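(* Let $f:\mathbb{R}^{n_1\times\cdots\times n_d}\to\mathbb{R}$ be smooth and let $\{\mathcal{X}^{(t)}\}_{t\ge0}\subseteq\mathcal{M}_{\le\mathbf{r}}$ be an infinite sequence generated by the Tucker rank-adaptive method (TRAM) described in the context. Assume that $f$ is bounded below by $f^*$. Then $$\liminf_{t\to\infty}\|\mathrm{P}_{\mathrm{T}_{\mathcal{X}^{(t)}}\mathcal{M}_{\le\mathbf{r}}}(-\nabla f(\mathcal{X}^{(t)}))\|_{\mathrm F}=0.$$
   Context: Tensor notation. $\mathrm{St}(p,n)=\{\mathbf{X}\in\mathbb{R}^{n\times p}:\mathbf{X}^{\mathsf T}\mathbf{X}=\mathbf{I}_p\}$. $\mathbf{X}_{(k)}\in\mathbb{R}^{n_k\times n_{-k}}$, $n_{-k}=\prod_{i\ne k}n_i$, is the mode-$k$ unfolding, $(\mathcal{X}\times_k\mathbf{A})_{(k)}=\mathbf{A}\mathbf{X}_{(k)}$, $\mathrm{rank}_{\mathrm{tc}}(\mathcal{X})=(\mathrm{rank}\,\mathbf{X}_{(1)},\dots,\mathrm{rank}\,\mathbf{X}_{(d)})$. $\mathbf{r}$ is a vector of positive integers with $r_k\le n_k$; $\mathcal{M}_{\le\mathbf{r}}=\{\mathcal{X}:\mathrm{rank}_{\mathrm{tc}}(\mathcal{X})\le\mathbf{r}\}$ (componentwise), and $\mathcal{M}_{\mathbf{q}}=\{\mathcal{X}:\mathrm{rank}_{\mathrm{tc}}(\mathcal{X})=\mathbf{q}\}$ is a smooth embedded submanifold; for $\mathcal{X}\in\mathcal{M}_{\mathbf{q}}$,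 $\mathrm{grad} f(\mathcal{X})=\mathrm{P}_{\mathrm{T}_{\mathcal{X}}\mathcal{M}_{\mathbf{q}}}(\nabla f(\mathcal{X}))$ (orthogonal projection onto the tangent space) is the Riemannian gradient. $\mathrm{T}_{\mathcal{X}}\mathcal{M}_{\le\mathbf{r}}$ is the Bouligand tangent cone (limits of $(\mathcal{X}^{(i)}-\mathcal{X})/t^{(i)}$ with $\mathcal{X}^{(i)}\in\mathcal{M}_{\le\mathbf{r}}$, $\mathcal{X}^{(i)}\to\mathcal{X}$, $t^{(i)}>0$, $t^{(i)}\to0$) and $\mathrm{P}_{\mathrm{T}_{\mathcal{X}}\mathcal{M}_{\le\mathbf{r}}}(\mathcal{A})$ is a (any) Frobenius-nearest point of it to $\mathcal{A}$. $\mathrm{P}_{\mathbf{S}}=\mathbf{S}\mathbf{S}^{\mathsf T}$, $\mathrm{P}_{\mathbf{S}}^\perp=\mathbf{I}-\mathbf{S}\mathbf{S}^{\mathsf T}$ for matrices $\mathbf S$ with orthonormal columns. HOSVD. $\mathrm{P}^{\mathrm{HO}}_{\le\mathbf{q}}(\mathcal{A})=\mathcal{A}\times_{k=1}^d\bar{\mathbf{U}}_k\bar{\mathbf{U}}_k^{\mathsf T}$, with $\bar{\mathbf{U}}_k\in\mathrm{St}(q_k,n_k)$ consisting of leading $q_k$ left singular vectors of $\mathbf{A}_{(k)}$. Approximate projection. For $\mathcal{X}=\mathcal{G}\times_{k=1}^d\mathbf{U}_k$ of Tucker rank $\underline{\mathbf{r}}\le\mathbf{r}$ ($\mathcal{G}\in\mathbb{R}^{\underline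 r_1\times\cdots\times\underline r_d}$, $\mathbf{U}_k\in\mathrm{St}(\underline r_k,n_k)$) and (randomly) chosen $\tilde{\mathbf{U}}_{k,1}\in\mathrm{St}(r_k-\underline r_k,n_k)$ with $\mathbf{U}_k^{\mathsf T}\tilde{\mathbf{U}}_{k,1}=0$, $\tilde{\mathbf{S}}_k=[\mathbf{U}_k\ \tilde{\mathbf{U}}_{k,1}]$: $\tilde{\mathrm P}_{\mathrm{T}_{\mathcal{X}}\mathcal{M}_{\le\mathbf{r}}}\mathcal{A}=\mathcal{A}\times_{k=1}^d\mathrm{P}_{\tilde{\mathbf{S}}_k}+\sum_{k=1}^d\mathcal{G}\times_k\big(\mathrm{P}^\perp_{\tilde{\mathbf{S}}_k}(\mathcal{A}\times_{j\ne k}\mathbf{U}_j^{\mathsf T})_{(k)}\mathbf{G}_{(k)}^\dagger\big)\times_{j\ne k}\mathbf{U}_j$, where $\dagger$ is the Moore–Penrose pseudoinverse. Line search. Parameters $\rho,a\in(0,1)$, $s_{\min}>0$. "Armijo stepsize from $\mathcal{X}$ along $g$ with update map $\Phi$" means $s=\rho^l s_0>s_{\min}$ ($s_0>0$ a given initial stepsize, $l$ the smallest integer) with $f(\mathcal{X})-f(\Phi(\mathcal{X}+sg))\ge s\,a\,\langle-\nabla f(\mathcal{X}),g\rangle$; existence of all required stepsizes is part of the assumption that the sequence is generated by the method. TRAM. Parameters: $\varepsilon_R^{(0)}>0$, $\rho_R\in(0,1)$, $\varepsilon_1,\varepsilon_2>0$, $\Delta\in(0,1)$, $\rho_1\in(0,1)$,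 $\omega\in(0,1]$, and rank-increasing parameters $\{\boldsymbol{\ell}^{(t)}\}_{t\ge0}$, where $\boldsymbol{\ell}^{(t)}$ is a vector of $d$ positive integers with $\boldsymbol{\ell}^{(t)}\le\mathbf{r}-\underline{\mathbf{r}}^{(t)}$ whenever it is used. Start with $\tilde{\mathcal{X}}^{(0)}\in\mathcal{M}_{\le\mathbf{r}}$. For $t=0,1,\dots$, with $\underline{\mathbf{r}}^{(t)}=\mathrm{rank}_{\mathrm{tc}}(\tilde{\mathcal{X}}^{(t)})$: (1) Riemannian gradient descent on $\mathcal{M}_{\underline{\mathbf{r}}^{(t)}}$: $\mathcal{Y}^{(0)}=\tilde{\mathcal{X}}^{(t)}$, $\mathcal{Y}^{(i+1)}=\mathrm{P}^{\mathrm{HO}}_{\le\underline{\mathbf{r}}^{(t)}}(\mathcal{Y}^{(i)}-s^{(i)}\mathrm{grad} f(\mathcal{Y}^{(i)}))$ with Armijo stepsizes (update map $\mathrm{P}^{\mathrm{HO}}_{\le\underline{\mathbf{r}}^{(t)}}$), all iterates lying in $\mathcal{M}_{\underline{\mathbf{r}}^{(t)}}$. At each iterate one checks, in this order, and stops if (a) rank deficiency: for some $k$, the ratio of the $\underline r^{(t)}_k$-th to the first singular value of $\mathbf{Y}^{(i)}_{(k)}$ is $\le\Delta$; or (b) $\|\mathrm{grad} f(\mathcal{Y}^{(i)})\|_{\mathrm F}\le\varepsilon_R^{(t)}$. The procedure is assumed to stop after finitely many steps, and $\mathcal{X}^{(t)}$ is the last iterate. Put $\mathcal{T}^{(t)}=\mathrm{grad}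 f(\mathcal{X}^{(t)})$ and write $\mathcal{X}^{(t)}=\mathcal{G}^{(t)}\times_{k=1}^d\mathbf{U}_k^{(t)}$ (Tucker decomposition). (2) If stopped by (a): rank decrease. With $\sigma_{1,k}\ge\cdots\ge\sigma_{\underline r_k^{(t)},k}>0$ the singular values of $\mathbf{X}^{(t)}_{(k)}$ and $\Delta'=\Delta$, let $\hat r_k=\min\{i:\sigma_{i+1,k}<\Delta'\sigma_{1,k}\}$, or $\hat r_k=\underline r_k^{(t)}$ if $\sigma_{\underline r_k^{(t)},k}\ge\Delta'\sigma_{1,k}$; replace $\Delta'$ by $\rho_1\Delta'$ until $f(\mathrm{P}^{\mathrm{HO}}_{\le\hat{\mathbf{r}}}(\mathcal{X}^{(t)}))\le f(\mathcal{X}^{(t)})$; set $\tilde{\mathcal{X}}^{(t+1)}=\mathrm{P}^{\mathrm{HO}}_{\le\hat{\mathbf{r}}}(\mathcal{X}^{(t)})$. If $\mathrm{rank}_{\mathrm{tc}}(\tilde{\mathcal{X}}^{(t+1)})=\underline{\mathbf{r}}^{(t)}$, the method terminates (so this never happens for an infinite sequence). (3) If stopped by (b) and $\underline{\mathbf{r}}^{(t)}=\mathbf{r}$: set $\tilde{\mathcal{X}}^{(t+1)}=\mathcal{X}^{(t)}$ and $\varepsilon_R^{(t+1)}=\rho_R\varepsilon_R^{(t)}$. (4) If stopped by (b) and $\underline{\mathbf{r}}^{(t)}\ne\mathbf{r}$: select (randomly) $\mathbf{U}_{k,1}^{(t)}\in\mathrm{St}(\ell_k^{(t)},n_k)$ with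 $(\mathbf{U}_{k,1}^{(t)})^{\mathsf T}\mathbf{U}_k^{(t)}=0$, and let $\mathcal{N}^{(t)}=-\nabla f(\mathcal{X}^{(t)})\times_{k=1}^d\mathrm{P}_{\mathbf{U}_{k,1}^{(t)}}$. (4i) If $\|\mathcal{N}^{(t)}\|_{\mathrm F}\ge\varepsilon_1\|\mathcal{T}^{(t)}\|_{\mathrm F}$ and $\varepsilon_2\|\nabla f(\mathcal{X}^{(t)})\|_{\mathrm F}\le\|\mathcal{T}^{(t)}\|_{\mathrm F}$ (rank increase): $\tilde{\mathcal{X}}^{(t+1)}=\mathcal{X}^{(t)}+s\,\mathcal{N}^{(t)}$ with an Armijo stepsize (update map the identity). (4ii) Else if $\varepsilon_2\|\nabla f(\mathcal{X}^{(t)})\|_{\mathrm F}>\|\mathcal{T}^{(t)}\|_{\mathrm F}$ (restart): $\tilde{\mathcal{X}}^{(t+1)}=\mathrm{P}^{\mathrm{HO}}_{\le\mathbf{r}}(\mathcal{X}^{(t)}+s^{(t)}g^{(t)})$ with an Armijo stepsize (update map $\mathrm{P}^{\mathrm{HO}}_{\le\mathbf{r}}$), where $g^{(t)}=\tilde{\mathrm P}_{\mathrm{T}_{\mathcal{X}^{(t)}}\mathcal{M}_{\le\mathbf{r}}}(-\nabla f(\mathcal{X}^{(t)}))$ is computed, repeating with other choices of the $\tilde{\mathbf{U}}_{k,1}$, until the angle condition $\langle-\nabla f(\mathcal{X}^{(t)}),g^{(t)}\rangle\ge\omega\|\mathrm{P}_{\mathrm{T}_{\mathcal{X}^{(t)}}\mathcal{M}_{\le\mathbf{r}}}(-\nabla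 f(\mathcal{X}^{(t)}))\|_{\mathrm F}\|g^{(t)}\|_{\mathrm F}$ holds. (4iii) Otherwise: $\tilde{\mathcal{X}}^{(t+1)}=\mathcal{X}^{(t)}$ and $\varepsilon_R^{(t+1)}=\rho_R\varepsilon_R^{(t)}$. In all cases where it is not explicitly changed, $\varepsilon_R^{(t+1)}=\varepsilon_R^{(t)}$.
   Formalization: In the restart step the angle condition additionally requires that a zero direction g is accepted only if the projection of the negative gradient onto the tangent cone is zero; without this, g = 0 passes the inequality trivially and the claim fails. *)

theory Defs
  imports "HOL-Analysis.Analysis" "Jordan_Normal_Form.DL_Rank"
begin

section \<open>Calculus and geometry in Euclidean spaces\<close>

fun times_diff_on :: "nat \<Rightarrow> 'a::real_normed_vector set \<Rightarrow> ('a \<Rightarrow> 'b::real_normed_vector) \<Rightarrow> bool" where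
  "times_diff_on 0 S f \<longleftrightarrow> continuous_on S f"
| "times_diff_on (Suc k) S f \<longleftrightarrow>
     (\<forall>x\<in>S. f differentiable (at x)) \<and> (\<forall>v. times_diff_on k S (\<lambda>x. frechet_derivative f (at x) v))"

text \<open>Only meaningful for open \<open>S\<close>, since the derivatives are taken in the full neighbourhood.\<close>

definition smooth_on :: "'a::real_normed_vector set \<Rightarrow> ('a \<Rightarrow> 'b::real_normed_vector) \<Rightarrow> bool" where
  "smooth_on S f \<longleftrightarrow> (\<forall>k. times_diff_on k S f)"

definition gradient :: "('a::real_inner \<Rightarrow> real) \<Rightarrow> 'a \<Rightarrow> 'a" where
  "gradient f x = (THE D. GDERIV f x :> D)"

definition tangent_cone :: "'a::real_normed_vector set \<Rightarrow> 'a \<Rightarrow> 'a set" where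
  "tangent_cone S x = {v. \<exists>y \<tau>. (\<forall>i. y i \<in> S) \<and> y \<longlonglongrightarrow> x \<and>
      (\<forall>i. \<tau> i > 0) \<and> \<tau> \<longlonglongrightarrow> (0::real) \<and> (\<lambda>i. (y i - x) /\<^sub>R \<tau> i) \<longlonglongrightarrow> v}"

text \<open>The tangent space of an embedded submanifold: the velocities of the smooth curves in it.\<close>

definition tangent_space :: "'a::real_normed_vector set \<Rightarrow> 'a \<Rightarrow> 'a set" where
  "tangent_space M x = {v. \<exists>\<gamma> \<delta>. \<delta> > (0::real) \<and> smooth_on {-\<delta><..<\<delta>} \<gamma> \<and>
      \<gamma> ` {-\<delta><..<\<delta>} \<subseteq> M \<and> \<gamma> 0 = x \<and> (\<gamma> has_vector_derivative v) (at 0)}"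

definition orth_proj :: "'a::real_inner set \<Rightarrow> 'a \<Rightarrow> 'a" where
  "orth_proj V a = (THE p. p \<in> V \<and> (\<forall>w\<in>V. inner (a - p) w = 0))"

definition nearest_points :: "'a::metric_space set \<Rightarrow> 'a \<Rightarrow> 'a set" where
  "nearest_points S a = {p \<in> S. \<forall>y\<in>S. dist a p \<le> dist a y}"


section \<open>Matrices\<close>

definition stiefel :: "nat \<Rightarrow> nat \<Rightarrow> real mat set" where
  "stiefel p n = {U \<in> carrier_mat n p. transpose_mat U * U = 1\<^sub>m p}"

definition proj_mat :: "real mat \<Rightarrow> real mat" where
  "proj_mat S = S * transpose_mat S"

definition perp_mat :: "real mat \<Rightarrow> real mat" where
  "perp_mat S = 1\<^sub>m (dim_row S) - S * transpose_mat S"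

text \<open>The full decomposition (square \<open>U\<close>), so that \<open>q\<close> leading left singular vectors exist for every
  \<open>q \<le> dim_row M\<close>, even beyond the number of columns.\<close>

definition is_svd :: "real mat \<Rightarrow> real mat \<Rightarrow> real mat \<Rightarrow> real mat \<Rightarrow> bool" where
  "is_svd M U S V \<longleftrightarrow>
     U \<in> stiefel (dim_row M) (dim_row M) \<and> V \<in> stiefel (dim_col M) (dim_col M) \<and>
     S \<in> carrier_mat (dim_row M) (dim_col M) \<and>
     (\<forall>i<dim_row M. \<forall>j<dim_col M. i \<noteq> j \<longrightarrow> S $$ (i, j) = 0) \<and>
     (\<forall>i<min (dim_row M) (dim_col M). S $$ (i, i) \<ge> 0) \<and>
     (\<forall>i j. i \<le> j \<and> j < min (dim_row M) (dim_col M) \<longrightarrow> S $$ (j, j) \<le> S $$ (i, i)) \<and>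
     M = U * S * transpose_mat V"

text \<open>Singular values are counted from 1, while matrix indices start at 0.\<close>

definition singular_value :: "real mat \<Rightarrow> nat \<Rightarrow> real" where
  "singular_value M i = (THE s. \<exists>U S V. is_svd M U S V \<and> s = S $$ (i - 1, i - 1))"

definition leading_left_singular :: "nat \<Rightarrow> real mat \<Rightarrow> real mat set" where
  "leading_left_singular q M =
     {W. \<exists>U S V. is_svd M U S V \<and> W = mat (dim_row M) q (\<lambda>(i, j). U $$ (i, j))}"

definition pinv :: "real mat \<Rightarrow> real mat" where
  "pinv M = (THE P. P \<in> carrier_mat (dim_col M) (dim_row M) \<and>
     M * P * M = M \<and> P * M * P = P \<and>
     transpose_mat (M * P) = M * P \<and> transpose_mat (P * M) = P * M)"


section \<open>Arrays, unfoldings and mode products\<close>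

text \<open>The modes are the elements of a finite type \<open>'d\<close> (so \<open>d = CARD('d)\<close>), and multi-indices are
  0-based. An array of size \<open>m\<close> is only ever read at the multi-indices in \<open>multi_indices m\<close>.\<close>

type_synonym 'd array = "('d \<Rightarrow> nat) \<Rightarrow> real"

definition multi_indices :: "('d \<Rightarrow> nat) \<Rightarrow> ('d \<Rightarrow> nat) set" where
  "multi_indices m = {i. \<forall>k. i k < m k}"

text \<open>The columns of the mode-\<open>k\<close> unfolding are labelled by the multi-indices of the other modes
  (with a dummy 0 in mode \<open>k\<close>), in a fixed order. The choice of this order is immaterial.\<close>

definition col_set :: "'d \<Rightarrow> ('d \<Rightarrow> nat) \<Rightarrow> ('d \<Rightarrow> nat) set" where
  "col_set k m = {i. i k = 0 \<and> (\<forall>j. j \<noteq> k \<longrightarrow> i j < m j)}"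

definition num_cols :: "'d::finite \<Rightarrow> ('d \<Rightarrow> nat) \<Rightarrow> nat" where
  "num_cols k m = (\<Prod>j\<in>-{k}. m j)"

definition col_enum :: "'d::finite \<Rightarrow> ('d \<Rightarrow> nat) \<Rightarrow> nat \<Rightarrow> 'd \<Rightarrow> nat" where
  "col_enum k m = (SOME e. bij_betw e {..<num_cols k m} (col_set k m))"

definition unfolding_mat :: "'d::finite \<Rightarrow> ('d \<Rightarrow> nat) \<Rightarrow> 'd array \<Rightarrow> real mat" where
  "unfolding_mat k m T = mat (m k) (num_cols k m) (\<lambda>(a, c). T ((col_enum k m c)(k := a)))"

definition mode_prod :: "'d \<Rightarrow> real mat \<Rightarrow> 'd array \<Rightarrow> 'd array" where
  "mode_prod k A T = (\<lambda>i. \<Sum>j<dim_col A. A $$ (i k, j) * T (i(k := j)))"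

text \<open>The successive mode products \<open>T \<times>\<^sub>k A\<^sub>k\<close> over all \<open>k \<in> K\<close>. Products in different modes commute.\<close>

definition mode_prods :: "('d::finite \<Rightarrow> real mat) \<Rightarrow> 'd set \<Rightarrow> 'd array \<Rightarrow> 'd array" where
  "mode_prods A K T = Finite_Set.fold (\<lambda>k. mode_prod k (A k)) T K"

lemma card_col_set:
  fixes k :: "'d::finite"
  shows "finite (col_set k m)" "card (col_set k m) = num_cols k m"
proof -
  have eq: "col_set k m = PiE UNIV (\<lambda>j. if j = k then {0} else {..<m j})"
  proof (rule Set.set_eqI)
    fix i :: "'d \<Rightarrow> nat"
    have "i \<in> col_set k m \<longleftrightarrow> (\<forall>j. (j = k \<longrightarrow> i j = 0) \<and> (j \<noteq> k \<longrightarrow> i j < m j))"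
      unfolding col_set_def by auto
    also have "\<dots> \<longleftrightarrow> (\<forall>j. i j \<in> (if j = k then {0} else {..<m j}))"
      by (intro iff_allI) auto
    finally show "i \<in> col_set k m \<longleftrightarrow> i \<in> PiE UNIV (\<lambda>j. if j = k then {0} else {..<m j})"
      by (simp only: PiE_iff extensional_UNIV) simp
  qed
  show "finite (col_set k m)" unfolding eq by (rule finite_PiE) auto
  have "card (col_set k m) = (\<Prod>j\<in>UNIV. card (if j = k then {0} else {..<m j}))"
    unfolding eq by (rule card_PiE) simp
  also have "\<dots> = (\<Prod>j\<in>insert k (-{k}). card (if j = k then {0} else {..<m j}))"
    by (rule prod.cong) auto
  also have "\<dots> = (\<Prod>j\<in>-{k}. card (if j = k then {0} else {..<m j}))"
    by (subst prod.insert) auto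
  also have "\<dots> = num_cols k m"
    unfolding num_cols_def by (rule prod.cong) auto
  finally show "card (col_set k m) = num_cols k m" .
qed

lemma bij_betw_col_enum: "bij_betw (col_enum k m) {..<num_cols k m} (col_set k m)"
proof -
  have "\<exists>e. bij_betw e {..<num_cols k m} (col_set k m)"
    using ex_bij_betw_nat_finite[OF card_col_set(1)[of k m]] card_col_set(2)[of k m]
    by (simp add: atLeast0LessThan)
  then show ?thesis unfolding col_enum_def by (rule someI_ex)
qed

lemma comp_fun_commute_mode_prod: "comp_fun_commute (\<lambda>k. mode_prod k (A k))"
proof
  fix j k
  show "mode_prod j (A j) \<circ> mode_prod k (A k) = mode_prod k (A k) \<circ> mode_prod j (A j)"
  proof (cases "j = k")
    case False
    show ?thesis
    proof (intro ext)
      fix T i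
      have "(mode_prod j (A j) \<circ> mode_prod k (A k)) T i
          = (\<Sum>a<dim_col (A j). \<Sum>b<dim_col (A k).
               A j $$ (i j, a) * A k $$ (i k, b) * T (i(j := a, k := b)))"
        using False by (simp add: mode_prod_def sum_distrib_left mult.assoc)
      also have "\<dots> = (\<Sum>b<dim_col (A k). \<Sum>a<dim_col (A j).
               A j $$ (i j, a) * A k $$ (i k, b) * T (i(j := a, k := b)))"
        by (rule sum.swap)
      also have "\<dots> = (mode_prod k (A k) \<circ> mode_prod j (A j)) T i"
        using False by (simp add: mode_prod_def sum_distrib_left mult.assoc mult.left_commute
            fun_upd_twist)
      finally show "(mode_prod j (A j) \<circ> mode_prod k (A k)) T i
          = (mode_prod k (A k) \<circ> mode_prod j (A j)) T i" .
    qed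
  qed simp
qed

lemma mode_prods_empty [simp]: "mode_prods A {} T = T"
  by (simp add: mode_prods_def)

lemma mode_prods_insert:
  assumes "k \<notin> K"
  shows "mode_prods A (insert k K) T = mode_prod k (A k) (mode_prods A K T)"
proof -
  interpret comp_fun_commute "\<lambda>k. mode_prod k (A k)"
    by (rule comp_fun_commute_mode_prod)
  show ?thesis using assms by (simp add: mode_prods_def)
qed

lemma unfolding_mat_mode_prod:
  assumes "dim_col A = m k"
  shows "unfolding_mat k (m(k := dim_row A)) (mode_prod k A T) = A * unfolding_mat k m T"
proof -
  have 1: "num_cols k (m(k := b)) = num_cols k m" for b
    unfolding num_cols_def by (rule prod.cong) auto
  have 2: "col_set k (m(k := b)) = col_set k m" for b
    by (auto simp: col_set_def)
  have 3: "col_enum k (m(k := b)) = col_enum k m" for b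
    by (simp add: col_enum_def 1 2)
  show ?thesis
    by (rule eq_matI)
      (auto simp: unfolding_mat_def 1 3 mode_prod_def assms scalar_prod_def atLeast0LessThan
        intro!: sum.cong)
qed


section \<open>The tensor space\<close>

text \<open>A type cannot depend on the sizes \<open>n\<close>. Hence the Euclidean space of all tensors of size \<open>n\<close> is
  rendered as \<open>real ^ 'm\<close>, where the finite type \<open>'m\<close> of positions is labelled by the multi-indices
  through a bijection \<open>ix\<close> from \<open>UNIV\<close> to \<open>multi_indices n\<close>. Its norm and inner product are the Frobenius ones.\<close>

definition array_of :: "('m::finite \<Rightarrow> 'd \<Rightarrow> nat) \<Rightarrow> real ^ 'm \<Rightarrow> 'd array" where
  "array_of ix X = (\<lambda>i. X $ inv_into UNIV ix i)"

definition tensor_of :: "('m::finite \<Rightarrow> 'd \<Rightarrow> nat) \<Rightarrow> 'd array \<Rightarrow> real ^ 'm" where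
  "tensor_of ix T = (\<chi> p. T (ix p))"

definition tensor_prods ::
  "('m::finite \<Rightarrow> 'd::finite \<Rightarrow> nat) \<Rightarrow> ('d \<Rightarrow> real mat) \<Rightarrow> real ^ 'm \<Rightarrow> real ^ 'm" where
  "tensor_prods ix A X = tensor_of ix (mode_prods A UNIV (array_of ix X))"

definition tensor_unfolding ::
  "('m::finite \<Rightarrow> 'd::finite \<Rightarrow> nat) \<Rightarrow> ('d \<Rightarrow> nat) \<Rightarrow> 'd \<Rightarrow> real ^ 'm \<Rightarrow> real mat" where
  "tensor_unfolding ix n k X = unfolding_mat k n (array_of ix X)"

definition rank_tc ::
  "('m::finite \<Rightarrow> 'd::finite \<Rightarrow> nat) \<Rightarrow> ('d \<Rightarrow> nat) \<Rightarrow> real ^ 'm \<Rightarrow> 'd \<Rightarrow> nat" where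
  "rank_tc ix n X = (\<lambda>k. vec_space.rank (n k) (tensor_unfolding ix n k X))"

definition rank_le_set ::
  "('m::finite \<Rightarrow> 'd::finite \<Rightarrow> nat) \<Rightarrow> ('d \<Rightarrow> nat) \<Rightarrow> ('d \<Rightarrow> nat) \<Rightarrow> (real ^ 'm) set" where
  "rank_le_set ix n r = {X. \<forall>k. rank_tc ix n X k \<le> r k}"

definition rank_eq_set ::
  "('m::finite \<Rightarrow> 'd::finite \<Rightarrow> nat) \<Rightarrow> ('d \<Rightarrow> nat) \<Rightarrow> ('d \<Rightarrow> nat) \<Rightarrow> (real ^ 'm) set" where
  "rank_eq_set ix n q = {X. rank_tc ix n X = q}"

definition riem_grad ::
  "('m::finite \<Rightarrow> 'd::finite \<Rightarrow> nat) \<Rightarrow> ('d \<Rightarrow> nat) \<Rightarrow> (real ^ 'm \<Rightarrow> real) \<Rightarrow> real ^ 'm \<Rightarrow> real ^ 'm" where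
  "riem_grad ix n f X =
     orth_proj (tangent_space (rank_eq_set ix n (rank_tc ix n X)) X) (gradient f X)"

text \<open>Singular vectors are not unique, so the truncated HOSVD is set-valued: any choice is allowed.\<close>

definition hosvd ::
  "('m::finite \<Rightarrow> 'd::finite \<Rightarrow> nat) \<Rightarrow> ('d \<Rightarrow> nat) \<Rightarrow> ('d \<Rightarrow> nat) \<Rightarrow> real ^ 'm \<Rightarrow> (real ^ 'm) set" where
  "hosvd ix n q A = {Y. \<exists>U. (\<forall>k. U k \<in> leading_left_singular (q k) (tensor_unfolding ix n k A)) \<and>
      Y = tensor_prods ix (\<lambda>k. proj_mat (U k)) A}"

definition tucker_decomp ::
  "('m::finite \<Rightarrow> 'd::finite \<Rightarrow> nat) \<Rightarrow> ('d \<Rightarrow> nat) \<Rightarrow> ('d \<Rightarrow> nat) \<Rightarrow> real ^ 'm \<Rightarrow>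
     'd array \<Rightarrow> ('d \<Rightarrow> real mat) \<Rightarrow> bool" where
  "tucker_decomp ix n q X G U \<longleftrightarrow>
     (\<forall>k. U k \<in> stiefel (q k) (n k)) \<and> X = tensor_of ix (mode_prods U UNIV G)"

text \<open>The approximate projection of \<open>A\<close> at the tensor with core \<open>G\<close> of size \<open>q\<close> and factors \<open>U\<close>; the
  additional columns \<open>W k\<close> extend the factors to \<open>S k = [U k  W k]\<close>.\<close>

definition approx_proj ::
  "('m::finite \<Rightarrow> 'd::finite \<Rightarrow> nat) \<Rightarrow> ('d \<Rightarrow> nat) \<Rightarrow> ('d \<Rightarrow> nat) \<Rightarrow>
     'd array \<Rightarrow> ('d \<Rightarrow> real mat) \<Rightarrow> ('d \<Rightarrow> real mat) \<Rightarrow> real ^ 'm \<Rightarrow> real ^ 'm" where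
  "approx_proj ix n q G U W A =
    (let S = (\<lambda>k. mat_of_cols (n k) (cols (U k) @ cols (W k)))
     in tensor_prods ix (\<lambda>k. proj_mat (S k)) A +
        (\<Sum>k\<in>UNIV.
           let B = unfolding_mat k (q(k := n k))
                     (mode_prods (\<lambda>j. transpose_mat (U j)) (-{k}) (array_of ix A));
               R = perp_mat (S k) * B * pinv (unfolding_mat k q G)
           in tensor_of ix (mode_prods U (-{k}) (mode_prod k R G))))"


section \<open>The Tucker rank-adaptive method\<close>

text \<open>\<open>Y\<close> is the point obtained from \<open>X\<close> along \<open>g\<close> with an Armijo stepsize and the (set-valued) update
  map \<open>\<Phi>\<close>; all trial stepsizes before the accepted one have been rejected.\<close>

definition armijo_accept ::
  "('a::real_inner \<Rightarrow> real) \<Rightarrow> real \<Rightarrow> 'a \<Rightarrow> 'a \<Rightarrow> real \<Rightarrow> 'a \<Rightarrow> bool" where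
  "armijo_accept f a X g s Y \<longleftrightarrow> f X - f Y \<ge> s * a * inner (- gradient f X) g"

definition armijo_step ::
  "('a::real_inner \<Rightarrow> real) \<Rightarrow> real \<Rightarrow> real \<Rightarrow> real \<Rightarrow> ('a \<Rightarrow> 'a set) \<Rightarrow> 'a \<Rightarrow> 'a \<Rightarrow> 'a \<Rightarrow> bool" where
  "armijo_step f \<rho> a s\<^sub>m\<^sub>i\<^sub>n \<Phi> X g Y \<longleftrightarrow>
     (\<exists>s\<^sub>0 > 0. \<exists>l::nat. \<rho> ^ l * s\<^sub>0 > s\<^sub>m\<^sub>i\<^sub>n \<and>
        Y \<in> \<Phi> (X + (\<rho> ^ l * s\<^sub>0) *\<^sub>R g) \<and> armijo_accept f a X g (\<rho> ^ l * s\<^sub>0) Y \<and>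
        (\<forall>l'<l. \<exists>Z \<in> \<Phi> (X + (\<rho> ^ l' * s\<^sub>0) *\<^sub>R g). \<not> armijo_accept f a X g (\<rho> ^ l' * s\<^sub>0) Z))"

text \<open>If the rank is 0, there is no singular value to compare.\<close>

definition rank_deficient ::
  "('m::finite \<Rightarrow> 'd::finite \<Rightarrow> nat) \<Rightarrow> ('d \<Rightarrow> nat) \<Rightarrow> real \<Rightarrow> real ^ 'm \<Rightarrow> bool" where
  "rank_deficient ix n \<Delta> Y \<longleftrightarrow>
     (\<exists>k. rank_tc ix n Y k \<ge> 1 \<and>
        singular_value (tensor_unfolding ix n k Y) (rank_tc ix n Y k) /
        singular_value (tensor_unfolding ix n k Y) 1 \<le> \<Delta>)"

text \<open>\<open>X\<close> is the last iterate of Riemannian gradient descent started at \<open>X0\<close> on the tensors of the rank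
  of \<open>X0\<close>.\<close>

definition rgd_result ::
  "('m::finite \<Rightarrow> 'd::finite \<Rightarrow> nat) \<Rightarrow> ('d \<Rightarrow> nat) \<Rightarrow> (real ^ 'm \<Rightarrow> real) \<Rightarrow>
     real \<Rightarrow> real \<Rightarrow> real \<Rightarrow> real \<Rightarrow> real \<Rightarrow> real ^ 'm \<Rightarrow> real ^ 'm \<Rightarrow> bool" where
  "rgd_result ix n f \<rho> a s\<^sub>m\<^sub>i\<^sub>n \<Delta> \<epsilon> X0 X \<longleftrightarrow>
     (\<exists>Y N. Y 0 = X0 \<and> Y N = X \<and>
        (\<forall>i\<le>N. Y i \<in> rank_eq_set ix n (rank_tc ix n X0)) \<and>
        (\<forall>i<N. \<not> rank_deficient ix n \<Delta> (Y i) \<and> \<not> norm (riem_grad ix n f (Y i)) \<le> \<epsilon> \<and>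
           armijo_step f \<rho> a s\<^sub>m\<^sub>i\<^sub>n (hosvd ix n (rank_tc ix n X0))
             (Y i) (- riem_grad ix n f (Y i)) (Y (Suc i))) \<and>
        (rank_deficient ix n \<Delta> X \<or> norm (riem_grad ix n f X) \<le> \<epsilon>))"

definition reduced_rank ::
  "('m::finite \<Rightarrow> 'd::finite \<Rightarrow> nat) \<Rightarrow> ('d \<Rightarrow> nat) \<Rightarrow> real \<Rightarrow> real ^ 'm \<Rightarrow> 'd \<Rightarrow> nat" where
  "reduced_rank ix n \<Delta> X = (\<lambda>k.
     let \<sigma> = singular_value (tensor_unfolding ix n k X); q = rank_tc ix n X k
     in if \<sigma> q \<ge> \<Delta> * \<sigma> 1 then q else (LEAST i. \<sigma> (Suc i) < \<Delta> * \<sigma> 1))"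

definition rank_decrease_step ::
  "('m::finite \<Rightarrow> 'd::finite \<Rightarrow> nat) \<Rightarrow> ('d \<Rightarrow> nat) \<Rightarrow> (real ^ 'm \<Rightarrow> real) \<Rightarrow>
     real \<Rightarrow> real \<Rightarrow> real ^ 'm \<Rightarrow> real ^ 'm \<Rightarrow> bool" where
  "rank_decrease_step ix n f \<Delta> \<rho>\<^sub>1 X Y \<longleftrightarrow>
     (\<exists>j::nat. Y \<in> hosvd ix n (reduced_rank ix n (\<rho>\<^sub>1 ^ j * \<Delta>) X) X \<and> f Y \<le> f X \<and>
        (\<forall>j'<j. \<exists>Z \<in> hosvd ix n (reduced_rank ix n (\<rho>\<^sub>1 ^ j' * \<Delta>) X) X. \<not> f Z \<le> f X))"

text \<open>The angle condition is a condition on the angle between \<open>- gradient f X\<close> and the direction \<open>g\<close>.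
  In its multiplied-out form it would be void for \<open>g = 0\<close>, where there is no angle; a vanishing
  direction is accepted only if the projection onto the tangent cone vanishes as well. The norm of a
  nearest point \<open>Q\<close> of the tangent cone does not depend on the choice of \<open>Q\<close>.\<close>

definition angle_condition ::
  "('m::finite \<Rightarrow> 'd::finite \<Rightarrow> nat) \<Rightarrow> ('d \<Rightarrow> nat) \<Rightarrow> ('d \<Rightarrow> nat) \<Rightarrow> (real ^ 'm \<Rightarrow> real) \<Rightarrow>
     real \<Rightarrow> real ^ 'm \<Rightarrow> real ^ 'm \<Rightarrow> bool" where
  "angle_condition ix n r f \<omega> X g \<longleftrightarrow>
     (\<exists>Q \<in> nearest_points (tangent_cone (rank_le_set ix n r) X) (- gradient f X).
        inner (- gradient f X) g \<ge> \<omega> * norm Q * norm g \<and> (g = 0 \<longrightarrow> Q = 0))"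

definition restart_step ::
  "('m::finite \<Rightarrow> 'd::finite \<Rightarrow> nat) \<Rightarrow> ('d \<Rightarrow> nat) \<Rightarrow> ('d \<Rightarrow> nat) \<Rightarrow> (real ^ 'm \<Rightarrow> real) \<Rightarrow>
     real \<Rightarrow> real \<Rightarrow> real \<Rightarrow> real \<Rightarrow> 'd array \<Rightarrow> ('d \<Rightarrow> real mat) \<Rightarrow> real ^ 'm \<Rightarrow> real ^ 'm \<Rightarrow> bool" where
  "restart_step ix n r f \<rho> a s\<^sub>m\<^sub>i\<^sub>n \<omega> G U X Y \<longleftrightarrow>
     (\<exists>W. (\<forall>k. W k \<in> stiefel (r k - rank_tc ix n X k) (n k) \<and>
              transpose_mat (U k) * W k = 0\<^sub>m (rank_tc ix n X k) (r k - rank_tc ix n X k)) \<and>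
        (let g = approx_proj ix n (rank_tc ix n X) G U W (- gradient f X)
         in angle_condition ix n r f \<omega> X g \<and>
            armijo_step f \<rho> a s\<^sub>m\<^sub>i\<^sub>n (hosvd ix n r) X g Y))"

text \<open>One iteration after Riemannian gradient descent has returned \<open>X\<close>: the next starting point is
  \<open>X'\<close>, and the tolerance changes from \<open>\<epsilon>\<close> to \<open>\<epsilon>'\<close>. The rank of \<open>X\<close> equals the rank of the
  starting point of this iteration.\<close>

definition tram_update ::
  "('m::finite \<Rightarrow> 'd::finite \<Rightarrow> nat) \<Rightarrow> ('d \<Rightarrow> nat) \<Rightarrow> ('d \<Rightarrow> nat) \<Rightarrow> (real ^ 'm \<Rightarrow> real) \<Rightarrow>
     real \<Rightarrow> real \<Rightarrow> real \<Rightarrow> real \<Rightarrow> real \<Rightarrow> real \<Rightarrow> real \<Rightarrow> real \<Rightarrow> real \<Rightarrow> ('d \<Rightarrow> nat) \<Rightarrow>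
     real ^ 'm \<Rightarrow> real \<Rightarrow> real ^ 'm \<Rightarrow> real \<Rightarrow> bool" where
  "tram_update ix n r f \<rho> a s\<^sub>m\<^sub>i\<^sub>n \<rho>\<^sub>R \<epsilon>\<^sub>1 \<epsilon>\<^sub>2 \<Delta> \<rho>\<^sub>1 \<omega> \<l> X \<epsilon> X' \<epsilon>' \<longleftrightarrow>
    (let q = rank_tc ix n X; T = riem_grad ix n f X in
     if rank_deficient ix n \<Delta> X then
       rank_decrease_step ix n f \<Delta> \<rho>\<^sub>1 X X' \<and> rank_tc ix n X' \<noteq> q \<and> \<epsilon>' = \<epsilon>
     else if q = r then
       X' = X \<and> \<epsilon>' = \<rho>\<^sub>R * \<epsilon>
     else
       (\<forall>k. q k + \<l> k \<le> r k) \<and>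
       (\<exists>G U V. tucker_decomp ix n q X G U \<and>
          (\<forall>k. V k \<in> stiefel (\<l> k) (n k) \<and> transpose_mat (V k) * U k = 0\<^sub>m (\<l> k) (q k)) \<and>
          (let N = tensor_prods ix (\<lambda>k. proj_mat (V k)) (- gradient f X) in
           if norm N \<ge> \<epsilon>\<^sub>1 * norm T \<and> \<epsilon>\<^sub>2 * norm (gradient f X) \<le> norm T then
             armijo_step f \<rho> a s\<^sub>m\<^sub>i\<^sub>n (\<lambda>Z. {Z}) X N X' \<and> \<epsilon>' = \<epsilon>
           else if \<epsilon>\<^sub>2 * norm (gradient f X) > norm T then
             restart_step ix n r f \<rho> a s\<^sub>m\<^sub>i\<^sub>n \<omega> G U X X' \<and> \<epsilon>' = \<epsilon>
           else
             X' = X \<and> \<epsilon>' = \<rho>\<^sub>R * \<epsilon>)))"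

definition tram_sequence ::
  "('m::finite \<Rightarrow> 'd::finite \<Rightarrow> nat) \<Rightarrow> ('d \<Rightarrow> nat) \<Rightarrow> ('d \<Rightarrow> nat) \<Rightarrow> (real ^ 'm \<Rightarrow> real) \<Rightarrow>
     real \<Rightarrow> real \<Rightarrow> real \<Rightarrow> real \<Rightarrow> real \<Rightarrow> real \<Rightarrow> real \<Rightarrow> real \<Rightarrow> real \<Rightarrow> real \<Rightarrow> (nat \<Rightarrow> 'd \<Rightarrow> nat) \<Rightarrow>
     (nat \<Rightarrow> real ^ 'm) \<Rightarrow> bool" where
  "tram_sequence ix n r f \<rho> a s\<^sub>m\<^sub>i\<^sub>n \<epsilon>\<^sub>0 \<rho>\<^sub>R \<epsilon>\<^sub>1 \<epsilon>\<^sub>2 \<Delta> \<rho>\<^sub>1 \<omega> \<l> X \<longleftrightarrow>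
     (\<exists>X0 \<epsilon>. X0 0 \<in> rank_le_set ix n r \<and> \<epsilon> 0 = \<epsilon>\<^sub>0 \<and>
        (\<forall>t. rgd_result ix n f \<rho> a s\<^sub>m\<^sub>i\<^sub>n \<Delta> (\<epsilon> t) (X0 t) (X t) \<and>
             tram_update ix n r f \<rho> a s\<^sub>m\<^sub>i\<^sub>n \<rho>\<^sub>R \<epsilon>\<^sub>1 \<epsilon>\<^sub>2 \<Delta> \<rho>\<^sub>1 \<omega> (\<l> t) (X t) (\<epsilon> t) (X0 (Suc t)) (\<epsilon> (Suc t))))"

end

theory Submission
  imports Defs
begin

text \<open>
  Riemannian gradient descent never increases \<open>f\<close>, nor does any update of the starting point. Since
  \<open>f\<close> is bounded below, the decreases \<open>f (X t) - f (X (Suc t))\<close> tend to 0. Each outer iteration does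
  one of three things (\<open>tram_update_cases\<close>):

  \<^item> it lowers the sum of the mode ranks;
  \<^item> it keeps the point and multiplies the tolerance by \<open>\<rho>\<^sub>R\<close>, and then the projected negative gradient
    \<open>P t\<close> is at most a constant times the old tolerance;
  \<^item> it increases the rank or restarts, and then \<open>f\<close> decreases by at least a constant times the square of
    \<open>norm (P t)\<close>.

  Suppose that \<open>norm (P t)\<close> stays above some positive number. The third kind of iteration then happens only
  finitely often. From then on the rank sum never increases, so the first kind also happens only
  finitely often, and afterwards the tolerance decays geometrically. By the bound in the second case \<open>P t\<close>
  tends to 0, a contradiction (\<open>liminf_eq_0_of_descent\<close>).

  The trichotomy rests on two facts of linear algebra, each saying that some search direction \<open>g\<close> computed from
  \<open>- gradient f X\<close> satisfies \<open>inner (- gradient f X) g = (norm g)\<^sup>2\<close>, so that the Armijo condition turns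
  the size of \<open>g\<close> into a decrease of \<open>f\<close>.

  \<^item> The tangent space of the tensors of fixed multilinear rank is a linear subspace, and it coincides with the
    Bouligand tangent cone of the tensors of at most that rank (\<open>tangent_space_rank_eq_set\<close>,
    \<open>tangent_cone_rank_le_set\<close>). Hence the Riemannian gradient really is an orthogonal projection, and at a
    point of full rank \<open>r\<close> its norm bounds that of \<open>P t\<close>. Both sets are compared with the tensors \<open>v\<close> such that
    every unfolding of \<open>v\<close> maps the kernel of the corresponding unfolding of \<open>X\<close> into its column space. Directions
    of the cone satisfy this condition because rank is lower semicontinuous
    (\<open>bounded_rank_tangent_direction\<close>); conversely, such \<open>v\<close> is the velocity of an explicit polynomial curve.
  \<^item> The direction of the restart step is an orthogonal projection of \<open>- gradient f X\<close>: its summands are pairwise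
    orthogonal and each is such a projection (\<open>inner_approx_proj\<close>). Together with the angle condition, this bounds
    the norm of the direction below by \<open>\<omega>\<close> times that of \<open>P t\<close>.
\<close>

section \<open>Real matrices with implicit dimensions\<close>

text \<open>The library laws for matrix products speak of carriers, whose dimensions a rewriter would have to guess. With
  equations between \<open>dim_row\<close> and \<open>dim_col\<close> as premises the same laws apply by rewriting.\<close>

lemma mat_mult_assoc:
  fixes A B C :: "real mat"
  assumes "dim_col A = dim_row B" "dim_col B = dim_row C"
  shows "A * B * C = A * (B * C)"
  using assms by (intro assoc_mult_mat[of _ "dim_row A" "dim_row B" _ "dim_row C" _ "dim_col C"]) auto

lemma mat_transpose_mult:
  fixes A B :: "real mat"
  assumes "dim_col A = dim_row B"
  shows "transpose_mat (A * B) = transpose_mat B * transpose_mat A"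
  using assms by (intro transpose_mult[of _ "dim_row A" "dim_row B" _ "dim_col B"]) auto

lemma mat_diff_mult:
  fixes A B C :: "real mat"
  assumes "dim_row A = dim_row B" "dim_col A = dim_col B" "dim_col B = dim_row C"
  shows "(A - B) * C = A * C - B * C"
  using assms by (intro minus_mult_distrib_mat[of _ "dim_row A" "dim_row C" _ _ "dim_col C"]) auto

lemma mat_mult_diff:
  fixes A B C :: "real mat"
  assumes "dim_row C = dim_row B" "dim_col C = dim_col B" "dim_row B = dim_col A"
  shows "A * (B - C) = A * B - A * C"
  using assms by (intro mult_minus_distrib_mat[of _ "dim_row A" "dim_row C" _ "dim_col C"]) auto

lemma mat_add_mult:
  fixes A B C :: "real mat"
  assumes "dim_row A = dim_row B" "dim_col A = dim_col B" "dim_col B = dim_row C"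
  shows "(A + B) * C = A * C + B * C"
  using assms by (intro add_mult_distrib_mat[of _ "dim_row A" "dim_row C" _ _ "dim_col C"]) auto

lemma mat_mult_add:
  fixes A B C :: "real mat"
  assumes "dim_row B = dim_row C" "dim_col B = dim_col C" "dim_col A = dim_row C"
  shows "A * (B + C) = A * B + A * C"
  using assms by (intro mult_add_distrib_mat[of _ "dim_row A" "dim_row C" _ "dim_col C"]) auto

lemma mat_diff_self: "A - A = 0\<^sub>m (dim_row A) (dim_col A)" for A :: "real mat"
  by (intro eq_matI) auto

lemma mat_diff_eq_0_imp_eq:
  fixes A B :: "real mat"
  assumes "A - B = 0\<^sub>m m k" "dim_row A = m" "dim_col A = k" "dim_row B = m" "dim_col B = k"
  shows "A = B"
proof (rule eq_matI)
  fix i j assume "i < dim_row B" "j < dim_col B"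
  then have "(A - B) $$ (i, j) = 0" using assms by simp
  then show "A $$ (i, j) = B $$ (i, j)" using \<open>i < dim_row B\<close> \<open>j < dim_col B\<close> by simp
qed (use assms in auto)

lemma index_mult_mat_sum:
  fixes A B :: "real mat"
  assumes "i < dim_row A" "j < dim_col B" "dim_col A = dim_row B"
  shows "(A * B) $$ (i, j) = (\<Sum>k<dim_row B. A $$ (i, k) * B $$ (k, j))"
  using assms by (auto simp: scalar_prod_def atLeast0LessThan intro!: sum.cong)

lemma gram_eq_0_imp_eq_0:
  fixes D :: "real mat"
  assumes "D * transpose_mat D = 0\<^sub>m (dim_row D) (dim_row D)"
  shows "D = 0\<^sub>m (dim_row D) (dim_col D)"
proof (rule eq_matI)
  fix i j assume ij: "i < dim_row (0\<^sub>m (dim_row D) (dim_col D) :: real mat)" "j < dim_col (0\<^sub>m (dim_row D) (dim_col D) :: real mat)"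
  have "(D * transpose_mat D) $$ (i, i) = (\<Sum>k<dim_col D. (D $$ (i, k))\<^sup>2)"
    using ij by (subst index_mult_mat_sum) (auto simp: power2_eq_square intro!: sum.cong)
  then have "(\<Sum>k<dim_col D. (D $$ (i, k))\<^sup>2) = 0" using assms ij by simp
  then have "(D $$ (i, j))\<^sup>2 = 0"
    using ij by (subst (asm) sum_nonneg_eq_0_iff) auto
  then show "D $$ (i, j) = 0\<^sub>m (dim_row D) (dim_col D) $$ (i, j)" using ij by simp
qed auto

lemma mult_gram_eq_0:
  fixes D M :: "real mat"
  assumes "D * transpose_mat M * M = 0\<^sub>m (dim_row D) (dim_col M)" "dim_col D = dim_col M"
  shows "D * transpose_mat M = 0\<^sub>m (dim_row D) (dim_row M)"
proof -
  let ?E = "D * transpose_mat M"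
  have "?E * transpose_mat ?E = ?E * M * transpose_mat D"
    using assms(2) by (simp add: mat_transpose_mult mat_mult_assoc)
  also have "\<dots> = 0\<^sub>m (dim_row D) (dim_row D)" unfolding assms(1)
    using assms(2) by (simp add: left_mult_zero_mat[of _ "dim_col M" "dim_row D"])
  finally show ?thesis using gram_eq_0_imp_eq_0[of ?E] by simp
qed

section \<open>Generalized inverses\<close>

text \<open>Wedderburn's rank reduction: if \<open>M $$ (i, j) \<noteq> 0\<close> and \<open>D\<close> has \<open>1 / M $$ (i, j)\<close> as its only nonzero
  entry, at \<open>(j, i)\<close>, then \<open>M - M * D * M\<close> has fewer nonzero rows than \<open>M\<close>, because the row \<open>i\<close> vanishes and zero
  rows stay zero. A generalized inverse \<open>Z\<close> of the difference yields \<open>(1 - D M) Z (1 - M D) + D\<close> for \<open>M\<close>.\<close>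

lemma ex_gen_inverse:
  fixes M :: "real mat"
  shows "\<exists>Z \<in> carrier_mat (dim_col M) (dim_row M). M * Z * M = M"
proof (induction "card {i. i < dim_row M \<and> (\<exists>j<dim_col M. M $$ (i, j) \<noteq> 0)}" arbitrary: M rule: less_induct)
  case less
  define m k where "m = dim_row M" and "k = dim_col M"
  show ?case
  proof (cases "\<exists>i j. i < m \<and> j < k \<and> M $$ (i, j) \<noteq> 0")
    case False
    then have "M = 0\<^sub>m m k" by (intro eq_matI) (auto simp: m_def k_def)
    then have "M * 0\<^sub>m k m * M = M" by simp
    then show ?thesis by (intro bexI[of _ "0\<^sub>m k m"]) (auto simp: m_def k_def)
  next
    case True
    then obtain i j where ij: "i < m" "j < k" "M $$ (i, j) \<noteq> 0" by auto
    define D where "D = mat k m (\<lambda>(b, a). if b = j \<and> a = i then 1 / M $$ (i, j) else 0)"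
    have dims [simp]: "dim_row M = m" "dim_col M = k" "dim_row D = k" "dim_col D = m"
      by (auto simp: m_def k_def D_def)
    define N where "N = M - M * D * M"
    have dimsN [simp]: "dim_row N = m" "dim_col N = k" by (auto simp: N_def)
    have MD: "(M * D) $$ (a, c) = (if c = i then M $$ (a, j) / M $$ (i, j) else 0)"
      if "a < m" "c < m" for a c
      using that ij by (subst index_mult_mat_sum) (auto simp: D_def sum.delta if_distrib cong: if_cong)
    have N: "N $$ (a, b) = M $$ (a, b) - M $$ (a, j) / M $$ (i, j) * M $$ (i, b)"
      if "a < m" "b < k" for a b
    proof -
      have "(M * D * M) $$ (a, b) = (\<Sum>c<m. (M * D) $$ (a, c) * M $$ (c, b))"
        using that by (subst index_mult_mat_sum) auto
      also have "\<dots> = (\<Sum>c<m. if c = i then M $$ (a, j) / M $$ (i, j) * M $$ (i, b) else 0)"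
        using that by (intro sum.cong) (auto simp: MD simp del: index_mult_mat(1))
      finally show ?thesis using that ij by (simp add: N_def)
    qed
    have "{a. a < m \<and> (\<exists>b<k. N $$ (a, b) \<noteq> 0)} \<subset> {a. a < m \<and> (\<exists>b<k. M $$ (a, b) \<noteq> 0)}"
    proof
      show "{a. a < m \<and> (\<exists>b<k. N $$ (a, b) \<noteq> 0)} \<subseteq> {a. a < m \<and> (\<exists>b<k. M $$ (a, b) \<noteq> 0)}"
      proof clarify
        fix a b assume ab: "a < m" "b < k" "N $$ (a, b) \<noteq> 0"
        then have "M $$ (a, b) \<noteq> 0 \<or> M $$ (a, j) \<noteq> 0" by (auto simp: N)
        then show "\<exists>b<k. M $$ (a, b) \<noteq> 0" using ab(2) ij(2) by blast
      qed
      have "i \<notin> {a. a < m \<and> (\<exists>b<k. N $$ (a, b) \<noteq> 0)}" using ij by (auto simp: N)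
      moreover have "i \<in> {a. a < m \<and> (\<exists>b<k. M $$ (a, b) \<noteq> 0)}" using ij by auto
      ultimately show "{a. a < m \<and> (\<exists>b<k. N $$ (a, b) \<noteq> 0)} \<noteq> {a. a < m \<and> (\<exists>b<k. M $$ (a, b) \<noteq> 0)}"
        by blast
    qed
    then have "card {a. a < m \<and> (\<exists>b<k. N $$ (a, b) \<noteq> 0)} < card {a. a < m \<and> (\<exists>b<k. M $$ (a, b) \<noteq> 0)}"
      by (intro psubset_card_mono) auto
    then obtain Z where Z: "Z \<in> carrier_mat k m" "N * Z * N = N"
      using less[of N] by auto
    have [simp]: "dim_row Z = k" "dim_col Z = m" using Z by auto
    define Y where "Y = (1\<^sub>m k - D * M) * Z * (1\<^sub>m m - M * D)"
    have dimY [simp]: "dim_row Y = k" "dim_col Y = m" by (auto simp: Y_def)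
    have N1: "N = M * (1\<^sub>m k - D * M)" by (simp add: N_def mat_mult_diff mat_mult_assoc)
    have N2: "N = (1\<^sub>m m - M * D) * M" by (simp add: N_def mat_diff_mult mat_mult_assoc)
    have "M * Y * M = M * (1\<^sub>m k - D * M) * Z * ((1\<^sub>m m - M * D) * M)"
      by (simp add: Y_def mat_mult_assoc)
    also have "\<dots> = N * Z * N" by (simp only: N1[symmetric] N2[symmetric])
    finally have MYM: "M * Y * M = N" using Z by simp
    have "M * (Y + D) * M = M * Y * M + M * D * M"
      by (simp add: mat_mult_add mat_add_mult)
    also have "\<dots> = M" unfolding MYM by (intro eq_matI) (auto simp: N_def)
    finally show ?thesis by (intro bexI[of _ "Y + D"]) auto
  qed
qed

definition moore_penrose :: "real mat \<Rightarrow> real mat \<Rightarrow> bool" where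
  "moore_penrose M P \<longleftrightarrow> P \<in> carrier_mat (dim_col M) (dim_row M) \<and>
     M * P * M = M \<and> P * M * P = P \<and>
     transpose_mat (M * P) = M * P \<and> transpose_mat (P * M) = P * M"

lemma moore_penrose_unique:
  assumes "moore_penrose M P" "moore_penrose M Q"
  shows "P = Q"
proof -
  have [simp]: "dim_row P = dim_col M" "dim_col P = dim_row M" "dim_row Q = dim_col M" "dim_col Q = dim_row M"
    using assms by (auto simp: moore_penrose_def)
  have p: "M * (P * M) = M" "P * (M * P) = P" "transpose_mat (M * P) = M * P" "transpose_mat (P * M) = P * M"
    and q: "M * (Q * M) = M" "Q * (M * Q) = Q" "transpose_mat (M * Q) = M * Q" "transpose_mat (Q * M) = Q * M"
    using assms by (auto simp: moore_penrose_def mat_mult_assoc)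
  have "M * Q * (M * P) = M * Q * M * P" by (simp add: mat_mult_assoc)
  also have "\<dots> = M * P" using q(1) by (simp add: mat_mult_assoc)
  finally have "M * P = transpose_mat (M * Q * (M * P))" using p(3) by simp
  also have "\<dots> = transpose_mat (M * P) * transpose_mat (M * Q)"
    by (subst mat_transpose_mult) auto
  also have "\<dots> = M * P * M * Q" unfolding p(3) q(3) by (simp add: mat_mult_assoc)
  finally have 1: "M * P = M * Q" using p(1) by (simp add: mat_mult_assoc)
  have "P * M = transpose_mat (P * M * (Q * M))"
    using p(4) q(1) by (simp add: mat_mult_assoc)
  also have "\<dots> = transpose_mat (Q * M) * transpose_mat (P * M)"
    by (subst mat_transpose_mult) auto
  also have "\<dots> = Q * M" unfolding p(4) q(4) using p(1) by (simp add: mat_mult_assoc)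
  finally have 2: "P * M = Q * M" .
  have "P = P * M * P" using p(2) by (simp add: mat_mult_assoc)
  also have "\<dots> = Q * M * Q" using 1 2 by (simp add: mat_mult_assoc)
  finally show ?thesis using q(2) by (simp add: mat_mult_assoc)
qed

text \<open>Zlobec's formula: if \<open>T\<close> is the transpose of \<open>M\<close> and \<open>Y\<close> is any generalized inverse of \<open>T * M * T\<close>, then
  \<open>T * Y * T\<close> is the pseudoinverse. The four identities follow from \<open>W * Y * W = W\<close> by cancelling factors \<open>M\<close> and
  \<open>T\<close>, which is possible because a real matrix with zero Gram matrix is zero.\<close>

lemma ex_moore_penrose: "\<exists>P. moore_penrose M P"
proof -
  define m k where "m = dim_row M" and "k = dim_col M"
  define T where "T = transpose_mat M"
  define W where "W = T * M * T"
  have dims [simp]: "dim_row M = m" "dim_col M = k" "dim_row T = k" "dim_col T = m"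
    "dim_row W = k" "dim_col W = m"
    by (auto simp: m_def k_def T_def W_def)
  have TT [simp]: "transpose_mat T = M" "transpose_mat M = T" by (simp_all add: T_def)
  obtain Y where Y: "Y \<in> carrier_mat m k" "W * Y * W = W"
    using ex_gen_inverse[of W] by auto
  have [simp]: "dim_row Y = m" "dim_col Y = k" using Y by auto
  define P where "P = T * Y * T"
  have [simp]: "dim_row P = k" "dim_col P = m" by (auto simp: P_def)
  have rcancel: "A * T = B * T" if "A * T * M = B * T * M" "dim_col A = k" "dim_col B = k" "dim_row A = dim_row B" for A B
  proof -
    have "(A - B) * T * M = 0\<^sub>m (dim_row A) k"
      using that mat_diff_self[of "B * T * M"] by (simp add: mat_diff_mult)
    then have "(A - B) * T = 0\<^sub>m (dim_row A) m"
      using mult_gram_eq_0[of "A - B" M] that by simp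
    then have "A * T - B * T = 0\<^sub>m (dim_row A) m" using that by (simp add: mat_diff_mult)
    then show ?thesis by (rule mat_diff_eq_0_imp_eq) (simp_all add: that)
  qed
  have rcancel': "A * M = B * M" if "A * M * T = B * M * T" "dim_col A = m" "dim_col B = m" "dim_row A = dim_row B" for A B
  proof -
    have "(A - B) * M * T = 0\<^sub>m (dim_row A) m"
      using that mat_diff_self[of "B * M * T"] by (simp add: mat_diff_mult)
    then have "(A - B) * M = 0\<^sub>m (dim_row A) k"
      using mult_gram_eq_0[of "A - B" T] that by simp
    then have "A * M - B * M = 0\<^sub>m (dim_row A) k" using that by (simp add: mat_diff_mult)
    then show ?thesis by (rule mat_diff_eq_0_imp_eq) (simp_all add: that)
  qed
  have W0: "W * Y * T * M * T = T * M * T" using Y(2) by (simp add: W_def mat_mult_assoc)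
  have W1: "W * Y * T * M = T * M" by (rule rcancel') (use W0 in simp_all)
  have W2: "W * Y * T = T"
    using rcancel[of "W * Y" "1\<^sub>m k"] W1 by simp
  have T1: "T * (M * P * M - M) = 0\<^sub>m k k"
  proof -
    have "T * (M * P * M) = T * M"
      using W1 by (simp add: P_def W_def mat_mult_assoc)
    then show ?thesis using mat_diff_self[of "T * M"] by (subst mat_mult_diff) auto
  qed
  have MPM: "M * P * M = M"
  proof -
    let ?E = "M * P * M - M"
    have "transpose_mat ?E * ?E = transpose_mat (P * M - 1\<^sub>m k) * (T * ?E)"
    proof -
      have "?E = M * (P * M - 1\<^sub>m k)" by (simp add: mat_mult_diff mat_mult_assoc)
      then have "transpose_mat ?E = transpose_mat (P * M - 1\<^sub>m k) * T"
        by (simp add: mat_transpose_mult)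
      then show ?thesis by (simp add: mat_mult_assoc)
    qed
    also have "\<dots> = 0\<^sub>m k k" unfolding T1 by simp
    finally have "transpose_mat ?E = 0\<^sub>m k m"
      using gram_eq_0_imp_eq_0[of "transpose_mat ?E"] by simp
    then have "transpose_mat (transpose_mat ?E) = transpose_mat (0\<^sub>m k m)" by simp
    then have "?E = 0\<^sub>m m k" by simp
    then show ?thesis by (rule mat_diff_eq_0_imp_eq) simp_all
  qed
  have PMP: "P * M * P = P"
  proof -
    have "P * M * P = T * Y * (W * Y * T)" by (simp add: P_def W_def mat_mult_assoc)
    then show ?thesis unfolding W2 by (simp add: P_def)
  qed
  have sym1: "transpose_mat (M * P) = M * P"
  proof -
    let ?H = "M * P"
    have Ht: "transpose_mat ?H = M * transpose_mat Y * (M * T)"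
      by (simp add: P_def mat_transpose_mult mat_mult_assoc)
    have "?H * transpose_mat ?H = transpose_mat ?H"
    proof -
      have "?H * transpose_mat ?H = (M * P * M) * transpose_mat Y * (M * T)"
        unfolding Ht by (simp add: mat_mult_assoc)
      then show ?thesis unfolding MPM Ht .
    qed
    moreover have "transpose_mat (?H * transpose_mat ?H) = ?H * transpose_mat ?H"
      by (subst mat_transpose_mult) auto
    ultimately show ?thesis by (metis transpose_transpose)
  qed
  have sym2: "transpose_mat (P * M) = P * M"
  proof -
    let ?J = "P * M"
    have Jt: "transpose_mat ?J = T * M * transpose_mat Y * M"
      by (simp add: P_def mat_transpose_mult mat_mult_assoc)
    have "transpose_mat ?J * ?J = transpose_mat ?J"
    proof -
      have "transpose_mat ?J * ?J = T * M * transpose_mat Y * (M * P * M)"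
        unfolding Jt by (simp add: mat_mult_assoc)
      then show ?thesis unfolding MPM Jt .
    qed
    moreover have "transpose_mat (transpose_mat ?J * ?J) = transpose_mat ?J * ?J"
      by (subst mat_transpose_mult) auto
    ultimately show ?thesis by (metis transpose_transpose)
  qed
  show ?thesis using MPM PMP sym1 sym2
    by (intro exI[of _ P]) (auto simp: moore_penrose_def intro!: carrier_matI)
qed

lemma moore_penrose_pinv: "moore_penrose M (pinv M)"
proof -
  have "pinv M = (THE P. moore_penrose M P)" by (simp add: pinv_def moore_penrose_def)
  then show ?thesis using ex_moore_penrose[of M] moore_penrose_unique theI'[of "moore_penrose M"]
    by metis
qed

section \<open>Rank\<close>

lemma rank_mult_le:
  fixes A B :: "real mat"
  assumes "A \<in> carrier_mat n m" "B \<in> carrier_mat m k"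
  shows "vec_space.rank n (A * B) \<le> m"
proof -
  interpret vec_space "TYPE(real)" n .
  have AB: "A * B \<in> carrier_mat n k" using assms by auto
  have sub: "set (cols (A * B)) \<subseteq> span (set (cols A))"
  proof
    fix x assume "x \<in> set (cols (A * B))"
    then obtain i where i: "x = col (A * B) i" "i < k"
      using AB by (metis carrier_matD(2) cols_length cols_nth in_set_conv_nth)
    then have "x = A *\<^sub>v col B i"
      using assms by (intro eq_vecI) auto
    then have "x \<in> col_space A"
      using assms i(2) by (subst col_space_eq[OF assms(1)]) (auto intro!: bexI[of _ "col B i"])
    then show "x \<in> span (set (cols A))" by (simp add: col_space_def)
  qed
  have sA: "subspace class_ring (span (set (cols A))) V"
    using assms(1) by (metis carrier_matD(1) cols_dim span_is_subspace)
  have sAB: "subspace class_ring (span (set (cols (A * B)))) V"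
    using AB by (metis carrier_matD(1) cols_dim span_is_subspace)
  have "span (set (cols (A * B))) \<subseteq> span (set (cols A))"
    using sub sA by (simp add: span_is_subset subspace_def)
  note nested = nested_subspaces[OF sA sAB this]
  have fA: "vectorspace.fin_dim class_ring (vs (span (set (cols A))))"
    and fAB: "vectorspace.fin_dim class_ring (span_vs (set (cols (A * B))))"
    using assms(1) AB fin_dim_span_cols by auto
  have "rank (A * B) \<le> rank A" unfolding rank_def
    using vectorspace.subspace_dim[OF subspace_is_vs[OF sA] nested fA] fAB by auto
  also have "\<dots> \<le> m" by (rule rank_le_nc[OF assms(1)])
  finally show ?thesis .
qed

text \<open>The columns of the first factor are a maximal independent set of columns of \<open>A\<close>, and the second factor collects
  the coordinates of the columns of \<open>A\<close> in it.\<close>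

lemma ex_rank_factorization:
  fixes A :: "real mat"
  assumes "A \<in> carrier_mat n k"
  shows "\<exists>B \<in> carrier_mat n (vec_space.rank n A). \<exists>C \<in> carrier_mat (vec_space.rank n A) k. A = B * C"
proof -
  interpret vec_space "TYPE(real)" n .
  have cA: "set (cols A) \<subseteq> carrier_vec n" using assms cols_dim by blast
  have "lin_indpt {}" by (simp add: lin_dep_def)
  then obtain S where S: "finite S" "maximal S (\<lambda>T. T \<subseteq> set (cols A) \<and> lin_indpt T)"
    using maximal_exists_superset[of "set (cols A)" "\<lambda>T. T \<subseteq> set (cols A) \<and> lin_indpt T" "{}"] by auto
  have Sc: "S \<subseteq> set (cols A)" "lin_indpt S" using S(2) by (auto simp: maximal_def)
  have Scar: "S \<subseteq> carrier_vec n" using Sc(1) cA by blast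
  obtain xs where xs: "set xs = S" "distinct xs" using finite_distinct_list[OF S(1)] by auto
  define q where "q = length xs"
  have q: "rank A = q"
    using rank_card_indpt[OF assms S(2)] distinct_card[OF xs(2)] xs(1) by (simp add: q_def)
  define B where "B = mat_of_cols n xs"
  have B: "B \<in> carrier_mat n q" by (simp add: B_def q_def)
  have colsB: "set (cols B) = S" using Scar xs(1) by (simp add: B_def)
  have "\<exists>x \<in> carrier_vec q. B *\<^sub>v x = col A j" if j: "j < k" for j
  proof -
    have cj: "col A j \<in> set (cols A)" using assms j
      by (metis carrier_matD(2) cols_length cols_nth nth_mem)
    have "col A j \<in> span S"
    proof (cases "col A j \<in> S")
      case True
      then show ?thesis using Scar span_mem by auto
    next
      case False
      have "\<not> lin_indpt (S \<union> {col A j})"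
      proof
        assume "lin_indpt (S \<union> {col A j})"
        then have "S \<union> {col A j} = S"
          using S(2) cj Sc(1) unfolding maximal_def by blast
        then show False using False by blast
      qed
      then show ?thesis
        using lin_dep_iff_in_span[of S "col A j"] Scar Sc(2) False cj cA by auto
    qed
    then have "col A j \<in> col_space B" by (simp add: col_space_def colsB)
    then show ?thesis using B by (subst (asm) col_space_eq[OF B]) auto
  qed
  then obtain x where x: "\<And>j. j < k \<Longrightarrow> x j \<in> carrier_vec q \<and> B *\<^sub>v x j = col A j" by metis
  define C where "C = mat q k (\<lambda>(i, j). x j $ i)"
  have C: "C \<in> carrier_mat q k" by (simp add: C_def)
  have "A = B * C"
  proof (rule mat_col_eqI)
    fix j assume "j < dim_col (B * C)"
    then have j: "j < k" using C by simp
    have "col C j = x j" using x[OF j] j by (intro eq_vecI) (auto simp: C_def)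
    then have "col (B * C) j = B *\<^sub>v x j"
      using B C j by (intro eq_vecI) auto
    then show "col A j = col (B * C) j" using x[OF j] by simp
  qed (use assms B C in auto)
  then show ?thesis using B C unfolding q by blast
qed

lemma rank_mult_mult_le:
  fixes A M C :: "real mat"
  assumes "A \<in> carrier_mat a n" "M \<in> carrier_mat n k" "C \<in> carrier_mat k c"
  shows "vec_space.rank a (A * M * C) \<le> vec_space.rank n M"
proof -
  define q where "q = vec_space.rank n M"
  obtain B D where BD: "B \<in> carrier_mat n q" "D \<in> carrier_mat q k" "M = B * D"
    using ex_rank_factorization[OF assms(2)] unfolding q_def by blast
  have "A * M * C = (A * B) * (D * C)" using assms BD by (simp add: mat_mult_assoc)
  moreover have "vec_space.rank a ((A * B) * (D * C)) \<le> q"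
    using assms(1,3) BD(1,2) by (intro rank_mult_le) auto
  ultimately show ?thesis by (simp only: q_def)
qed

text \<open>This turns the rank into the nonvanishing of a determinant, which is an open condition. For a rank
  factorization \<open>M = B * C\<close> and a generalized inverse \<open>Z\<close>, the matrix \<open>E = C * Z * B\<close> satisfies \<open>M = B * E * C\<close>,
  so a singular \<open>E\<close> would give \<open>M\<close> a smaller rank; and \<open>C * Z\<close>, \<open>Z * B\<close> compress \<open>M\<close> to \<open>E * E\<close>.\<close>

lemma ex_nonsingular_compression:
  fixes M :: "real mat"
  assumes "M \<in> carrier_mat n k"
  defines "q \<equiv> vec_space.rank n M"
  shows "\<exists>S \<in> carrier_mat q n. \<exists>T \<in> carrier_mat k q. det (S * M * T) \<noteq> 0"
proof -
  obtain B C where BC: "B \<in> carrier_mat n q" "C \<in> carrier_mat q k" "M = B * C"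
    using ex_rank_factorization[OF assms(1)] unfolding q_def by blast
  obtain Z where Z: "Z \<in> carrier_mat k n" "M * Z * M = M"
    using ex_gen_inverse[of M] assms(1) by auto
  have dims [simp]: "dim_row B = n" "dim_col B = q" "dim_row C = q" "dim_col C = k"
    "dim_row Z = k" "dim_col Z = n" using BC Z by auto
  define E where "E = C * Z * B"
  have E: "E \<in> carrier_mat q q" by (auto simp: E_def)
  have "M = B * E * C" using Z(2) unfolding BC(3) E_def by (simp add: mat_mult_assoc)
  then have "q \<le> vec_space.rank q E"
    using rank_mult_mult_le[OF BC(1) E BC(2)] by (simp add: q_def)
  then have "det E \<noteq> 0"
    using vec_space.det_zero_low_rank[OF E] by force
  moreover have "(C * Z) * M * (Z * B) = E * E" unfolding BC(3) E_def by (simp add: mat_mult_assoc)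
  ultimately have "det ((C * Z) * M * (Z * B)) \<noteq> 0" using det_mult[OF E E] by simp
  then show ?thesis by (intro bexI[of _ "C * Z"] bexI[of _ "Z * B"]) auto
qed

lemma tendsto_det:
  fixes A :: "nat \<Rightarrow> real mat"
  assumes "\<And>i. A i \<in> carrier_mat q q" "L \<in> carrier_mat q q"
    and "\<And>a b. a < q \<Longrightarrow> b < q \<Longrightarrow> (\<lambda>i. A i $$ (a, b)) \<longlonglongrightarrow> L $$ (a, b)"
  shows "(\<lambda>i. det (A i)) \<longlonglongrightarrow> det L"
proof -
  have "(\<lambda>i. \<Sum>p | p permutes {0..<q}. signof p * (\<Prod>a = 0..<q. A i $$ (a, p a)))
      \<longlonglongrightarrow> (\<Sum>p | p permutes {0..<q}. signof p * (\<Prod>a = 0..<q. L $$ (a, p a)))"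
    by (intro tendsto_sum tendsto_mult tendsto_const tendsto_prod assms(3)) (auto simp: permutes_in_image)
  then show ?thesis by (simp only: det_def'[OF assms(1)] det_def'[OF assms(2)])
qed

lemma tendsto_mult_mat:
  fixes A B :: "nat \<Rightarrow> real mat"
  assumes "\<And>i. A i \<in> carrier_mat m l" "A' \<in> carrier_mat m l" "\<And>i. B i \<in> carrier_mat l k" "B' \<in> carrier_mat l k"
    and "\<And>a b. a < m \<Longrightarrow> b < l \<Longrightarrow> (\<lambda>i. A i $$ (a, b)) \<longlonglongrightarrow> A' $$ (a, b)"
    and "\<And>a b. a < l \<Longrightarrow> b < k \<Longrightarrow> (\<lambda>i. B i $$ (a, b)) \<longlonglongrightarrow> B' $$ (a, b)"
    and "a < m" "b < k"
  shows "(\<lambda>i. (A i * B i) $$ (a, b)) \<longlonglongrightarrow> (A' * B') $$ (a, b)"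
proof -
  have d: "dim_row (A i) = m" "dim_col (A i) = l" "dim_row (B i) = l" "dim_col (B i) = k" for i
    using assms(1,3)[of i] by auto
  have "(\<lambda>i. \<Sum>c<l. A i $$ (a, c) * B i $$ (c, b)) \<longlonglongrightarrow> (\<Sum>c<l. A' $$ (a, c) * B' $$ (c, b))"
    using assms(7,8) by (intro tendsto_sum tendsto_mult assms(5,6)) auto
  moreover have "(A i * B i) $$ (a, b) = (\<Sum>c<l. A i $$ (a, c) * B i $$ (c, b))" for i
    using d assms(7,8) by (subst index_mult_mat_sum) auto
  moreover have "(A' * B') $$ (a, b) = (\<Sum>c<l. A' $$ (a, c) * B' $$ (c, b))"
    using assms(2,4,7,8) by (subst index_mult_mat_sum) auto
  ultimately show ?thesis by simp
qed

lemma rank_lower_semicontinuous: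
  fixes A :: "nat \<Rightarrow> real mat"
  assumes A: "\<And>i. A i \<in> carrier_mat n k" and M: "M \<in> carrier_mat n k"
    and lim: "\<And>a b. a < n \<Longrightarrow> b < k \<Longrightarrow> (\<lambda>i. A i $$ (a, b)) \<longlonglongrightarrow> M $$ (a, b)"
  shows "eventually (\<lambda>i. vec_space.rank n M \<le> vec_space.rank n (A i)) sequentially"
proof -
  define q where "q = vec_space.rank n M"
  obtain S T where ST: "S \<in> carrier_mat q n" "T \<in> carrier_mat k q" "det (S * M * T) \<noteq> 0"
    using ex_nonsingular_compression[OF M] unfolding q_def by blast
  have SA: "S * A i \<in> carrier_mat q k" "S * A i * T \<in> carrier_mat q q" for i
    using ST A[of i] by auto
  have "(\<lambda>i. det (S * A i * T)) \<longlonglongrightarrow> det (S * M * T)"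
  proof (rule tendsto_det[of _ q])
    fix a b assume ab: "a < q" "b < q"
    show "(\<lambda>i. (S * A i * T) $$ (a, b)) \<longlonglongrightarrow> (S * M * T) $$ (a, b)"
    proof (rule tendsto_mult_mat[of _ q k _ _ q])
      fix a b assume "a < q" "b < k"
      then show "(\<lambda>i. (S * A i) $$ (a, b)) \<longlonglongrightarrow> (S * M) $$ (a, b)"
        using ST(1) A M lim by (intro tendsto_mult_mat[of _ q n _ _ k]) auto
    qed (use ST SA M ab in auto)
  qed (use ST SA M in auto)
  then have "eventually (\<lambda>i. det (S * A i * T) \<noteq> 0) sequentially"
    using ST(3) by (rule tendsto_imp_eventually_ne)
  then show ?thesis
  proof eventually_elim
    case (elim i)
    have "q = vec_space.rank q (S * A i * T)"
      using vec_space.low_rank_det_zero[OF SA(2) elim] by simp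
    also have "\<dots> \<le> vec_space.rank n (A i)"
      using rank_mult_mult_le[OF ST(1) A ST(2)] .
    finally show ?case by (simp add: q_def)
  qed
qed

text \<open>First-order form of the semicontinuity of rank: perturbing \<open>M\<close> along \<open>V\<close> without increasing the rank is
  possible only if \<open>V\<close> maps the kernel of \<open>M\<close> into its column space. Otherwise a nonsingular compression
  of \<open>M\<close>, bordered by one more row and column, would yield a nonsingular matrix whose size exceeds the
  rank of \<open>M\<close>. Since \<open>M * Z\<close> and \<open>Z * M\<close> are (possibly oblique) projections onto the column space and along the
  kernel, the condition reads as below.\<close>

lemma bounded_rank_tangent_direction:
  fixes M V Z :: "real mat" and W :: "nat \<Rightarrow> real mat"
  assumes M: "M \<in> carrier_mat n k" and V: "V \<in> carrier_mat n k" and W: "\<And>i. W i \<in> carrier_mat n k"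
    and Z: "Z \<in> carrier_mat k n" "M * Z * M = M"
    and \<tau>: "\<And>i. \<tau> i > 0" "\<tau> \<longlonglongrightarrow> 0"
    and lim: "\<And>a b. a < n \<Longrightarrow> b < k \<Longrightarrow> (\<lambda>i. W i $$ (a, b)) \<longlonglongrightarrow> V $$ (a, b)"
    and rank: "\<And>i. vec_space.rank n (M + \<tau> i \<cdot>\<^sub>m W i) \<le> vec_space.rank n M"
  shows "(1\<^sub>m n - M * Z) * V * (1\<^sub>m k - Z * M) = 0\<^sub>m n k"
proof (rule eq_matI)
  fix a b assume "a < dim_row (0\<^sub>m n k :: real mat)" "b < dim_col (0\<^sub>m n k :: real mat)"
  then have ab: "a < n" "b < k" by auto
  define q where "q = vec_space.rank n M"
  define Y where "Y i = M + \<tau> i \<cdot>\<^sub>m W i" for i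
  define E F where "E = 1\<^sub>m n - M * Z" and "F = 1\<^sub>m k - Z * M"
  obtain S T where ST: "S \<in> carrier_mat q n" "T \<in> carrier_mat k q" "det (S * M * T) \<noteq> 0"
    using ex_nonsingular_compression[OF M] unfolding q_def by blast
  have dims [simp]: "dim_row M = n" "dim_col M = k" "dim_row V = n" "dim_col V = k" "dim_row Z = k" "dim_col Z = n"
    "dim_row S = q" "dim_col S = n" "dim_row T = k" "dim_col T = q"
    "dim_row E = n" "dim_col E = n" "dim_row F = k" "dim_col F = k"
    using M V Z ST by (auto simp: E_def F_def)
  have dimsW [simp]: "dim_row (W i) = n" "dim_col (W i) = k" "dim_row (Y i) = n" "dim_col (Y i) = k" for i
    using W[of i] by (auto simp: Y_def)
  have EM: "E * M = 0\<^sub>m n k"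
    using mat_diff_self[of M] Z(2) by (simp add: E_def mat_diff_mult)
  have MF: "M * F = 0\<^sub>m n k"
    using mat_diff_self[of M] Z(2) by (simp add: F_def mat_mult_diff mat_mult_assoc)
  have YF: "Y i * F = \<tau> i \<cdot>\<^sub>m (W i * F)" for i
  proof -
    have "Y i * F = M * F + (\<tau> i \<cdot>\<^sub>m W i) * F" by (simp add: Y_def mat_add_mult)
    also have "(\<tau> i \<cdot>\<^sub>m W i) * F = \<tau> i \<cdot>\<^sub>m (W i * F)"
      by (rule mult_smult_assoc_mat[of _ n k _ k]) auto
    finally show ?thesis unfolding MF by (subst (asm) left_add_zero_mat[of _ n k]) (auto intro!: carrier_matI)
  qed
  \<comment> \<open>The compression S, T of the matrix is bordered by a row of E and a column of F divided by
    \<open>\<tau> i\<close>. The new column converges because \<open>Y i * F\<close> is \<open>\<tau> i\<close> times \<open>W i * F\<close>.\<close>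
  define L where "L = mat (Suc q) n (\<lambda>(x, y). if x < q then S $$ (x, y) else E $$ (a, y))"
  define R where "R c = mat k (Suc q) (\<lambda>(x, y). if y < q then T $$ (x, y) else c * F $$ (x, b))" for c
  have dimsL [simp]: "dim_row L = Suc q" "dim_col L = n" "dim_row (R c) = k" "dim_col (R c) = Suc q" for c
    by (auto simp: L_def R_def)
  have L_top: "(L * B) $$ (x, y) = (S * B) $$ (x, y)" if "x < q" "y < dim_col B" "dim_row B = n" for x y B
    using that by (subst (1 2) index_mult_mat_sum) (auto simp: L_def)
  have L_bot: "(L * B) $$ (q, y) = (E * B) $$ (a, y)" if "y < dim_col B" "dim_row B = n" for y B
    using that ab by (subst (1 2) index_mult_mat_sum) (auto simp: L_def)
  have R_left: "(B * R c) $$ (x, y) = (B * T) $$ (x, y)" if "x < dim_row B" "y < q" "dim_col B = k" for x y B c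
    using that by (subst (1 2) index_mult_mat_sum) (auto simp: R_def)
  have R_right: "(B * R c) $$ (x, q) = c * (B * F) $$ (x, b)" if "x < dim_row B" "dim_col B = k" for x B c
    using that ab by (subst (1 2) index_mult_mat_sum) (auto simp: R_def sum_distrib_left intro!: sum.cong)
  define K where "K i = L * Y i * R (1 / \<tau> i)" for i
  define K' where "K' = mat (Suc q) (Suc q)
    (\<lambda>(x, y). if y < q then (L * M * T) $$ (x, y) else (L * V * F) $$ (x, b))"
  have K: "K i \<in> carrier_mat (Suc q) (Suc q)" for i by (auto simp: K_def)
  have K': "K' \<in> carrier_mat (Suc q) (Suc q)" by (auto simp: K'_def)
  have detK: "det (K i) = 0" for i
  proof (rule ccontr)
    assume "det (K i) \<noteq> 0"
    then have "vec_space.rank (Suc q) (K i) = Suc q" by (rule vec_space.low_rank_det_zero[OF K])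
    moreover have "vec_space.rank (Suc q) (K i) \<le> vec_space.rank n (Y i)"
      unfolding K_def by (rule rank_mult_mult_le[of _ _ n _ k _ "Suc q"]) (auto intro!: carrier_matI)
    ultimately show False using rank[of i] by (simp add: Y_def q_def)
  qed
  have Ylim: "(\<lambda>i. Y i $$ (x, y)) \<longlonglongrightarrow> M $$ (x, y)" if "x < n" "y < k" for x y
  proof -
    have "(\<lambda>i. M $$ (x, y) + \<tau> i * W i $$ (x, y)) \<longlonglongrightarrow> M $$ (x, y) + 0 * V $$ (x, y)"
      by (intro tendsto_add tendsto_const tendsto_mult \<tau>(2) lim that)
    then show ?thesis using that by (simp add: Y_def)
  qed
  have limL: "(\<lambda>i. (L * A i * B) $$ (x, y)) \<longlonglongrightarrow> (L * A' * B) $$ (x, y)"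
    if "\<And>i. A i \<in> carrier_mat n k" "A' \<in> carrier_mat n k" "B \<in> carrier_mat k c" "x < Suc q" "y < c"
      "\<And>x y. x < n \<Longrightarrow> y < k \<Longrightarrow> (\<lambda>i. A i $$ (x, y)) \<longlonglongrightarrow> A' $$ (x, y)" for A A' B x y c
  proof (rule tendsto_mult_mat[of _ "Suc q" k _ _ c])
    fix x y assume "x < Suc q" "y < k"
    then show "(\<lambda>i. (L * A i) $$ (x, y)) \<longlonglongrightarrow> (L * A') $$ (x, y)"
      using that by (intro tendsto_mult_mat[of _ "Suc q" n _ _ k]) (auto intro!: carrier_matI)
  next
    show "L * A i \<in> carrier_mat (Suc q) k" for i using that(1)[of i] by (auto intro!: carrier_matI)
  qed (use that in \<open>auto intro!: carrier_matI\<close>)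
  have "(\<lambda>i. det (K i)) \<longlonglongrightarrow> det K'"
  proof (rule tendsto_det[OF K K'])
    fix x y assume xy: "x < Suc q" "y < Suc q"
    show "(\<lambda>i. K i $$ (x, y)) \<longlonglongrightarrow> K' $$ (x, y)"
    proof (cases "y < q")
      case True
      have "K i $$ (x, y) = (L * Y i * T) $$ (x, y)" for i
        unfolding K_def using xy True by (subst R_left) auto
      moreover have "(\<lambda>i. (L * Y i * T) $$ (x, y)) \<longlonglongrightarrow> (L * M * T) $$ (x, y)"
        using xy True Ylim by (intro limL[of _ _ _ q]) (auto intro!: carrier_matI)
      ultimately show ?thesis using True xy by (simp add: K'_def del: index_mult_mat(1))
    next
      case False
      then have y: "y = q" using xy by simp
      have "K i $$ (x, y) = (L * W i * F) $$ (x, b)" for i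
      proof -
        have "K i $$ (x, y) = 1 / \<tau> i * (L * Y i * F) $$ (x, b)"
          unfolding K_def y using xy by (subst R_right) auto
        also have "L * Y i * F = L * (Y i * F)" by (simp add: mat_mult_assoc)
        also have "\<dots> = \<tau> i \<cdot>\<^sub>m (L * (W i * F))"
          unfolding YF by (rule mult_smult_distrib[of _ "Suc q" n _ k]) (auto intro!: carrier_matI)
        also have "1 / \<tau> i * \<dots> $$ (x, b) = (L * (W i * F)) $$ (x, b)"
          using \<tau>(1)[of i] xy ab by (simp del: index_mult_mat(1))
        finally show ?thesis by (simp add: mat_mult_assoc)
      qed
      moreover have "(\<lambda>i. (L * W i * F) $$ (x, b)) \<longlonglongrightarrow> (L * V * F) $$ (x, b)"
        using xy ab lim by (intro limL[of _ _ _ k]) (auto intro!: carrier_matI)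
      ultimately show ?thesis using y xy by (simp add: K'_def del: index_mult_mat(1))
    qed
  qed
  then have detK': "det K' = 0" using LIMSEQ_unique[OF _ tendsto_const] by (simp add: detK)
  define A2 where "A2 = mat q 1 (\<lambda>(x, y). (L * V * F) $$ (x, b))"
  define A4 where "A4 = mat 1 1 (\<lambda>(x, y). (E * V * F) $$ (a, b))"
  have "K' = four_block_mat (S * M * T) A2 (0\<^sub>m 1 q) A4"
  proof (rule eq_matI)
    fix x y assume "x < dim_row (four_block_mat (S * M * T) A2 (0\<^sub>m 1 q) A4)"
      "y < dim_col (four_block_mat (S * M * T) A2 (0\<^sub>m 1 q) A4)"
    then have xy: "x < Suc q" "y < Suc q" by (auto simp: A4_def)
    have 1: "(L * M * T) $$ (x, y) = (S * M * T) $$ (x, y)" if "x < q" "y < q"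
      using L_top[of x y "M * T"] that by (simp add: mat_mult_assoc)
    have 2: "(L * M * T) $$ (q, y) = 0" if "y < q"
    proof -
      have "E * (M * T) = 0\<^sub>m n q" using EM by (simp add: mat_mult_assoc[symmetric] del: assoc_mult_mat)
      then show ?thesis using L_bot[of y "M * T"] that ab by (simp add: mat_mult_assoc)
    qed
    have 3: "(L * V * F) $$ (q, b) = (E * V * F) $$ (a, b)"
      using L_bot[of b "V * F"] ab by (simp add: mat_mult_assoc)
    show "K' $$ (x, y) = four_block_mat (S * M * T) A2 (0\<^sub>m 1 q) A4 $$ (x, y)"
      using xy 1 2 3 by (auto simp: K'_def A2_def A4_def less_Suc_eq simp del: index_mult_mat(1))
  qed (auto simp: K'_def A4_def)
  then have "det K' = det (S * M * T) * det A4"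
    by (simp add: det_four_block_mat_lower_left_zero[of _ q _ 1] A2_def A4_def carrier_matI)
  then have "det A4 = 0" using detK' ST(3) by simp
  then have "(E * V * F) $$ (a, b) = 0" by (simp add: A4_def det_single)
  then show "((1\<^sub>m n - M * Z) * V * (1\<^sub>m k - Z * M)) $$ (a, b) = 0\<^sub>m n k $$ (a, b)"
    using ab by (simp add: E_def F_def)
qed (use M V Z in auto)

section \<open>Inner products and mode products of arrays\<close>

definition array_inner :: "('d::finite \<Rightarrow> nat) \<Rightarrow> 'd array \<Rightarrow> 'd array \<Rightarrow> real" where
  "array_inner m T T' = (\<Sum>i\<in>multi_indices m. T i * T' i)"

lemma sum_multi_indices:
  fixes m :: "'d::finite \<Rightarrow> nat"
  shows "(\<Sum>i\<in>multi_indices m. g i) = (\<Sum>a<m k. \<Sum>c\<in>col_set k m. g (c(k := a)))"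
proof -
  have "(\<Sum>a<m k. \<Sum>c\<in>col_set k m. g (c(k := a))) = (\<Sum>(a, c)\<in>{..<m k} \<times> col_set k m. g (c(k := a)))"
    by (rule sum.cartesian_product)
  also have "\<dots> = (\<Sum>i\<in>multi_indices m. g i)"
    by (rule sum.reindex_bij_witness[of _ "\<lambda>i. (i k, i(k := 0))" "\<lambda>(a, c). c(k := a)"])
      (auto simp: col_set_def multi_indices_def)
  finally show ?thesis by simp
qed

lemma col_set_upd [simp]: "col_set k (m(k := b)) = col_set k m"
  by (auto simp: col_set_def)

lemma array_inner_commute: "array_inner m T T' = array_inner m T' T"
  by (simp add: array_inner_def mult.commute)

lemma array_inner_cong:
  assumes "\<And>i. i \<in> multi_indices m \<Longrightarrow> T i = S i" "\<And>i. i \<in> multi_indices m \<Longrightarrow> T' i = S' i"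
  shows "array_inner m T T' = array_inner m S S'"
  using assms by (simp add: array_inner_def)

lemma array_inner_mode_prod:
  fixes m :: "'d::finite \<Rightarrow> nat"
  assumes "dim_col A = m k"
  shows "array_inner (m(k := dim_row A)) (mode_prod k A T) T' = array_inner m T (mode_prod k (transpose_mat A) T')"
proof -
  have "array_inner (m(k := dim_row A)) (mode_prod k A T) T'
      = (\<Sum>a<dim_row A. \<Sum>c\<in>col_set k m. \<Sum>j<m k. A $$ (a, j) * T (c(k := j)) * T' (c(k := a)))"
    unfolding array_inner_def
    by (subst sum_multi_indices[of _ _ k]) (simp add: mode_prod_def assms sum_distrib_right)
  also have "\<dots> = (\<Sum>c\<in>col_set k m. \<Sum>a<dim_row A. \<Sum>j<m k. A $$ (a, j) * T (c(k := j)) * T' (c(k := a)))"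
    by (rule sum.swap)
  also have "\<dots> = (\<Sum>c\<in>col_set k m. \<Sum>j<m k. \<Sum>a<dim_row A. A $$ (a, j) * T (c(k := j)) * T' (c(k := a)))"
    by (intro sum.cong refl sum.swap)
  also have "\<dots> = (\<Sum>j<m k. \<Sum>c\<in>col_set k m. \<Sum>a<dim_row A. A $$ (a, j) * T (c(k := j)) * T' (c(k := a)))"
    by (rule sum.swap)
  also have "\<dots> = (\<Sum>j<m k. \<Sum>c\<in>col_set k m. T (c(k := j)) * (\<Sum>a<dim_row A. transpose_mat A $$ (j, a) * T' (c(k := a))))"
    by (intro sum.cong refl) (simp add: sum_distrib_left assms mult_ac)
  also have "\<dots> = array_inner m T (mode_prod k (transpose_mat A) T')"
    unfolding array_inner_def by (subst sum_multi_indices[of _ _ k]) (simp add: mode_prod_def)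
  finally show ?thesis .
qed

lemma mode_prod_mode_prod:
  assumes "i k < dim_row A" "dim_col A = dim_row B"
  shows "mode_prod k A (mode_prod k B T) i = mode_prod k (A * B) T i"
proof -
  have "mode_prod k A (mode_prod k B T) i
      = (\<Sum>j<dim_row B. \<Sum>l<dim_col B. A $$ (i k, j) * B $$ (j, l) * T (i(k := l)))"
    using assms by (simp add: mode_prod_def sum_distrib_left mult.assoc)
  also have "\<dots> = (\<Sum>l<dim_col B. \<Sum>j<dim_row B. A $$ (i k, j) * B $$ (j, l) * T (i(k := l)))"
    by (rule sum.swap)
  also have "\<dots> = (\<Sum>l<dim_col B. (A * B) $$ (i k, l) * T (i(k := l)))"
    using assms by (intro sum.cong refl) (simp add: index_mult_mat_sum sum_distrib_right del: index_mult_mat(1))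
  also have "\<dots> = mode_prod k (A * B) T i" by (simp add: mode_prod_def)
  finally show ?thesis .
qed

lemma mode_prod_one:
  assumes "i k < p"
  shows "mode_prod k (1\<^sub>m p) T i = T i"
proof -
  have "(\<Sum>j<p. 1\<^sub>m p $$ (i k, j) * T (i(k := j))) = (\<Sum>j\<in>{i k}. 1\<^sub>m p $$ (i k, j) * T (i(k := j)))"
    using assms by (intro sum.mono_neutral_right) auto
  then show ?thesis using assms by (simp add: mode_prod_def)
qed

text \<open>Applying the commutation law for families to one that has \<open>B\<close> in mode \<open>k\<close> and \<open>A\<close> elsewhere gives
  the law for two single products.\<close>

lemma mode_prod_commute:
  assumes "j \<noteq> k"
  shows "mode_prod j A (mode_prod k B T) = mode_prod k B (mode_prod j A T)"
proof -
  interpret comp_fun_commute "\<lambda>l. mode_prod l (((\<lambda>_. A)(k := B)) l)"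
    by (rule comp_fun_commute_mode_prod)
  show ?thesis using comp_fun_commute[of j k] assms by (simp add: fun_eq_iff)
qed

lemma mode_prod_cong:
  assumes "\<And>j. j < dim_col A \<Longrightarrow> T (i(k := j)) = T' (i(k := j))"
  shows "mode_prod k A T i = mode_prod k A T' i"
  using assms by (simp add: mode_prod_def)

lemma mode_prod_mode_prods_commute:
  fixes K :: "'d::finite set"
  assumes "k \<notin> K"
  shows "mode_prod k B (mode_prods A K T) = mode_prods A K (mode_prod k B T)"
proof -
  have "finite K" by simp
  then show ?thesis using assms
    by (induction K) (auto simp: mode_prods_insert mode_prod_commute)
qed

lemma array_inner_mode_prods:
  fixes K :: "'d::finite set"
  assumes "\<And>k. k \<in> K \<Longrightarrow> dim_col (A k) = m k"
  shows "array_inner (\<lambda>j. if j \<in> K then dim_row (A j) else m j) (mode_prods A K T) T'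
    = array_inner m T (mode_prods (\<lambda>j. transpose_mat (A j)) K T')"
proof -
  have "finite K" by simp
  then show ?thesis using assms
  proof (induction K arbitrary: T')
    case (insert k K)
    let ?m = "\<lambda>j. if j \<in> K then dim_row (A j) else m j"
    have m: "(\<lambda>j. if j \<in> insert k K then dim_row (A j) else m j) = ?m(k := dim_row (A k))"
      by auto
    have "array_inner (?m(k := dim_row (A k))) (mode_prod k (A k) (mode_prods A K T)) T'
        = array_inner ?m (mode_prods A K T) (mode_prod k (transpose_mat (A k)) T')"
      using insert by (intro array_inner_mode_prod) auto
    also have "\<dots> = array_inner m T (mode_prods (\<lambda>j. transpose_mat (A j)) K (mode_prod k (transpose_mat (A k)) T'))"
      using insert by simp
    finally show ?case using insert.hyps unfolding m
      by (simp add: mode_prods_insert mode_prod_mode_prods_commute)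
  qed simp
qed

lemma array_inner_mode_prods_isometry:
  fixes K :: "'d::finite set"
  assumes "\<And>k. k \<in> K \<Longrightarrow> transpose_mat (U k) * U k = 1\<^sub>m (m k)" "\<And>k. k \<in> K \<Longrightarrow> dim_col (U k) = m k"
  shows "array_inner (\<lambda>j. if j \<in> K then dim_row (U j) else m j) (mode_prods U K T) (mode_prods U K T')
    = array_inner m T T'"
proof -
  have "finite K" by simp
  then show ?thesis using assms
  proof (induction K)
    case (insert k K)
    let ?m = "\<lambda>j. if j \<in> K then dim_row (U j) else m j"
    let ?S = "mode_prods U K T" and ?S' = "mode_prods U K T'"
    have m: "(\<lambda>j. if j \<in> insert k K then dim_row (U j) else m j) = ?m(k := dim_row (U k))"
      by auto
    have "array_inner (?m(k := dim_row (U k))) (mode_prod k (U k) ?S) (mode_prod k (U k) ?S')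
        = array_inner ?m ?S (mode_prod k (transpose_mat (U k)) (mode_prod k (U k) ?S'))"
      using insert by (intro array_inner_mode_prod) auto
    also have "\<dots> = array_inner ?m ?S ?S'"
    proof (rule array_inner_cong)
      fix i assume "i \<in> multi_indices ?m"
      then have "i k < m k" using insert.hyps by (auto simp: multi_indices_def dest: spec[of _ k])
      then show "mode_prod k (transpose_mat (U k)) (mode_prod k (U k) ?S') i = ?S' i"
        using insert.prems[of k] by (subst mode_prod_mode_prod) (simp_all add: mode_prod_one)
    qed simp
    also have "\<dots> = array_inner m T T'" using insert by simp
    finally show ?case using insert.hyps unfolding m by (simp add: mode_prods_insert)
  qed simp
qed

section \<open>The Frobenius inner product of matrices\<close>

definition frobenius :: "real mat \<Rightarrow> real mat \<Rightarrow> real" where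
  "frobenius A B = (\<Sum>i<dim_row A. \<Sum>j<dim_col A. A $$ (i, j) * B $$ (i, j))"

lemma array_inner_unfolding: "array_inner m T T' = frobenius (unfolding_mat k m T) (unfolding_mat k m T')"
proof -
  have "array_inner m T T' = (\<Sum>a<m k. \<Sum>c\<in>col_set k m. T (c(k := a)) * T' (c(k := a)))"
    unfolding array_inner_def by (rule sum_multi_indices)
  also have "\<dots> = (\<Sum>a<m k. \<Sum>c<num_cols k m. T ((col_enum k m c)(k := a)) * T' ((col_enum k m c)(k := a)))"
    by (intro sum.cong refl sum.reindex_bij_betw[symmetric] bij_betw_col_enum)
  finally show ?thesis by (simp add: frobenius_def unfolding_mat_def)
qed

lemma frobenius_commute: "dim_row A = dim_row B \<Longrightarrow> dim_col A = dim_col B \<Longrightarrow> frobenius A B = frobenius B A"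
  by (simp add: frobenius_def mult.commute)

lemma frobenius_mult_left:
  assumes "dim_col P = dim_row X" "dim_row Y = dim_row P" "dim_col Y = dim_col X"
  shows "frobenius (P * X) Y = frobenius X (transpose_mat P * Y)"
proof -
  have "frobenius (P * X) Y = (\<Sum>i<dim_row P. \<Sum>j<dim_col X. \<Sum>k<dim_row X. P $$ (i, k) * X $$ (k, j) * Y $$ (i, j))"
    using assms by (simp add: frobenius_def index_mult_mat_sum sum_distrib_right del: index_mult_mat(1))
  also have "\<dots> = (\<Sum>i<dim_row P. \<Sum>k<dim_row X. \<Sum>j<dim_col X. P $$ (i, k) * X $$ (k, j) * Y $$ (i, j))"
    by (intro sum.cong refl sum.swap)
  also have "\<dots> = (\<Sum>k<dim_row X. \<Sum>i<dim_row P. \<Sum>j<dim_col X. P $$ (i, k) * X $$ (k, j) * Y $$ (i, j))"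
    by (rule sum.swap)
  also have "\<dots> = (\<Sum>k<dim_row X. \<Sum>j<dim_col X. \<Sum>i<dim_row P. P $$ (i, k) * X $$ (k, j) * Y $$ (i, j))"
    by (intro sum.cong refl sum.swap)
  also have "\<dots> = frobenius X (transpose_mat P * Y)"
    using assms by (auto simp: frobenius_def index_mult_mat_sum sum_distrib_left mult_ac simp del: index_mult_mat(1)
      intro!: sum.cong)
  finally show ?thesis .
qed

lemma frobenius_transpose:
  assumes "dim_row A = dim_row B" "dim_col A = dim_col B"
  shows "frobenius (transpose_mat A) (transpose_mat B) = frobenius A B"
proof -
  have "frobenius (transpose_mat A) (transpose_mat B) = (\<Sum>j<dim_col A. \<Sum>i<dim_row A. A $$ (i, j) * B $$ (i, j))"
    using assms by (simp add: frobenius_def)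
  also have "\<dots> = frobenius A B" unfolding frobenius_def by (rule sum.swap)
  finally show ?thesis .
qed

lemma frobenius_mult_right:
  assumes "dim_col X = dim_row Q" "dim_row Y = dim_row X" "dim_col Y = dim_col Q"
  shows "frobenius (X * Q) Y = frobenius X (Y * transpose_mat Q)"
proof -
  have "frobenius (X * Q) Y = frobenius (transpose_mat Q * transpose_mat X) (transpose_mat Y)"
    using assms frobenius_transpose[of "X * Q" Y] by (simp add: mat_transpose_mult)
  also have "\<dots> = frobenius (transpose_mat X) (Q * transpose_mat Y)"
    using assms by (subst frobenius_mult_left) auto
  also have "\<dots> = frobenius (transpose_mat X) (transpose_mat (Y * transpose_mat Q))"
    using assms by (simp add: mat_transpose_mult)
  also have "\<dots> = frobenius X (Y * transpose_mat Q)"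
    using assms by (subst frobenius_transpose) auto
  finally show ?thesis .
qed

text \<open>The map \<open>B \<mapsto> P * B * Q\<close> is an orthogonal projection if \<open>P\<close> and \<open>Q\<close> are.\<close>

lemma frobenius_two_sided_projection:
  assumes "dim_row P = dim_row B" "dim_col P = dim_row B" "transpose_mat P = P" "P * P = P"
    and "dim_row Q = dim_col B" "dim_col Q = dim_col B" "transpose_mat Q = Q" "Q * Q = Q"
  shows "frobenius B (P * B * Q) = frobenius (P * B * Q) (P * B * Q)"
proof -
  have "frobenius (P * B * Q) (P * B * Q) = frobenius (P * B) (P * B * Q * Q)"
    using assms by (subst frobenius_mult_right) auto
  also have "P * B * Q * Q = P * B * Q" using assms by (simp add: mat_mult_assoc)
  also have "frobenius (P * B) (P * B * Q) = frobenius B (P * (P * B * Q))"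
    using assms by (subst frobenius_mult_left) auto
  also have "P * (P * B * Q) = (P * P) * B * Q" using assms(1,2,5,6) by (simp add: mat_mult_assoc)
  finally show ?thesis using assms(4) by simp
qed

section \<open>Mode products on the tensor space\<close>

definition mode_op :: "('m::finite \<Rightarrow> 'd::finite \<Rightarrow> nat) \<Rightarrow> 'd \<Rightarrow> real mat \<Rightarrow> real ^ 'm \<Rightarrow> real ^ 'm" where
  "mode_op ix k A X = tensor_of ix (mode_prod k A (array_of ix X))"

definition mode_ops ::
  "('m::finite \<Rightarrow> 'd::finite \<Rightarrow> nat) \<Rightarrow> ('d \<Rightarrow> real mat) \<Rightarrow> 'd set \<Rightarrow> real ^ 'm \<Rightarrow> real ^ 'm" where
  "mode_ops ix A K X = tensor_of ix (mode_prods A K (array_of ix X))"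

locale tensor_space =
  fixes ix :: "'m::finite \<Rightarrow> 'd::finite \<Rightarrow> nat" and n :: "'d \<Rightarrow> nat"
  assumes ix: "bij_betw ix UNIV (multi_indices n)"
begin

abbreviation "unf \<equiv> tensor_unfolding ix n"
abbreviation "mp \<equiv> mode_op ix"
abbreviation "mps \<equiv> mode_ops ix"
abbreviation "rk \<equiv> rank_tc ix n"

lemma ix_in: "ix p \<in> multi_indices n"
  using ix by (auto simp: bij_betw_def)

lemma ix_less: "ix p k < n k"
  using ix_in[of p] by (simp add: multi_indices_def)

lemma array_of_tensor_of: "i \<in> multi_indices n \<Longrightarrow> array_of ix (tensor_of ix T) i = T i"
  using ix by (auto simp: array_of_def tensor_of_def bij_betw_def f_inv_into_f)

lemma array_of_ix [simp]: "array_of ix X (ix p) = X $ p"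
  using ix by (auto simp: array_of_def bij_betw_def)

lemma tensor_of_array_of [simp]: "tensor_of ix (array_of ix X) = X"
  by (simp add: tensor_of_def Finite_Cartesian_Product.vec_eq_iff)

lemma inner_eq_array_inner: "inner X Y = array_inner n (array_of ix X) (array_of ix Y)"
proof -
  have "inner X Y = (\<Sum>p\<in>UNIV. array_of ix X (ix p) * array_of ix Y (ix p))"
    by (simp add: inner_vec_def)
  also have "\<dots> = array_inner n (array_of ix X) (array_of ix Y)"
    unfolding array_inner_def by (rule sum.reindex_bij_betw[OF ix])
  finally show ?thesis .
qed

lemma inner_tensor_of: "inner X (tensor_of ix T) = array_inner n (array_of ix X) T"
  by (simp add: inner_eq_array_inner array_of_tensor_of cong: array_inner_cong)

lemma inner_tensor_of_tensor_of: "inner (tensor_of ix S) (tensor_of ix T) = array_inner n S T"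
  by (simp add: inner_eq_array_inner array_of_tensor_of cong: array_inner_cong)

text \<open>An array and the tensor made from it agree only at the multi-indices in range. A product with a matrix that has
  \<open>n k\<close> columns does not read any others, so the two product operations correspond.\<close>

lemma tensor_of_mode_prod:
  assumes "dim_col A = n k"
  shows "tensor_of ix (mode_prod k A T) = mp k A (tensor_of ix T)"
proof -
  have "mode_prod k A T (ix p) = mode_prod k A (array_of ix (tensor_of ix T)) (ix p)" for p
    using ix_in[of p] assms
    by (intro mode_prod_cong) (auto simp: array_of_tensor_of multi_indices_def)
  then show ?thesis by (simp add: mode_op_def tensor_of_def Finite_Cartesian_Product.vec_eq_iff)
qed

lemma mode_op_nth: "mp k A X $ p = (\<Sum>j<dim_col A. A $$ (ix p k, j) * array_of ix X ((ix p)(k := j)))"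
  by (simp add: mode_op_def tensor_of_def mode_prod_def)

lemma array_of_add: "array_of ix (X + Y) i = array_of ix X i + array_of ix Y i"
  by (simp add: array_of_def)

lemma array_of_scaleR: "array_of ix (c *\<^sub>R X) i = c * array_of ix X i"
  by (simp add: array_of_def)

lemma linear_mode_op: "linear (mp k A)"
  by (rule linearI)
    (simp_all add: Finite_Cartesian_Product.vec_eq_iff mode_op_nth array_of_add array_of_scaleR algebra_simps sum.distrib sum_distrib_left)

lemma mode_op_add_mat:
  assumes "dim_row B = n k" "dim_row A = n k" "dim_col A = dim_col B"
  shows "mp k (A + B) X = mp k A X + mp k B X"
  using assms ix_less by (simp add: Finite_Cartesian_Product.vec_eq_iff mode_op_nth algebra_simps sum.distrib)

lemma mode_op_diff_mat:
  assumes "dim_row B = n k" "dim_row A = n k" "dim_col A = dim_col B"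
  shows "mp k (A - B) X = mp k A X - mp k B X"
  using assms ix_less by (simp add: Finite_Cartesian_Product.vec_eq_iff mode_op_nth algebra_simps sum_subtractf)

lemma mode_op_smult_mat:
  assumes "dim_row A = n k"
  shows "mp k (c \<cdot>\<^sub>m A) X = c *\<^sub>R mp k A X"
  using assms ix_less by (simp add: Finite_Cartesian_Product.vec_eq_iff mode_op_nth algebra_simps sum_distrib_left)

lemma mode_op_one [simp]: "mp k (1\<^sub>m (n k)) X = X"
  by (simp add: Finite_Cartesian_Product.vec_eq_iff mode_op_def tensor_of_def mode_prod_one ix_less)

lemma mode_op_mode_op:
  assumes "dim_col A = n k" "dim_row A = n k" "dim_row B = n k"
  shows "mp k A (mp k B X) = mp k (A * B) X"
proof -
  have "mp k A (mp k B X) = tensor_of ix (mode_prod k A (mode_prod k B (array_of ix X)))"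
    unfolding tensor_of_mode_prod[OF assms(1)] mode_op_def[of _ k B] ..
  also have "\<dots> = mp k (A * B) X"
    using assms ix_less by (simp add: mode_op_def tensor_of_def Finite_Cartesian_Product.vec_eq_iff mode_prod_mode_prod)
  finally show ?thesis .
qed

lemma mode_op_commute:
  assumes "j \<noteq> k" "dim_col A = n j" "dim_col B = n k"
  shows "mp j A (mp k B X) = mp k B (mp j A X)"
proof -
  have "mp j A (mp k B X) = tensor_of ix (mode_prod j A (mode_prod k B (array_of ix X)))"
    unfolding tensor_of_mode_prod[OF assms(2)] mode_op_def[of _ k] ..
  also have "\<dots> = tensor_of ix (mode_prod k B (mode_prod j A (array_of ix X)))"
    using assms(1) by (simp add: mode_prod_commute)
  also have "\<dots> = mp k B (mp j A X)"
    unfolding tensor_of_mode_prod[OF assms(3)] mode_op_def[of _ j] ..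
  finally show ?thesis .
qed

lemma inner_mode_op:
  assumes "dim_row A = n k" "dim_col A = n k"
  shows "inner (mp k A X) Y = inner X (mp k (transpose_mat A) Y)"
proof -
  have "inner (mp k A X) Y = array_inner (n(k := dim_row A)) (mode_prod k A (array_of ix X)) (array_of ix Y)"
    using inner_tensor_of[of Y] assms
    by (simp add: mode_op_def inner_commute array_inner_commute[of _ "mode_prod k A _"])
  also have "\<dots> = array_inner n (array_of ix X) (mode_prod k (transpose_mat A) (array_of ix Y))"
    using assms by (intro array_inner_mode_prod) auto
  also have "\<dots> = inner X (mp k (transpose_mat A) Y)"
    by (simp add: mode_op_def inner_tensor_of)
  finally show ?thesis .
qed

lemma unf_carrier [simp]: "unf k X \<in> carrier_mat (n k) (num_cols k n)"
  by (simp add: tensor_unfolding_def unfolding_mat_def)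

lemma dim_unf [simp]: "dim_row (unf k X) = n k" "dim_col (unf k X) = num_cols k n"
  by (simp_all add: tensor_unfolding_def unfolding_mat_def)

text \<open>Since the position does not depend on the tensor, every entry of an unfolding is a coordinate function, hence
  linear and continuous.\<close>

lemma unf_entry:
  assumes "a < n k" "c < num_cols k n"
  obtains p where "\<And>X. unf k X $$ (a, c) = X $ p"
proof -
  have "col_enum k n c \<in> col_set k n"
    using bij_betw_col_enum[of k n] assms(2) by (auto simp: bij_betw_def)
  then have "(col_enum k n c)(k := a) \<in> multi_indices n"
    using assms(1) by (auto simp: col_set_def multi_indices_def)
  then obtain p where "(col_enum k n c)(k := a) = ix p"
    using ix by (auto simp: bij_betw_def)
  then have "unf k X $$ (a, c) = X $ p" for X
    using assms by (simp add: tensor_unfolding_def unfolding_mat_def)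
  then show ?thesis by (rule that)
qed

lemma unf_tensor_of: "unf k (tensor_of ix T) = unfolding_mat k n T"
proof (rule eq_matI)
  fix a c assume "a < dim_row (unfolding_mat k n T)" "c < dim_col (unfolding_mat k n T)"
  then have ac: "a < n k" "c < num_cols k n" by (auto simp: unfolding_mat_def)
  have "col_enum k n c \<in> col_set k n"
    using bij_betw_col_enum[of k n] ac(2) by (auto simp: bij_betw_def)
  then have "(col_enum k n c)(k := a) \<in> multi_indices n"
    using ac(1) by (auto simp: col_set_def multi_indices_def)
  then show "unf k (tensor_of ix T) $$ (a, c) = unfolding_mat k n T $$ (a, c)"
    using ac by (simp add: tensor_unfolding_def unfolding_mat_def array_of_tensor_of)
qed (simp_all add: unfolding_mat_def)

lemma unf_mode_op:
  assumes "dim_row A = n k" "dim_col A = n k"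
  shows "unf k (mp k A X) = A * unf k X"
  using unfolding_mat_mode_prod[of A n k "array_of ix X"] assms
  by (simp add: mode_op_def unf_tensor_of) (simp add: tensor_unfolding_def)

lemma unf_add: "unf k (X + Y) = unf k X + unf k Y"
  by (rule eq_matI) (auto simp: tensor_unfolding_def unfolding_mat_def array_of_add)

lemma unf_scaleR: "unf k (c *\<^sub>R X) = c \<cdot>\<^sub>m unf k X"
  by (rule eq_matI) (auto simp: tensor_unfolding_def unfolding_mat_def array_of_scaleR)

lemma inner_eq_frobenius: "inner X Y = frobenius (unf k X) (unf k Y)"
  by (simp add: inner_eq_array_inner array_inner_unfolding[of _ _ _ k] tensor_unfolding_def)

lemma unf_inject: "unf k X = unf k Y \<longleftrightarrow> X = Y"
proof
  assume eq: "unf k X = unf k Y"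
  have "inner Z X = inner Z Y" for Z by (simp add: inner_eq_frobenius[of _ _ k] eq)
  then show "X = Y" by (metis vector_eq_ldot)
qed simp

lemma tendsto_unf:
  assumes "y \<longlonglongrightarrow> X" "a < n k" "c < num_cols k n"
  shows "(\<lambda>i. unf k (y i) $$ (a, c)) \<longlonglongrightarrow> unf k X $$ (a, c)"
proof -
  obtain p where "\<And>X. unf k X $$ (a, c) = X $ p" using unf_entry[OF assms(2,3)] by blast
  then show ?thesis using assms(1) by (simp add: tendsto_vec_nth)
qed

lemma rk_def': "rk X k = vec_space.rank (n k) (unf k X)"
  by (simp add: rank_tc_def)

lemma eventually_rk_ge:
  assumes "y \<longlonglongrightarrow> X"
  shows "eventually (\<lambda>i. rk X k \<le> rk (y i) k) sequentially"
  unfolding rk_def' by (rule rank_lower_semicontinuous) (auto intro: tendsto_unf[OF assms])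

lemma rk_le_dim_col:
  assumes "unf k X = A * B" "A \<in> carrier_mat (n k) m" "B \<in> carrier_mat m (num_cols k n)"
  shows "rk X k \<le> m"
  unfolding rk_def' assms(1) by (rule rank_mult_le[OF assms(2,3)])

lemma rk_le_rk:
  assumes "unf k Y = A * unf k X * B" "A \<in> carrier_mat (n k) (n k)" "B \<in> carrier_mat (num_cols k n) (num_cols k n)"
  shows "rk Y k \<le> rk X k"
  unfolding rk_def' assms(1) by (rule rank_mult_mult_le[OF assms(2) unf_carrier assms(3)])

section \<open>Multilinear rank under mode products\<close>

definition unf_pinv :: "'d \<Rightarrow> real ^ 'm \<Rightarrow> real mat" where
  "unf_pinv k X = pinv (unf k X)"

lemma unf_pinv: "dim_row (unf_pinv k X) = num_cols k n" "dim_col (unf_pinv k X) = n k"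
  "unf k X * unf_pinv k X * unf k X = unf k X"
  using moore_penrose_pinv[of "unf k X"] by (auto simp: moore_penrose_def unf_pinv_def)

definition col_proj :: "'d \<Rightarrow> real ^ 'm \<Rightarrow> real mat" where
  "col_proj k X = unf k X * unf_pinv k X"

lemma dim_col_proj [simp]: "dim_row (col_proj k X) = n k" "dim_col (col_proj k X) = n k"
  by (simp_all add: col_proj_def unf_pinv)

lemma col_proj_idem: "col_proj k X * col_proj k X = col_proj k X"
proof -
  have "col_proj k X * col_proj k X = (unf k X * unf_pinv k X * unf k X) * unf_pinv k X"
    by (simp add: col_proj_def mat_mult_assoc unf_pinv(1,2))
  then show ?thesis by (simp add: unf_pinv(3) col_proj_def)
qed

lemma mode_op_col_proj_self: "mp k (col_proj k X) X = X"
  by (subst unf_inject[of k, symmetric]) (simp add: unf_mode_op col_proj_def unf_pinv)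

lemma rk_le_if_col_proj:
  assumes "mp k (col_proj k X) Y = Y"
  shows "rk Y k \<le> rk X k"
proof -
  have "unf k Y = col_proj k X * unf k Y"
    using assms by (metis unf_mode_op dim_col_proj)
  then have "unf k Y = 1\<^sub>m (n k) * unf k X * (unf_pinv k X * unf k Y)"
    by (simp add: col_proj_def mat_mult_assoc unf_pinv(1,2))
  then show ?thesis by (rule rk_le_rk) (auto simp: unf_pinv intro!: carrier_matI)
qed

text \<open>A mode product changes every unfolding, not only the one in its own mode. In the other modes the rank
  cannot grow because the product commutes with the projection onto the column space of \<open>unf k X\<close>.\<close>

lemma rk_mode_op_le:
  assumes "dim_row A = n j" "dim_col A = n j"
  shows "rk (mp j A X) k \<le> rk X k"
proof (cases "j = k")
  case True
  have "unf k (mp j A X) = A * unf k X * 1\<^sub>m (num_cols k n)"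
    using assms True by (simp add: unf_mode_op)
  then show ?thesis by (rule rk_le_rk) (use assms True in auto)
next
  case False
  then show ?thesis using mode_op_commute[of k j "col_proj k X" A X] assms
    by (intro rk_le_if_col_proj) (simp add: mode_op_col_proj_self)
qed

section \<open>Products in several modes\<close>

lemma mode_ops_empty [simp]: "mps A {} X = X"
  by (simp add: mode_ops_def)

lemma mode_ops_insert:
  assumes "k \<notin> K" "dim_col (A k) = n k"
  shows "mps A (insert k K) X = mp k (A k) (mps A K X)"
  using assms by (simp add: mode_ops_def mode_prods_insert tensor_of_mode_prod)

lemma tensor_prods_eq_mode_ops: "tensor_prods ix A X = mps A UNIV X"
  by (simp add: tensor_prods_def mode_ops_def)

lemma mode_op_mode_ops_commute:
  assumes "k \<notin> K" "dim_col B = n k" "\<And>k. dim_col (A k) = n k"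
  shows "mp k B (mps A K X) = mps A K (mp k B X)"
proof -
  have "finite K" by simp
  then show ?thesis using assms
    by (induction K) (auto simp: mode_ops_insert mode_op_commute)
qed

lemma inner_mode_ops:
  assumes "\<And>k. dim_row (A k) = n k" "\<And>k. dim_col (A k) = n k"
  shows "inner (mps A K X) Y = inner X (mps (\<lambda>k. transpose_mat (A k)) K Y)"
proof -
  have "finite K" by simp
  then show ?thesis
  proof (induction K arbitrary: Y)
    case (insert k K)
    let ?At = "\<lambda>k. transpose_mat (A k)"
    have "inner (mps A (insert k K) X) Y = inner (mps A K X) (mp k (?At k) Y)"
      using assms insert.hyps by (simp add: mode_ops_insert inner_mode_op)
    also have "\<dots> = inner X (mps ?At K (mp k (?At k) Y))" by (rule insert.IH)
    also have "mps ?At K (mp k (?At k) Y) = mp k (?At k) (mps ?At K Y)"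
      using assms insert.hyps by (intro mode_op_mode_ops_commute[symmetric]) auto
    also have "\<dots> = mps ?At (insert k K) Y"
      using assms insert.hyps by (intro mode_ops_insert[symmetric]) auto
    finally show ?case .
  qed simp
qed

lemma mode_ops_idem:
  assumes "\<And>k. dim_row (A k) = n k" "\<And>k. dim_col (A k) = n k" "\<And>k. A k * A k = A k"
  shows "mps A K (mps A K X) = mps A K X"
proof -
  have "finite K" by simp
  then show ?thesis
  proof (induction K)
    case (insert k K)
    have "mps A (insert k K) (mps A (insert k K) X) = mp k (A k) (mps A K (mp k (A k) (mps A K X)))"
      using assms insert by (simp add: mode_ops_insert)
    also have "mps A K (mp k (A k) (mps A K X)) = mp k (A k) (mps A K (mps A K X))"
      using assms insert.hyps by (intro mode_op_mode_ops_commute[symmetric]) auto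
    also have "mp k (A k) (mp k (A k) (mps A K (mps A K X))) = mps A (insert k K) X"
      unfolding insert.IH using assms insert.hyps by (simp add: mode_op_mode_op mode_ops_insert)
    finally show ?case .
  qed simp
qed

lemma inner_mode_ops_projection:
  assumes "\<And>k. dim_row (A k) = n k" "\<And>k. dim_col (A k) = n k" "\<And>k. A k * A k = A k" "\<And>k. transpose_mat (A k) = A k"
  shows "inner X (mps A K X) = (norm (mps A K X))\<^sup>2"
proof -
  have "(norm (mps A K X))\<^sup>2 = inner X (mps A K (mps A K X))"
    using assms by (simp add: power2_norm_eq_inner inner_mode_ops)
  then show ?thesis using assms by (simp add: mode_ops_idem)
qed

end

section \<open>Polynomial curves\<close>

text \<open>Polynomial curves are generated by constants, sums and multiplication by the parameter. This class is closed
  under differentiation and linear maps, so its members are smooth by a plain induction on the order.\<close>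

inductive poly_curve :: "(real \<Rightarrow> 'a::real_normed_vector) \<Rightarrow> bool" where
  const: "poly_curve (\<lambda>_. c)"
| add: "poly_curve \<gamma> \<Longrightarrow> poly_curve \<eta> \<Longrightarrow> poly_curve (\<lambda>t. \<gamma> t + \<eta> t)"
| mult: "poly_curve \<gamma> \<Longrightarrow> poly_curve (\<lambda>t. t *\<^sub>R \<gamma> t)"

lemma poly_curve_linear:
  assumes "poly_curve \<gamma>" "linear L"
  shows "poly_curve (\<lambda>t. L (\<gamma> t))"
  using assms(1)
proof induction
  case (add \<gamma> \<eta>)
  then show ?case using poly_curve.add[OF add.IH] by (simp add: linear_add[OF assms(2)])
next
  case (mult \<gamma>)
  then show ?case using poly_curve.mult[OF mult.IH] by (simp add: linear_scale[OF assms(2)])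
qed (rule poly_curve.const)

lemma poly_curve_derivative:
  assumes "poly_curve \<gamma>"
  shows "\<exists>\<gamma>'. poly_curve \<gamma>' \<and> (\<forall>t. (\<gamma> has_vector_derivative \<gamma>' t) (at t))"
  using assms
proof induction
  case (const c)
  show ?case by (intro exI[of _ "\<lambda>_. 0"] conjI poly_curve.const) auto
next
  case (add \<gamma> \<eta>)
  then obtain \<gamma>' \<eta>' where "poly_curve \<gamma>'" "\<forall>t. (\<gamma> has_vector_derivative \<gamma>' t) (at t)"
    "poly_curve \<eta>'" "\<forall>t. (\<eta> has_vector_derivative \<eta>' t) (at t)" by auto
  then show ?case
    by (intro exI[of _ "\<lambda>t. \<gamma>' t + \<eta>' t"]) (auto intro: poly_curve.add has_vector_derivative_add)
next
  case (mult \<gamma>)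
  then obtain \<gamma>' where \<gamma>': "poly_curve \<gamma>'" "\<forall>t. (\<gamma> has_vector_derivative \<gamma>' t) (at t)" by auto
  have "((\<lambda>t. t *\<^sub>R \<gamma> t) has_vector_derivative t *\<^sub>R \<gamma>' t + 1 *\<^sub>R \<gamma> t) (at t)" for t
    by (intro has_vector_derivative_scaleR DERIV_ident) (use \<gamma>' in auto)
  then show ?case using \<gamma>'(1) mult.hyps
    by (intro exI[of _ "\<lambda>t. t *\<^sub>R \<gamma>' t + 1 *\<^sub>R \<gamma> t"]) (auto intro: poly_curve.intros)
qed

lemma poly_curve_isCont: "poly_curve \<gamma> \<Longrightarrow> isCont \<gamma> t"
  using poly_curve_derivative has_vector_derivative_continuous by blast

lemma times_diff_on_poly_curve:
  assumes "poly_curve \<gamma>"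
  shows "times_diff_on k S \<gamma>"
  using assms
proof (induction k arbitrary: \<gamma>)
  case 0
  then show ?case by (simp add: continuous_at_imp_continuous_on poly_curve_isCont)
next
  case (Suc k)
  obtain \<gamma>' where \<gamma>': "poly_curve \<gamma>'" "\<And>t. (\<gamma> has_vector_derivative \<gamma>' t) (at t)"
    using poly_curve_derivative[OF Suc.prems] by auto
  then have d: "(\<gamma> has_derivative (\<lambda>v. v *\<^sub>R \<gamma>' t)) (at t)" for t
    by (simp add: has_vector_derivative_def)
  have "frechet_derivative \<gamma> (at t) v = v *\<^sub>R \<gamma>' t" for t v
    using frechet_derivative_at[OF d[of t]] by metis
  then show ?case using d Suc.IH[OF poly_curve_linear[OF \<gamma>'(1)]]
    by (auto simp: differentiable_def)
qed

lemma smooth_on_poly_curve: "poly_curve \<gamma> \<Longrightarrow> smooth_on S \<gamma>"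
  by (simp add: smooth_on_def times_diff_on_poly_curve)

section \<open>Tangent cones, nearest points and orthogonal projections\<close>

text \<open>Sample the curve at \<open>\<delta> / (i + 2)\<close>: this keeps the parameter positive and strictly inside the
  domain also for \<open>i = 0\<close>.\<close>

lemma tangent_space_subset_tangent_cone:
  assumes "M \<subseteq> S"
  shows "tangent_space M x \<subseteq> tangent_cone S x"
proof
  fix v assume "v \<in> tangent_space M x"
  then obtain \<gamma> \<delta> where \<delta>: "\<delta> > (0::real)" and \<gamma>: "\<gamma> ` {-\<delta><..<\<delta>} \<subseteq> M" "\<gamma> 0 = x"
    and d: "(\<gamma> has_vector_derivative v) (at 0)"
    by (auto simp: tangent_space_def)
  define \<tau> where "\<tau> i = \<delta> / real (i + 2)" for i
  have \<tau>0: "0 < \<tau> i" "\<tau> i < \<delta>" for i using \<delta> by (auto simp: \<tau>_def field_simps intro!: add_pos_nonneg)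
  have \<tau>: "\<tau> \<longlonglongrightarrow> 0"
    unfolding \<tau>_def by (rule LIMSEQ_ignore_initial_segment[OF lim_const_over_n])
  have at: "filterlim \<tau> (at 0) sequentially"
    using \<tau> \<tau>0(1) by (auto simp: filterlim_at intro!: always_eventually) (metis less_irrefl)
  have "isCont \<gamma> 0" using d by (rule has_vector_derivative_continuous)
  then have "(\<lambda>i. \<gamma> (\<tau> i)) \<longlonglongrightarrow> \<gamma> 0" using \<tau> by (rule isCont_tendsto_compose)
  moreover have "(\<lambda>i. (\<gamma> (\<tau> i) - x) /\<^sub>R \<tau> i) \<longlonglongrightarrow> v"
  proof -
    have "((\<lambda>h. norm (\<gamma> (0 + h) - \<gamma> 0 - h *\<^sub>R v) / norm h) \<longlongrightarrow> 0) (at 0)"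
      using d by (simp add: has_vector_derivative_def has_derivative_at)
    from filterlim_compose[OF this at]
    have "(\<lambda>i. norm (\<gamma> (\<tau> i) - x - \<tau> i *\<^sub>R v) / \<tau> i) \<longlonglongrightarrow> 0"
      using \<tau>0(1) by (simp add: \<gamma> less_imp_le)
    moreover have "norm (\<gamma> (\<tau> i) - x - \<tau> i *\<^sub>R v) / \<tau> i = norm ((\<gamma> (\<tau> i) - x) /\<^sub>R \<tau> i - v)" for i
    proof -
      have "(\<gamma> (\<tau> i) - x) /\<^sub>R \<tau> i - v = (\<gamma> (\<tau> i) - x - \<tau> i *\<^sub>R v) /\<^sub>R \<tau> i"
        using \<tau>0(1)[of i] by (simp add: scaleR_diff_right)
      then show ?thesis using \<tau>0(1)[of i] by (simp add: divide_inverse_commute)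
    qed
    ultimately have "(\<lambda>i. (\<gamma> (\<tau> i) - x) /\<^sub>R \<tau> i - v) \<longlonglongrightarrow> 0"
      by (simp add: tendsto_norm_zero_iff)
    then show ?thesis by (rule LIM_zero_cancel)
  qed
  moreover have "\<gamma> (\<tau> i) \<in> S" for i
  proof -
    have "\<tau> i \<in> {-\<delta><..<\<delta>}" using \<tau>0[of i] \<delta> by simp
    then show ?thesis using \<gamma>(1) assms by blast
  qed
  ultimately show "v \<in> tangent_cone S x" unfolding tangent_cone_def mem_Collect_eq
    using \<tau>0(1) \<tau> \<gamma>(2) by (intro exI[of _ "\<lambda>i. \<gamma> (\<tau> i)"] exI[of _ \<tau>]) simp
qed

lemma tangent_cone_scale:
  assumes "v \<in> tangent_cone S x" "c > 0"
  shows "c *\<^sub>R v \<in> tangent_cone S x"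
proof -
  obtain y \<tau> where y: "\<forall>i. y i \<in> S" "y \<longlonglongrightarrow> x" "\<forall>i. \<tau> i > 0" "\<tau> \<longlonglongrightarrow> (0::real)"
    "(\<lambda>i. (y i - x) /\<^sub>R \<tau> i) \<longlonglongrightarrow> v"
    using assms(1) by (auto simp: tangent_cone_def)
  have "(\<lambda>i. \<tau> i / c) \<longlonglongrightarrow> 0" using tendsto_divide[OF y(4) tendsto_const[of c]] assms(2) by simp
  moreover have "(\<lambda>i. (y i - x) /\<^sub>R (\<tau> i / c)) \<longlonglongrightarrow> c *\<^sub>R v"
    using tendsto_scaleR[OF tendsto_const[of c] y(5)] by (simp add: divide_inverse mult.commute)
  ultimately show ?thesis unfolding tangent_cone_def
    using y assms(2) by (intro CollectI exI[of _ y] exI[of _ "\<lambda>i. \<tau> i / c"]) auto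
qed

text \<open>Along the ray through \<open>p\<close> the squared distance to \<open>a\<close> is a quadratic polynomial in the scaling factor, and
  its minimum over the positive factors is attained at 1. The factor \<open>1 / 2\<close> shows that
  \<open>inner a p\<close> is positive; then the vertex of the parabola is a valid factor and must equal 1.\<close>

lemma nearest_point_cone_inner:
  fixes a :: "'a::real_inner"
  assumes p: "p \<in> nearest_points C a" and C: "\<And>v c. v \<in> C \<Longrightarrow> c > 0 \<Longrightarrow> c *\<^sub>R v \<in> C"
  shows "inner a p = (norm p)\<^sup>2"
proof (cases "p = 0")
  case False
  define h where "h = inner a p"
  define q where "q = (norm p)\<^sup>2"
  have q: "q > 0" using False by (simp add: q_def)
  have le: "q - 2 * h \<le> c\<^sup>2 * q - 2 * c * h" if "c > 0" for c
  proof -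
    have "dist a p \<le> dist a (c *\<^sub>R p)"
      using p C[of p c] that by (auto simp: nearest_points_def)
    then have "(norm (a - p))\<^sup>2 \<le> (norm (a - c *\<^sub>R p))\<^sup>2" by (simp add: dist_norm)
    then show ?thesis unfolding h_def q_def power2_norm_eq_inner
      by (simp add: inner_diff inner_commute[of p a] power2_eq_square algebra_simps)
  qed
  have "q - 2 * h \<le> (1 / 2)\<^sup>2 * q - 2 * (1 / 2) * h" by (rule le) simp
  then have "h > 0" using q by (simp add: power2_eq_square)
  then have "q - 2 * h \<le> (h / q)\<^sup>2 * q - 2 * (h / q) * h" using q by (intro le) simp
  also have "\<dots> = - (h\<^sup>2 / q)" using q by (simp add: power2_eq_square field_simps)
  finally have "(q - h)\<^sup>2 \<le> 0" using q by (simp add: power2_eq_square field_simps)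
  then show ?thesis by (simp add: h_def q_def)
qed simp

lemma nearest_point_cone_norm_le:
  fixes a :: "'a::real_inner"
  assumes "p \<in> nearest_points C a" "\<And>v c. v \<in> C \<Longrightarrow> c > 0 \<Longrightarrow> c *\<^sub>R v \<in> C"
  shows "norm p \<le> norm a"
proof -
  have "(norm p)\<^sup>2 \<le> norm a * norm p"
    using nearest_point_cone_inner[OF assms] norm_cauchy_schwarz[of a p] by simp
  then show ?thesis by (cases "norm p = 0") (auto simp: power2_eq_square)
qed

lemma nearest_point_cone_norm_unique:
  fixes a :: "'a::real_inner"
  assumes p: "p \<in> nearest_points C a" and p': "p' \<in> nearest_points C a"
    and C: "\<And>v c. v \<in> C \<Longrightarrow> c > 0 \<Longrightarrow> c *\<^sub>R v \<in> C"
  shows "norm p = norm p'"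
proof -
  have *: "(dist a x)\<^sup>2 = (norm a)\<^sup>2 - (norm x)\<^sup>2" if "x \<in> nearest_points C a" for x
    using nearest_point_cone_inner[OF that C]
    by (simp add: dist_norm power2_norm_eq_inner inner_diff inner_commute)
  have "dist a p = dist a p'" using p p' by (auto simp: nearest_points_def intro: antisym)
  then have "(norm p)\<^sup>2 = (norm p')\<^sup>2" using *[OF p] *[OF p'] by simp
  then show ?thesis by simp
qed

text \<open>For a subspace the description in \<open>orth_proj\<close> has exactly one solution.\<close>

lemma orth_proj_props:
  fixes V :: "'a::euclidean_space set"
  assumes "Real_Vector_Spaces.subspace V"
  shows "orth_proj V a \<in> V" "\<And>w. w \<in> V \<Longrightarrow> inner (a - orth_proj V a) w = 0"
proof -
  have sV: "Real_Vector_Spaces.span V = V" using assms by simp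
  obtain y z where yz: "y \<in> V" "\<And>w. w \<in> V \<Longrightarrow> inner z w = 0" "a = y + z"
    using orthogonal_subspace_decomp_exists[of V a] unfolding sV Linear_Algebra.orthogonal_def by blast
  have "orth_proj V a \<in> V \<and> (\<forall>w\<in>V. inner (a - orth_proj V a) w = 0)"
    unfolding orth_proj_def
  proof (rule theI[of _ y])
    show "y \<in> V \<and> (\<forall>w\<in>V. inner (a - y) w = 0)" using yz by auto
  next
    fix p assume p: "p \<in> V \<and> (\<forall>w\<in>V. inner (a - p) w = 0)"
    have "p - y \<in> V" using p yz(1) assms by (simp add: Real_Vector_Spaces.subspace_diff)
    then have "inner (a - p) (p - y) = 0" "inner (a - y) (p - y) = 0"
      using p yz by auto
    then have "inner (p - y) (p - y) = 0" by (simp add: inner_diff)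
    then show "p = y" by simp
  qed
  then show "orth_proj V a \<in> V" "\<And>w. w \<in> V \<Longrightarrow> inner (a - orth_proj V a) w = 0" by auto
qed

context tensor_space
begin

section \<open>The tangent space at a tensor of fixed multilinear rank\<close>

text \<open>The condition says that \<open>unf k v\<close> maps the kernel of \<open>unf k X\<close> into its column space. For a single mode it
  describes the tangent space of the matrices of fixed rank, so this is the intersection of the tangent
  spaces belonging to the individual unfoldings.\<close>

definition tucker_tangent_space :: "real ^ 'm \<Rightarrow> (real ^ 'm) set" where
  "tucker_tangent_space X = {v. \<forall>k. (1\<^sub>m (n k) - col_proj k X) * unf k v * (1\<^sub>m (num_cols k n) - unf_pinv k X * unf k X)
     = 0\<^sub>m (n k) (num_cols k n)}"

lemma subspace_tucker_tangent_space: "Real_Vector_Spaces.subspace (tucker_tangent_space X)"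
proof (rule Real_Vector_Spaces.subspaceI)
  have "unf k 0 = 0\<^sub>m (n k) (num_cols k n)" for k
    by (intro eq_matI) (auto simp: tensor_unfolding_def unfolding_mat_def array_of_def)
  then show "0 \<in> tucker_tangent_space X" by (simp add: tucker_tangent_space_def unf_pinv)
next
  fix v w assume "v \<in> tucker_tangent_space X" "w \<in> tucker_tangent_space X"
  then show "v + w \<in> tucker_tangent_space X" by (simp add: tucker_tangent_space_def unf_add mat_mult_add mat_add_mult unf_pinv)
next
  fix c v assume v: "v \<in> tucker_tangent_space X"
  have "(1\<^sub>m (n k) - col_proj k X) * (c \<cdot>\<^sub>m unf k v) * (1\<^sub>m (num_cols k n) - unf_pinv k X * unf k X)
    = c \<cdot>\<^sub>m ((1\<^sub>m (n k) - col_proj k X) * unf k v * (1\<^sub>m (num_cols k n) - unf_pinv k X * unf k X))" for k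
    by (subst mult_smult_distrib[of _ "n k" "n k" _ "num_cols k n"], auto simp: unf_pinv intro!: carrier_matI)
  then show "c *\<^sub>R v \<in> tucker_tangent_space X" using v by (simp add: tucker_tangent_space_def unf_scaleR)
qed

lemma tangent_cone_subset_tucker_tangent_space: "tangent_cone (rank_le_set ix n (rk X)) X \<subseteq> tucker_tangent_space X"
proof
  fix v assume "v \<in> tangent_cone (rank_le_set ix n (rk X)) X"
  then obtain y \<tau> where y: "\<And>i. y i \<in> rank_le_set ix n (rk X)" "y \<longlonglongrightarrow> X"
    "\<And>i. \<tau> i > 0" "\<tau> \<longlonglongrightarrow> (0::real)" "(\<lambda>i. (y i - X) /\<^sub>R \<tau> i) \<longlonglongrightarrow> v"
    by (auto simp: tangent_cone_def)
  have "(1\<^sub>m (n k) - unf k X * unf_pinv k X) * unf k v * (1\<^sub>m (num_cols k n) - unf_pinv k X * unf k X)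
    = 0\<^sub>m (n k) (num_cols k n)" for k
  proof (rule bounded_rank_tangent_direction[where W = "\<lambda>i. unf k ((y i - X) /\<^sub>R \<tau> i)"])
    fix i
    have "unf k X + \<tau> i \<cdot>\<^sub>m unf k ((y i - X) /\<^sub>R \<tau> i) = unf k (X + \<tau> i *\<^sub>R ((y i - X) /\<^sub>R \<tau> i))"
      by (simp only: unf_add unf_scaleR)
    also have "X + \<tau> i *\<^sub>R ((y i - X) /\<^sub>R \<tau> i) = y i" using y(3)[of i] by simp
    finally show "vec_space.rank (n k) (unf k X + \<tau> i \<cdot>\<^sub>m unf k ((y i - X) /\<^sub>R \<tau> i)) \<le> vec_space.rank (n k) (unf k X)"
      using y(1)[of i] by (simp add: rank_le_set_def rank_tc_def)
  qed (use y tendsto_unf[OF y(5)] in \<open>auto simp: unf_pinv intro!: carrier_matI\<close>)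
  then show "v \<in> tucker_tangent_space X" by (simp add: tucker_tangent_space_def col_proj_def)
qed

lemma mode_ops_col_proj_self: "mps (\<lambda>k. col_proj k X) K X = X"
proof -
  have "finite K" by simp
  then show ?thesis by (induction K) (simp_all add: mode_ops_insert mode_op_col_proj_self)
qed

text \<open>The familiar parametrization of the tangent space: a variation \<open>C\<close> of the core plus variations of the
  factors. The components of \<open>v\<close> outside the column spaces are split off one mode after the other. The part
  removed in mode \<open>k\<close> has the form \<open>A k * unf k X\<close> by the condition in that mode, and it is left unchanged by the
  projections already applied in the other modes because these fix \<open>X\<close>.\<close>

lemma tucker_tangent_space_decomposition:
  assumes "v \<in> tucker_tangent_space X"
  obtains A C where "\<And>k. dim_row (A k) = n k" "\<And>k. dim_col (A k) = n k"
    "\<And>k. mp k (col_proj k X) C = C" "v = C + (\<Sum>k\<in>UNIV. mp k (A k) X)"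
proof -
  define P where "P = (\<lambda>k. col_proj k X)"
  define A where "A k = (1\<^sub>m (n k) - P k) * unf k v * unf_pinv k X" for k
  have dims [simp]: "dim_row (P k) = n k" "dim_col (P k) = n k" "dim_row (A k) = n k" "dim_col (A k) = n k" for k
    by (simp_all add: P_def A_def unf_pinv)
  have A: "mp k (1\<^sub>m (n k) - P k) v = mp k (A k) X" for k
  proof -
    let ?B = "(1\<^sub>m (n k) - P k) * unf k v"
    have "?B * (1\<^sub>m (num_cols k n) - unf_pinv k X * unf k X) = 0\<^sub>m (n k) (num_cols k n)"
      using assms by (simp add: tucker_tangent_space_def P_def)
    then have "?B - ?B * (unf_pinv k X * unf k X) = 0\<^sub>m (n k) (num_cols k n)"
      by (simp add: mat_mult_diff unf_pinv(1,2))
    then have "?B = ?B * (unf_pinv k X * unf k X)"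
      by (rule mat_diff_eq_0_imp_eq) (simp_all add: unf_pinv(1,2))
    also have "\<dots> = A k * unf k X" by (simp add: A_def mat_mult_assoc unf_pinv(1,2))
    finally show ?thesis by (subst unf_inject[of k, symmetric]) (simp add: unf_mode_op)
  qed
  have tele: "v = mps P K v + (\<Sum>k\<in>K. mp k (A k) X)" for K
  proof -
    have "finite K" by simp
    then show ?thesis
    proof (induction K)
      case (insert k K)
      have "mps P K v - mp k (P k) (mps P K v) = mp k (1\<^sub>m (n k) - P k) (mps P K v)"
        by (simp add: mode_op_diff_mat)
      also have "\<dots> = mps P K (mp k (1\<^sub>m (n k) - P k) v)"
        using insert.hyps by (intro mode_op_mode_ops_commute) auto
      also have "\<dots> = mp k (A k) (mps P K X)"
        unfolding A using insert.hyps by (intro mode_op_mode_ops_commute[symmetric]) auto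
      also have "\<dots> = mp k (A k) X" by (simp add: P_def mode_ops_col_proj_self)
      finally have "mps P K v = mps P (insert k K) v + mp k (A k) X"
        using insert.hyps by (simp add: mode_ops_insert algebra_simps)
      moreover have "(\<Sum>j\<in>insert k K. mp j (A j) X) = mp k (A k) X + (\<Sum>j\<in>K. mp j (A j) X)"
        using insert.hyps by simp
      ultimately show ?case using insert.IH by (metis add.assoc)
    qed simp
  qed
  have "mp k (P k) (mps P UNIV v) = mps P UNIV v" for k
  proof -
    have "mps P UNIV v = mp k (P k) (mps P (UNIV - {k}) v)"
      using mode_ops_insert[of k "UNIV - {k}" P v] by (simp add: insert_absorb)
    then show ?thesis by (simp add: mode_op_mode_op) (simp add: P_def col_proj_idem)
  qed
  then show thesis using that[of A "mps P UNIV v"] tele[of UNIV] by (simp add: P_def)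
qed

text \<open>The curve multiplies \<open>X + t C\<close> by \<open>1 + t A\<^sub>k\<close> in every mode \<open>k\<close>. Its velocity at 0 is given by the
  product rule. Its ranks never exceed those of \<open>X\<close>, since \<open>X + t C\<close> has its columns in the column spaces of \<open>X\<close> and
  mode products do not increase ranks; near 0 they are not smaller either, by semicontinuity.\<close>

lemma tucker_tangent_space_subset_tangent_space: "tucker_tangent_space X \<subseteq> tangent_space (rank_eq_set ix n (rk X)) X"
proof
  fix v assume "v \<in> tucker_tangent_space X"
  then obtain A C where dimA [simp]: "\<And>k. dim_row (A k) = n k" "\<And>k. dim_col (A k) = n k"
    and C: "\<And>k. mp k (col_proj k X) C = C" and v: "v = C + (\<Sum>k\<in>UNIV. mp k (A k) X)"
    using tucker_tangent_space_decomposition by blast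
  define \<gamma> where "\<gamma> K t = mps (\<lambda>k. 1\<^sub>m (n k) + t \<cdot>\<^sub>m A k) K (X + t *\<^sub>R C)" for K and t :: real
  have \<gamma>_empty: "\<gamma> {} = (\<lambda>t. X + t *\<^sub>R C)" by (simp add: \<gamma>_def fun_eq_iff)
  have \<gamma>_insert': "\<gamma> (insert k K) t = mp k (1\<^sub>m (n k) + t \<cdot>\<^sub>m A k) (\<gamma> K t)" if "k \<notin> K" for k K t
    using that by (simp add: \<gamma>_def mode_ops_insert)
  have \<gamma>_insert: "\<gamma> (insert k K) = (\<lambda>t. \<gamma> K t + t *\<^sub>R mp k (A k) (\<gamma> K t))" if "k \<notin> K" for k K
    using that by (simp add: fun_eq_iff \<gamma>_insert' mode_op_add_mat mode_op_smult_mat)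
  have "poly_curve (\<gamma> K) \<and> \<gamma> K 0 = X \<and>
      (\<gamma> K has_vector_derivative C + (\<Sum>k\<in>K. mp k (A k) X)) (at 0) \<and>
      (\<forall>t k. rk (\<gamma> K t) k \<le> rk X k)" for K
  proof -
    have "finite K" by simp
    then show ?thesis
    proof (induction K)
      case empty
      have "poly_curve (\<gamma> {})" unfolding \<gamma>_empty by (intro poly_curve.intros)
      moreover have "(\<gamma> {} has_vector_derivative C) (at 0)"
      proof -
        have "((\<lambda>t. X + t *\<^sub>R C) has_vector_derivative 0 + (0 *\<^sub>R 0 + 1 *\<^sub>R C)) (at 0)"
          by (intro has_vector_derivative_add has_vector_derivative_scaleR DERIV_ident has_vector_derivative_const)
        then show ?thesis by (simp add: \<gamma>_empty)
      qed
      moreover have "mp k (col_proj k X) (X + t *\<^sub>R C) = X + t *\<^sub>R C" for k t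
        by (simp add: linear_add[OF linear_mode_op] linear_scale[OF linear_mode_op] C mode_op_col_proj_self)
      ultimately show ?case by (simp add: \<gamma>_empty rk_le_if_col_proj)
    next
      case (insert k K)
      note IH = insert.IH[THEN conjunct1] insert.IH[THEN conjunct2, THEN conjunct1]
        insert.IH[THEN conjunct2, THEN conjunct2, THEN conjunct1]
        insert.IH[THEN conjunct2, THEN conjunct2, THEN conjunct2]
      let ?v = "C + (\<Sum>k\<in>K. mp k (A k) X)"
      have "poly_curve (\<gamma> (insert k K))" unfolding \<gamma>_insert[OF insert.hyps(2)]
        by (rule poly_curve.add[OF IH(1) poly_curve.mult[OF poly_curve_linear[OF IH(1) linear_mode_op]]])
      moreover have "\<gamma> (insert k K) 0 = X" using IH(2) by (simp add: \<gamma>_insert[OF insert.hyps(2)])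
      moreover have "(\<gamma> (insert k K) has_vector_derivative C + (\<Sum>k\<in>insert k K. mp k (A k) X)) (at 0)"
      proof -
        have "((\<lambda>t. mp k (A k) (\<gamma> K t)) has_vector_derivative mp k (A k) ?v) (at 0)"
          by (rule bounded_linear.has_vector_derivative[OF _ IH(3)])
            (simp add: linear_conv_bounded_linear[symmetric] linear_mode_op)
        then have "((\<lambda>t. t *\<^sub>R mp k (A k) (\<gamma> K t)) has_vector_derivative
            0 *\<^sub>R mp k (A k) ?v + 1 *\<^sub>R mp k (A k) (\<gamma> K 0)) (at 0)"
          by (intro has_vector_derivative_scaleR DERIV_ident)
        from has_vector_derivative_add[OF IH(3) this] show ?thesis
          using insert.hyps IH(2) unfolding \<gamma>_insert[OF insert.hyps(2)] by (simp add: algebra_simps)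
      qed
      moreover have "rk (\<gamma> (insert k K) t) j \<le> rk X j" for t j
      proof -
        have "rk (\<gamma> (insert k K) t) j \<le> rk (\<gamma> K t) j"
          unfolding \<gamma>_insert'[OF insert.hyps(2)] by (rule rk_mode_op_le) auto
        then show ?thesis by (rule order_trans) (simp add: IH(4))
      qed
      ultimately show ?case by blast
    qed
  qed
  note this[of UNIV]
  then have poly: "poly_curve (\<gamma> UNIV)" and \<gamma>0: "\<gamma> UNIV 0 = X"
    and d: "(\<gamma> UNIV has_vector_derivative C + (\<Sum>k\<in>UNIV. mp k (A k) X)) (at 0)"
    and le: "\<forall>t k. rk (\<gamma> UNIV t) k \<le> rk X k"
    by simp_all
  have "eventually (\<lambda>t. \<forall>k. rk X k \<le> rk (\<gamma> UNIV t) k) (at 0)"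
  proof (rule sequentially_imp_eventually_within, intro allI impI, elim conjE)
    fix s :: "nat \<Rightarrow> real" assume "s \<longlonglongrightarrow> 0"
    with poly_curve_isCont[OF poly, of 0] have "(\<lambda>i. \<gamma> UNIV (s i)) \<longlonglongrightarrow> \<gamma> UNIV 0"
      by (rule isCont_tendsto_compose)
    then show "eventually (\<lambda>i. \<forall>k. rk X k \<le> rk (\<gamma> UNIV (s i)) k) sequentially"
      unfolding \<gamma>0 by (intro eventually_all_finite eventually_rk_ge)
  qed
  then obtain \<delta> where \<delta>: "\<delta> > 0" "\<And>t k. t \<noteq> 0 \<Longrightarrow> dist t 0 < \<delta> \<Longrightarrow> rk X k \<le> rk (\<gamma> UNIV t) k"
    unfolding eventually_at by auto
  have "rk (\<gamma> UNIV t) = rk X" if "t \<in> {-\<delta><..<\<delta>}" for t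
  proof (rule ext)
    fix k show "rk (\<gamma> UNIV t) k = rk X k"
      using \<delta>(2)[of t k] le that \<gamma>0 by (cases "t = 0") (auto intro!: antisym simp: dist_real_def)
  qed
  then have "\<gamma> UNIV ` {-\<delta><..<\<delta>} \<subseteq> rank_eq_set ix n (rk X)"
    by (simp add: rank_eq_set_def image_subset_iff)
  then show "v \<in> tangent_space (rank_eq_set ix n (rk X)) X"
    unfolding tangent_space_def mem_Collect_eq
    using \<delta>(1) smooth_on_poly_curve[OF poly] \<gamma>0 d[folded v] by blast
qed

text \<open>Velocities of curves of constant rank lie in the cone of bounded rank, so the three sets form a cycle of
  inclusions.\<close>

lemma tangent_space_rank_eq_set: "tangent_space (rank_eq_set ix n (rk X)) X = tucker_tangent_space X"
  and tangent_cone_rank_le_set: "tangent_cone (rank_le_set ix n (rk X)) X = tucker_tangent_space X"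
proof -
  have "rank_eq_set ix n (rk X) \<subseteq> rank_le_set ix n (rk X)"
    by (auto simp: rank_eq_set_def rank_le_set_def)
  then show "tangent_space (rank_eq_set ix n (rk X)) X = tucker_tangent_space X"
    "tangent_cone (rank_le_set ix n (rk X)) X = tucker_tangent_space X"
    using tangent_space_subset_tangent_cone tangent_cone_subset_tucker_tangent_space tucker_tangent_space_subset_tangent_space by blast+
qed

lemma riem_grad_in_tucker_tangent_space: "riem_grad ix n f X \<in> tucker_tangent_space X"
  and inner_riem_grad: "v \<in> tucker_tangent_space X \<Longrightarrow> inner (gradient f X) v = inner (riem_grad ix n f X) v"
  using orth_proj_props(1)[OF subspace_tucker_tangent_space[of X], of "gradient f X"]
    orth_proj_props(2)[OF subspace_tucker_tangent_space[of X], of v "gradient f X"]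
  by (auto simp: riem_grad_def tangent_space_rank_eq_set inner_diff_left)

end

section \<open>The restart direction is an orthogonal projection\<close>

lemma proj_mat_stiefel:
  assumes "V \<in> stiefel p m"
  shows "dim_row (proj_mat V) = m" "dim_col (proj_mat V) = m"
    "transpose_mat (proj_mat V) = proj_mat V" "proj_mat V * proj_mat V = proj_mat V"
proof -
  have V: "dim_row V = m" "dim_col V = p" "transpose_mat V * V = 1\<^sub>m p"
    using assms by (auto simp: stiefel_def)
  show "dim_row (proj_mat V) = m" "dim_col (proj_mat V) = m" using V by (simp_all add: proj_mat_def)
  show "transpose_mat (proj_mat V) = proj_mat V" using V by (simp add: proj_mat_def mat_transpose_mult)
  have "proj_mat V * proj_mat V = V * (transpose_mat V * V) * transpose_mat V"
    using V(1,2) by (simp add: proj_mat_def mat_mult_assoc)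
  then show "proj_mat V * proj_mat V = proj_mat V" using V by (simp add: proj_mat_def)
qed

lemma proj_mat_append_cols:
  assumes "dim_row U = m" "dim_row W = m"
  shows "proj_mat (mat_of_cols m (cols U @ cols W)) = U * transpose_mat U + W * transpose_mat W"
proof (rule eq_matI)
  let ?S = "mat_of_cols m (cols U @ cols W)"
  fix i j assume "i < dim_row (U * transpose_mat U + W * transpose_mat W)"
    "j < dim_col (U * transpose_mat U + W * transpose_mat W)"
  then have ij: "i < m" "j < m" using assms by auto
  have S: "?S $$ (x, y) = (if y < dim_col U then U $$ (x, y) else W $$ (x, y - dim_col U))"
    if "x < m" "y < dim_col U + dim_col W" for x y
    using that assms by (auto simp: mat_of_cols_index nth_append)
  have "proj_mat ?S $$ (i, j) = (\<Sum>y<dim_col U + dim_col W. ?S $$ (i, y) * ?S $$ (j, y))"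
    using ij unfolding proj_mat_def by (subst index_mult_mat_sum) auto
  also have "\<dots> = (\<Sum>y<dim_col U. ?S $$ (i, y) * ?S $$ (j, y))
      + (\<Sum>y = dim_col U..<dim_col U + dim_col W. ?S $$ (i, y) * ?S $$ (j, y))"
    by (simp add: lessThan_atLeast0 sum.atLeastLessThan_concat)
  also have "(\<Sum>y<dim_col U. ?S $$ (i, y) * ?S $$ (j, y)) = (\<Sum>y<dim_col U. U $$ (i, y) * U $$ (j, y))"
    using ij by (intro sum.cong) (auto simp: S)
  also have "(\<Sum>y = dim_col U..<dim_col U + dim_col W. ?S $$ (i, y) * ?S $$ (j, y))
      = (\<Sum>y<dim_col W. W $$ (i, y) * W $$ (j, y))"
    using ij by (intro sum.reindex_bij_witness[of _ "\<lambda>y. y + dim_col U" "\<lambda>y. y - dim_col U"]) (auto simp: S)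
  finally show "proj_mat ?S $$ (i, j) = (U * transpose_mat U + W * transpose_mat W) $$ (i, j)"
    using ij assms by (simp add: index_mult_mat_sum del: index_mult_mat(1))
qed (use assms in \<open>auto simp: proj_mat_def\<close>)

text \<open>The data from which the restart direction is computed: the factors \<open>U k\<close> of a Tucker decomposition and the
  randomly chosen columns \<open>W k\<close> that extend them.\<close>

locale extended_factors = tensor_space ix n for ix :: "'m::finite \<Rightarrow> 'd::finite \<Rightarrow> nat" and n +
  fixes q r :: "'d \<Rightarrow> nat" and U W :: "'d \<Rightarrow> real mat"
  assumes U: "\<And>k. U k \<in> stiefel (q k) (n k)"
    and W: "\<And>k. W k \<in> stiefel (r k - q k) (n k)"
    and UW: "\<And>k. transpose_mat (U k) * W k = 0\<^sub>m (q k) (r k - q k)"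
begin

definition S where "S k = mat_of_cols (n k) (cols (U k) @ cols (W k))"
definition ext_proj where "ext_proj k = proj_mat (S k)"

lemma dims [simp]: "dim_row (U k) = n k" "dim_col (U k) = q k" "dim_row (W k) = n k" "dim_col (W k) = r k - q k"
  "dim_row (S k) = n k"
  using U[of k] W[of k] by (auto simp: stiefel_def S_def)

lemma UtU: "transpose_mat (U k) * U k = 1\<^sub>m (q k)" and WtW: "transpose_mat (W k) * W k = 1\<^sub>m (r k - q k)"
  using U[of k] W[of k] by (auto simp: stiefel_def)

lemma WtU: "transpose_mat (W k) * U k = 0\<^sub>m (r k - q k) (q k)"
proof -
  have "transpose_mat (W k) * U k = transpose_mat (transpose_mat (U k) * W k)"
    by (simp add: mat_transpose_mult)
  then show ?thesis by (simp add: UW)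
qed

lemma ext_proj_eq: "ext_proj k = U k * transpose_mat (U k) + W k * transpose_mat (W k)"
  unfolding ext_proj_def S_def by (rule proj_mat_append_cols) auto

lemma dim_ext_proj [simp]: "dim_row (ext_proj k) = n k" "dim_col (ext_proj k) = n k"
  by (simp_all add: ext_proj_eq)

lemma transpose_ext_proj: "transpose_mat (ext_proj k) = ext_proj k"
  by (simp add: ext_proj_def proj_mat_def mat_transpose_mult)

lemma ext_proj_U: "ext_proj k * U k = U k"
proof -
  have "ext_proj k * U k = U k * (transpose_mat (U k) * U k) + W k * (transpose_mat (W k) * U k)"
    by (simp add: ext_proj_eq mat_add_mult mat_mult_assoc)
  also have "\<dots> = U k" unfolding UtU WtU
    by (intro eq_matI) (auto simp: right_mult_zero_mat[of _ "n k" "r k - q k"] intro!: carrier_matI)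
  finally show ?thesis .
qed

lemma ext_proj_W: "ext_proj k * W k = W k"
proof -
  have "ext_proj k * W k = U k * (transpose_mat (U k) * W k) + W k * (transpose_mat (W k) * W k)"
    by (simp add: ext_proj_eq mat_add_mult mat_mult_assoc)
  also have "\<dots> = W k" unfolding UW WtW
    by (intro eq_matI) (auto simp: right_mult_zero_mat[of _ "n k" "q k"] intro!: carrier_matI)
  finally show ?thesis .
qed

lemma ext_proj_idem: "ext_proj k * ext_proj k = ext_proj k"
proof -
  have "ext_proj k * ext_proj k = ext_proj k * U k * transpose_mat (U k) + ext_proj k * W k * transpose_mat (W k)"
    by (subst (2) ext_proj_eq) (simp add: mat_mult_add mat_mult_assoc)
  then show ?thesis unfolding ext_proj_U ext_proj_W ext_proj_eq[symmetric] .
qed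

text \<open>The summands of the approximate projection: the core part is the projection of the tensor onto the
  extended factor spaces, and the factor part of mode \<open>k\<close> varies the \<open>k\<close>-th factor inside the orthogonal
  complement of its extended space.\<close>

definition core_part where "core_part A = mps ext_proj UNIV A"

definition factor_coeff where
  "factor_coeff G A k = unfolding_mat k (q(k := n k)) (mode_prods (\<lambda>j. transpose_mat (U j)) (-{k}) (array_of ix A))"

definition factor_mat where
  "factor_mat G A k = perp_mat (S k) * factor_coeff G A k * pinv (unfolding_mat k q G)"

definition factor_part where
  "factor_part G A k = tensor_of ix (mode_prods U (-{k}) (mode_prod k (factor_mat G A k) G))"

lemma approx_proj_eq: "approx_proj ix n q G U W A = core_part A + (\<Sum>k\<in>UNIV. factor_part G A k)"
  by (simp add: approx_proj_def core_part_def factor_part_def factor_mat_def factor_coeff_def S_def[abs_def] ext_proj_def[abs_def]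
      tensor_prods_eq_mode_ops Let_def)

lemma perp_S: "perp_mat (S k) = 1\<^sub>m (n k) - ext_proj k"
  by (simp add: perp_mat_def ext_proj_def proj_mat_def)

lemma num_cols_upd [simp]: "num_cols k (m(k := b)) = num_cols k m"
  unfolding num_cols_def by (rule prod.cong) auto

lemma dim_pinv [simp]: "dim_row (pinv M) = dim_col M" "dim_col (pinv M) = dim_row M"
  using moore_penrose_pinv[of M] by (auto simp: moore_penrose_def)

lemma dim_unfolding_mat [simp]: "dim_row (unfolding_mat k m G) = m k" "dim_col (unfolding_mat k m G) = num_cols k m"
  by (simp_all add: unfolding_mat_def)

lemma dim_factor [simp]: "dim_row (factor_coeff G A k) = n k" "dim_col (factor_coeff G A k) = num_cols k q"
  "dim_row (factor_mat G A k) = n k" "dim_col (factor_mat G A k) = q k"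
  by (simp_all add: factor_coeff_def factor_mat_def perp_S)

lemma ext_proj_perp: "ext_proj k * (1\<^sub>m (n k) - ext_proj k) = 0\<^sub>m (n k) (n k)"
  using mat_diff_self[of "ext_proj k"] by (simp add: mat_mult_diff ext_proj_idem)

lemma perp_idem: "(1\<^sub>m (n k) - ext_proj k) * (1\<^sub>m (n k) - ext_proj k) = 1\<^sub>m (n k) - ext_proj k"
proof -
  have "(1\<^sub>m (n k) - ext_proj k) * (1\<^sub>m (n k) - ext_proj k) = (1\<^sub>m (n k) - ext_proj k) - ext_proj k * (1\<^sub>m (n k) - ext_proj k)"
    by (subst mat_diff_mult) auto
  then show ?thesis unfolding ext_proj_perp by (intro eq_matI) auto
qed

lemma transpose_perp: "transpose_mat (1\<^sub>m (n k) - ext_proj k) = 1\<^sub>m (n k) - ext_proj k"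
  by (subst transpose_minus[of _ "n k" "n k"]) (auto simp: transpose_ext_proj intro!: carrier_matI)

text \<open>Multiplication by the factors \<open>U j\<close> in the modes \<open>j \<noteq> k\<close> is an isometry, which reduces the claim to the
  mode-\<open>k\<close> unfolding. There the map is the two-sided projection by the complement of the extended space on the left and
  by \<open>G\<^sup>\<dagger> G\<close> on the right, for the unfolded core \<open>G\<close>.\<close>

lemma factor_part_inner: "inner A (factor_part G A k) = (norm (factor_part G A k))\<^sup>2"
proof -
  let ?m = "q(k := n k)" and ?H = "mode_prod k (factor_mat G A k) G" and ?B = "factor_coeff G A k"
  let ?Gk = "unfolding_mat k q G" and ?P = "1\<^sub>m (n k) - ext_proj k"
  let ?Q = "pinv ?Gk * ?Gk"
  have n: "(\<lambda>j. if j \<in> -{k} then dim_row (U j) else ?m j) = n" by auto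
  have H: "unfolding_mat k ?m ?H = ?P * ?B * ?Q"
  proof -
    have "unfolding_mat k (q(k := dim_row (factor_mat G A k))) ?H = factor_mat G A k * ?Gk"
      by (rule unfolding_mat_mode_prod) simp
    then show ?thesis by (simp add: factor_mat_def perp_S mat_mult_assoc)
  qed
  have "inner A (factor_part G A k) = array_inner n (mode_prods U (-{k}) ?H) (array_of ix A)"
    by (simp add: factor_part_def inner_tensor_of array_inner_commute)
  also have "\<dots> = array_inner ?m ?H (mode_prods (\<lambda>j. transpose_mat (U j)) (-{k}) (array_of ix A))"
    using array_inner_mode_prods[of "-{k}" U ?m ?H "array_of ix A"] unfolding n by simp
  also have "\<dots> = frobenius (unfolding_mat k ?m ?H) ?B"
    by (simp add: array_inner_unfolding[of _ _ _ k] factor_coeff_def)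
  also have "\<dots> = frobenius ?B (unfolding_mat k ?m ?H)" by (rule frobenius_commute) auto
  also have "\<dots> = frobenius (unfolding_mat k ?m ?H) (unfolding_mat k ?m ?H)" unfolding H
  proof (rule frobenius_two_sided_projection)
    show "transpose_mat ?Q = ?Q" using moore_penrose_pinv[of ?Gk] by (simp add: moore_penrose_def)
    have "?Q * ?Q = pinv ?Gk * ?Gk * pinv ?Gk * ?Gk" by (simp add: mat_mult_assoc)
    then show "?Q * ?Q = ?Q" using moore_penrose_pinv[of ?Gk] by (simp add: moore_penrose_def)
  qed (simp_all add: perp_idem transpose_perp)
  also have "\<dots> = array_inner ?m ?H ?H" by (simp add: array_inner_unfolding[of _ _ _ k])
  also have "\<dots> = array_inner n (mode_prods U (-{k}) ?H) (mode_prods U (-{k}) ?H)"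
    using array_inner_mode_prods_isometry[of "-{k}" U ?m ?H ?H] unfolding n by (simp add: UtU)
  also have "\<dots> = (norm (factor_part G A k))\<^sup>2"
    by (simp add: factor_part_def power2_norm_eq_inner inner_tensor_of_tensor_of)
  finally show ?thesis .
qed

lemma mode_op_tensor_of_mode_prod:
  assumes "dim_col B = n k" "dim_row B = n k" "dim_row C = n k"
  shows "mp k B (tensor_of ix (mode_prod k C T)) = tensor_of ix (mode_prod k (B * C) T)"
  unfolding tensor_of_mode_prod[OF assms(1), symmetric]
  using assms ix_less by (simp add: tensor_of_def Finite_Cartesian_Product.vec_eq_iff mode_prod_mode_prod)

lemma ext_proj_factor_part_same: "mp k (ext_proj k) (factor_part G A k) = 0"
proof -
  have "factor_part G A k = tensor_of ix (mode_prod k (factor_mat G A k) (mode_prods U (-{k}) G))"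
    by (simp add: factor_part_def mode_prod_mode_prods_commute)
  then have "mp k (ext_proj k) (factor_part G A k)
      = tensor_of ix (mode_prod k (ext_proj k * factor_mat G A k) (mode_prods U (-{k}) G))"
    by (simp add: mode_op_tensor_of_mode_prod)
  also have "ext_proj k * factor_mat G A k = ext_proj k * (1\<^sub>m (n k) - ext_proj k) * (factor_coeff G A k * pinv (unfolding_mat k q G))"
    by (simp add: factor_mat_def perp_S mat_mult_assoc)
  also have "\<dots> = 0\<^sub>m (n k) (q k)" unfolding ext_proj_perp
    by (rule left_mult_zero_mat) (auto intro!: carrier_matI)
  also have "tensor_of ix (mode_prod k (0\<^sub>m (n k) (q k)) T) = 0" for T
    using ix_less by (simp add: tensor_of_def Finite_Cartesian_Product.vec_eq_iff mode_prod_def)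
  finally show ?thesis .
qed

lemma ext_proj_factor_part_other:
  assumes "j \<noteq> k"
  shows "mp k (ext_proj k) (factor_part G A j) = factor_part G A j"
proof -
  have "- {j} = insert k (- {j} - {k})" using assms by auto
  then have "factor_part G A j
      = tensor_of ix (mode_prod k (U k) (mode_prods U (-{j} - {k}) (mode_prod j (factor_mat G A j) G)))"
    unfolding factor_part_def by (metis DiffD2 insertI1 mode_prods_insert)
  then show ?thesis by (simp add: mode_op_tensor_of_mode_prod ext_proj_U)
qed

lemma ext_proj_core_part: "mp k (ext_proj k) (core_part A) = core_part A"
proof -
  have "core_part A = mp k (ext_proj k) (mps ext_proj (UNIV - {k}) A)"
    using mode_ops_insert[of k "UNIV - {k}" ext_proj A] by (simp add: insert_absorb core_part_def)
  then show ?thesis by (simp add: mode_op_mode_op ext_proj_idem)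
qed

text \<open>The columns of the factor part of mode \<open>k\<close> are perpendicular to the extended space of that mode. The core part and
  the factor parts of the other modes have their columns inside it.\<close>

lemma inner_factor_part_eq_0:
  assumes "mp k (ext_proj k) Y = Y"
  shows "inner (factor_part G A k) Y = 0"
proof -
  have "inner (factor_part G A k) Y = inner (mp k (ext_proj k) (factor_part G A k)) Y"
    by (subst inner_mode_op) (simp_all add: transpose_ext_proj assms)
  then show ?thesis by (simp add: ext_proj_factor_part_same)
qed

lemma inner_approx_proj:
  "inner A (approx_proj ix n q G U W A) = (norm (approx_proj ix n q G U W A))\<^sup>2"
proof -
  let ?C = "core_part A" and ?F = "factor_part G A"
  have FC: "inner (?F k) ?C = 0" for k by (rule inner_factor_part_eq_0[OF ext_proj_core_part])
  have CF: "inner ?C (?F k) = 0" for k using FC by (simp add: inner_commute)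
  have FF: "inner (?F k) (?F j) = (if j = k then (norm (?F k))\<^sup>2 else 0)" for k j
    using inner_factor_part_eq_0[OF ext_proj_factor_part_other] by (simp add: power2_norm_eq_inner)
  have "(norm (?C + (\<Sum>k\<in>UNIV. ?F k)))\<^sup>2 = inner ?C ?C + (\<Sum>k\<in>UNIV. \<Sum>j\<in>UNIV. inner (?F k) (?F j))"
    by (simp add: power2_norm_eq_inner inner_add inner_sum_left inner_sum_right FC CF) (rule sum.swap)
  also have "\<dots> = (norm ?C)\<^sup>2 + (\<Sum>k\<in>UNIV. (norm (?F k))\<^sup>2)"
    by (simp add: FF dot_square_norm)
  also have "\<dots> = inner A ?C + (\<Sum>k\<in>UNIV. inner A (?F k))"
  proof -
    have "inner A ?C = (norm ?C)\<^sup>2" unfolding core_part_def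
      by (rule inner_mode_ops_projection) (simp_all add: ext_proj_idem transpose_ext_proj)
    then show ?thesis by (simp add: factor_part_inner)
  qed
  finally show ?thesis by (simp add: approx_proj_eq inner_add_right inner_sum_right)
qed

end

section \<open>Descent of the single steps\<close>

lemma armijo_step_decrease:
  assumes "armijo_step f \<rho> a s\<^sub>m\<^sub>i\<^sub>n \<Phi> X g Y" "0 < a" "0 < s\<^sub>m\<^sub>i\<^sub>n"
    and "b \<le> inner (- gradient f X) g" "0 \<le> b"
  shows "f X - f Y \<ge> s\<^sub>m\<^sub>i\<^sub>n * a * b"
proof -
  obtain s where s: "s > s\<^sub>m\<^sub>i\<^sub>n" "f X - f Y \<ge> s * a * inner (- gradient f X) g"
    using assms(1) by (auto simp: armijo_step_def armijo_accept_def)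
  have "s\<^sub>m\<^sub>i\<^sub>n * a * b \<le> s * a * inner (- gradient f X) g"
    using s(1) assms by (intro mult_mono) auto
  then show ?thesis using s(2) by linarith
qed

lemma reduced_rank_le: "reduced_rank ix n \<Delta> X k \<le> rank_tc ix n X k"
proof -
  let ?\<sigma> = "singular_value (tensor_unfolding ix n k X)" and ?q = "rank_tc ix n X k"
  have "(LEAST i. ?\<sigma> (Suc i) < \<Delta> * ?\<sigma> 1) \<le> ?q" if less: "?\<sigma> ?q < \<Delta> * ?\<sigma> 1"
  proof (cases "?q")
    case 0
    \<comment> \<open>indices are shifted down by 1, so the natural number 0 also denotes the first singular value\<close>
    have "?\<sigma> 0 = ?\<sigma> (Suc 0)" by (simp add: singular_value_def)
    then have "?\<sigma> (Suc 0) < \<Delta> * ?\<sigma> 1" using less 0 by simp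
    then show ?thesis by (metis Least_le 0)
  next
    case (Suc i)
    then have "(LEAST i. ?\<sigma> (Suc i) < \<Delta> * ?\<sigma> 1) \<le> i" using less by (intro Least_le) simp
    then show ?thesis using Suc by simp
  qed
  then show ?thesis by (auto simp: reduced_rank_def Let_def not_le)
qed

context tensor_space
begin

text \<open>The factor \<open>U k\<close> of the truncation has \<open>q k\<close> columns, and the unfolding of \<open>Y\<close> in mode \<open>k\<close> factors
  through it.\<close>

lemma rk_hosvd_le:
  assumes "Y \<in> hosvd ix n q A"
  shows "rk Y k \<le> q k"
proof -
  obtain U where U: "\<And>k. U k \<in> leading_left_singular (q k) (unf k A)"
    and Y: "Y = mps (\<lambda>k. proj_mat (U k)) UNIV A"
    using assms by (auto simp: hosvd_def tensor_prods_eq_mode_ops)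
  have dims [simp]: "dim_row (U k) = n k" "dim_col (U k) = q k" for k
    using U[of k] by (auto simp: leading_left_singular_def)
  let ?V = "mps (\<lambda>k. proj_mat (U k)) (UNIV - {k}) A"
  have "Y = mp k (proj_mat (U k)) ?V"
    using mode_ops_insert[of k "UNIV - {k}" "\<lambda>k. proj_mat (U k)" A]
    by (simp add: insert_absorb Y proj_mat_def)
  then have "unf k Y = U k * (transpose_mat (U k) * unf k ?V)"
    by (simp add: unf_mode_op proj_mat_def mat_mult_assoc)
  then show ?thesis by (rule rk_le_dim_col) (auto intro!: carrier_matI)
qed

lemma rgd_result_descent:
  assumes "rgd_result ix n f \<rho> a s\<^sub>m\<^sub>i\<^sub>n \<Delta> \<epsilon> X0 X" "0 < a" "0 < s\<^sub>m\<^sub>i\<^sub>n"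
  shows "f X \<le> f X0" "rk X = rk X0"
proof -
  obtain Y N where Y: "Y 0 = X0" "Y N = X" "\<And>i. i \<le> N \<Longrightarrow> Y i \<in> rank_eq_set ix n (rk X0)"
    "\<And>i. i < N \<Longrightarrow> armijo_step f \<rho> a s\<^sub>m\<^sub>i\<^sub>n (hosvd ix n (rk X0))
             (Y i) (- riem_grad ix n f (Y i)) (Y (Suc i))"
    using assms(1) unfolding rgd_result_def by blast
  have step: "f (Y (Suc i)) \<le> f (Y i)" if "i < N" for i
  proof -
    have "inner (- gradient f (Y i)) (- riem_grad ix n f (Y i)) = (norm (riem_grad ix n f (Y i)))\<^sup>2"
      by (simp add: inner_riem_grad[OF riem_grad_in_tucker_tangent_space] power2_norm_eq_inner)
    then show ?thesis
      using armijo_step_decrease[where b = 0, OF Y(4)[OF that] assms(2,3)] by simp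
  qed
  have "i \<le> N \<Longrightarrow> f (Y i) \<le> f X0" for i
  proof (induction i)
    case (Suc i)
    then show ?case using step[of i] by simp
  qed (simp add: Y)
  then show "f X \<le> f X0" using Y(2) by blast
  show "rk X = rk X0" using Y(2) Y(3)[of N] by (auto simp: rank_eq_set_def)
qed

text \<open>At the rank of \<open>X\<close> itself the cone is the tangent space, where the gradient and the Riemannian gradient have the
  same inner products.\<close>

lemma nearest_point_norm_le_riem_grad:
  assumes "P \<in> nearest_points (tangent_cone (rank_le_set ix n (rk X)) X) (- gradient f X)"
  shows "norm P \<le> norm (riem_grad ix n f X)"
proof -
  have "P \<in> tucker_tangent_space X" using assms by (simp add: nearest_points_def tangent_cone_rank_le_set)
  then have "(norm P)\<^sup>2 = - inner (riem_grad ix n f X) P"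
    using nearest_point_cone_inner[OF assms tangent_cone_scale] by (simp add: inner_riem_grad)
  also have "\<dots> \<le> norm (riem_grad ix n f X) * norm P"
    using norm_cauchy_schwarz[of "- riem_grad ix n f X" P] by simp
  finally show ?thesis by (cases "norm P = 0") (auto simp: power2_eq_square)
qed

lemma inner_tensor_prods_proj_mat:
  assumes "\<And>k. V k \<in> stiefel (l k) (n k)"
  shows "inner Z (tensor_prods ix (\<lambda>k. proj_mat (V k)) Z) = (norm (tensor_prods ix (\<lambda>k. proj_mat (V k)) Z))\<^sup>2"
  unfolding tensor_prods_eq_mode_ops
  by (rule inner_mode_ops_projection) (simp_all add: proj_mat_stiefel[OF assms])

text \<open>For the direction \<open>g\<close>, the angle condition reads \<open>\<omega> * norm Q * norm g \<le> (norm g)\<^sup>2\<close>, because \<open>g\<close> is an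
  orthogonal projection of the negative gradient. Hence \<open>\<omega> * norm Q \<le> norm g\<close>. All nearest points of a cone have the
  same norm, so \<open>Q\<close> may be replaced by \<open>P\<close>.\<close>

lemma restart_step_decrease:
  assumes "restart_step ix n r f \<rho> a s\<^sub>m\<^sub>i\<^sub>n \<omega> G U X Y"
    and U: "\<And>k. U k \<in> stiefel (rk X k) (n k)"
    and P: "P \<in> nearest_points (tangent_cone (rank_le_set ix n r) X) (- gradient f X)"
    and pos: "0 < a" "0 < s\<^sub>m\<^sub>i\<^sub>n" "0 < \<omega>"
  shows "f X - f Y \<ge> s\<^sub>m\<^sub>i\<^sub>n * a * (\<omega>\<^sup>2 * (norm P)\<^sup>2)"
proof -
  obtain W where W: "\<And>k. W k \<in> stiefel (r k - rk X k) (n k)"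
    "\<And>k. transpose_mat (U k) * W k = 0\<^sub>m (rk X k) (r k - rk X k)"
    and g: "angle_condition ix n r f \<omega> X (approx_proj ix n (rk X) G U W (- gradient f X))"
      "armijo_step f \<rho> a s\<^sub>m\<^sub>i\<^sub>n (hosvd ix n r) X (approx_proj ix n (rk X) G U W (- gradient f X)) Y"
    using assms(1) by (auto simp: restart_step_def Let_def)
  interpret extended_factors ix n "rk X" r U W
    by unfold_locales (use U W in auto)
  define g where "g = approx_proj ix n (rk X) G U W (- gradient f X)"
  obtain Q where Q: "Q \<in> nearest_points (tangent_cone (rank_le_set ix n r) X) (- gradient f X)"
    "inner (- gradient f X) g \<ge> \<omega> * norm Q * norm g" "g = 0 \<Longrightarrow> Q = 0"
    using g(1) by (auto simp: angle_condition_def g_def)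
  have PQ: "norm P = norm Q" by (rule nearest_point_cone_norm_unique[OF P Q(1) tangent_cone_scale])
  have gg: "inner (- gradient f X) g = (norm g)\<^sup>2" unfolding g_def by (rule inner_approx_proj)
  have "\<omega> * norm Q \<le> norm g"
  proof (cases "g = 0")
    case False
    then show ?thesis using Q(2) unfolding gg by (simp add: power2_eq_square)
  qed (simp add: Q(3))
  then have "(\<omega> * norm Q)\<^sup>2 \<le> (norm g)\<^sup>2" using pos by (intro power_mono) auto
  then have "\<omega>\<^sup>2 * (norm P)\<^sup>2 \<le> inner (- gradient f X) g" unfolding gg PQ by (simp add: power_mult_distrib)
  then show ?thesis using armijo_step_decrease[OF g(2)[folded g_def] pos(1,2)] by simp
qed

text \<open>The constant in the last alternative covers rank increase, where \<open>norm P \<le> norm (gradient f X)\<close> and the two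
  acceptance tests give \<open>\<epsilon>\<^sub>1 * \<epsilon>\<^sub>2 * norm P \<le> norm N\<close>, and restart.\<close>

lemma tram_update_cases:
  assumes upd: "tram_update ix n r f \<rho> a s\<^sub>m\<^sub>i\<^sub>n \<rho>\<^sub>R \<epsilon>\<^sub>1 \<epsilon>\<^sub>2 \<Delta> \<rho>\<^sub>1 \<omega> \<l> X \<epsilon> X' \<epsilon>'"
    and stop: "rank_deficient ix n \<Delta> X \<or> norm (riem_grad ix n f X) \<le> \<epsilon>"
    and P: "P \<in> nearest_points (tangent_cone (rank_le_set ix n r) X) (- gradient f X)"
    and pos: "0 < a" "0 < s\<^sub>m\<^sub>i\<^sub>n" "0 < \<epsilon>\<^sub>1" "0 < \<epsilon>\<^sub>2" "0 < \<omega>"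
  shows "f X' \<le> f X \<and> (\<Sum>k\<in>UNIV. rk X' k) < (\<Sum>k\<in>UNIV. rk X k)
    \<or> X' = X \<and> \<epsilon>' = \<rho>\<^sub>R * \<epsilon> \<and> norm P \<le> max 1 (1 / \<epsilon>\<^sub>2) * \<epsilon>
    \<or> f X - f X' \<ge> s\<^sub>m\<^sub>i\<^sub>n * a * min ((\<epsilon>\<^sub>1 * \<epsilon>\<^sub>2)\<^sup>2) (\<omega>\<^sup>2) * (norm P)\<^sup>2"
proof -
  let ?T = "riem_grad ix n f X"
  have P_le: "norm P \<le> norm (gradient f X)"
    using nearest_point_cone_norm_le[OF P tangent_cone_scale] by simp
  consider (decrease) "rank_deficient ix n \<Delta> X" | (full) "\<not> rank_deficient ix n \<Delta> X" "rk X = r"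
    | (other) "\<not> rank_deficient ix n \<Delta> X" "rk X \<noteq> r" by blast
  then show ?thesis
  proof cases
    case decrease
    then have dec: "rank_decrease_step ix n f \<Delta> \<rho>\<^sub>1 X X'" "rk X' \<noteq> rk X"
      using upd by (auto simp: tram_update_def Let_def)
    then obtain \<Delta>' where X': "X' \<in> hosvd ix n (reduced_rank ix n \<Delta>' X) X" "f X' \<le> f X"
      by (auto simp: rank_decrease_step_def)
    have le: "rk X' k \<le> rk X k" for k
      using rk_hosvd_le[OF X'(1)] reduced_rank_le le_trans by blast
    moreover obtain k where "rk X' k \<noteq> rk X k" using dec(2) by blast
    ultimately have "(\<Sum>k\<in>UNIV. rk X' k) < (\<Sum>k\<in>UNIV. rk X k)"
      by (intro sum_strict_mono_ex1) (auto intro!: exI[of _ k] simp: order_less_le)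
    then show ?thesis using X'(2) by simp
  next
    case full
    then have "X' = X" "\<epsilon>' = \<rho>\<^sub>R * \<epsilon>" using upd by (auto simp: tram_update_def Let_def)
    moreover have "norm P \<le> \<epsilon>"
      using nearest_point_norm_le_riem_grad[of P X f] P full stop by simp
    then have "norm P \<le> max 1 (1 / \<epsilon>\<^sub>2) * \<epsilon>"
    proof -
      have "0 \<le> \<epsilon>" using \<open>norm P \<le> \<epsilon>\<close> norm_ge_zero order_trans by blast
      then have "1 * \<epsilon> \<le> max 1 (1 / \<epsilon>\<^sub>2) * \<epsilon>" by (intro mult_right_mono) auto
      then show ?thesis using \<open>norm P \<le> \<epsilon>\<close> by simp
    qed
    ultimately show ?thesis by simp
  next
    case other
    then obtain G U V where GU: "tucker_decomp ix n (rk X) X G U"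
      and VU: "\<forall>k. V k \<in> stiefel (\<l> k) (n k) \<and> transpose_mat (V k) * U k = 0\<^sub>m (\<l> k) (rk X k)"
      and step: "let N = tensor_prods ix (\<lambda>k. proj_mat (V k)) (- gradient f X) in
           if norm N \<ge> \<epsilon>\<^sub>1 * norm ?T \<and> \<epsilon>\<^sub>2 * norm (gradient f X) \<le> norm ?T then
             armijo_step f \<rho> a s\<^sub>m\<^sub>i\<^sub>n (\<lambda>Z. {Z}) X N X' \<and> \<epsilon>' = \<epsilon>
           else if \<epsilon>\<^sub>2 * norm (gradient f X) > norm ?T then
             restart_step ix n r f \<rho> a s\<^sub>m\<^sub>i\<^sub>n \<omega> G U X X' \<and> \<epsilon>' = \<epsilon>
           else X' = X \<and> \<epsilon>' = \<rho>\<^sub>R * \<epsilon>"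
      using upd by (auto simp: tram_update_def Let_def)
    then have V: "\<And>k. V k \<in> stiefel (\<l> k) (n k)" by blast
    define N where "N = tensor_prods ix (\<lambda>k. proj_mat (V k)) (- gradient f X)"
    have c: "s\<^sub>m\<^sub>i\<^sub>n * a * min ((\<epsilon>\<^sub>1 * \<epsilon>\<^sub>2)\<^sup>2) (\<omega>\<^sup>2) * (norm P)\<^sup>2 \<le> s\<^sub>m\<^sub>i\<^sub>n * a * (x * (norm P)\<^sup>2)"
      if "min ((\<epsilon>\<^sub>1 * \<epsilon>\<^sub>2)\<^sup>2) (\<omega>\<^sup>2) \<le> x" for x
      using pos that by (simp add: mult.assoc mult_left_mono mult_right_mono)
    consider (increase) "norm N \<ge> \<epsilon>\<^sub>1 * norm ?T" "\<epsilon>\<^sub>2 * norm (gradient f X) \<le> norm ?T"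
        "armijo_step f \<rho> a s\<^sub>m\<^sub>i\<^sub>n (\<lambda>Z. {Z}) X N X'"
      | (restart) "restart_step ix n r f \<rho> a s\<^sub>m\<^sub>i\<^sub>n \<omega> G U X X'"
      | (shrink) "\<epsilon>\<^sub>2 * norm (gradient f X) \<le> norm ?T" "X' = X" "\<epsilon>' = \<rho>\<^sub>R * \<epsilon>"
      using step unfolding Let_def N_def[symmetric] by (auto split: if_splits simp: not_less)
    then show ?thesis
    proof cases
      case increase
      have "\<epsilon>\<^sub>1 * \<epsilon>\<^sub>2 * norm P \<le> \<epsilon>\<^sub>1 * (\<epsilon>\<^sub>2 * norm (gradient f X))"
        using pos P_le by simp
      also have "\<dots> \<le> \<epsilon>\<^sub>1 * norm ?T" using pos increase(2) by simp
      also have "\<dots> \<le> norm N" by (rule increase(1))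
      finally have "(\<epsilon>\<^sub>1 * \<epsilon>\<^sub>2 * norm P)\<^sup>2 \<le> (norm N)\<^sup>2" using pos by (intro power_mono) auto
      then have "(\<epsilon>\<^sub>1 * \<epsilon>\<^sub>2)\<^sup>2 * (norm P)\<^sup>2 \<le> inner (- gradient f X) N"
        unfolding N_def inner_tensor_prods_proj_mat[OF V] by (simp add: power_mult_distrib)
      from armijo_step_decrease[OF increase(3) pos(1,2) this] c[of "(\<epsilon>\<^sub>1 * \<epsilon>\<^sub>2)\<^sup>2"]
      show ?thesis by simp
    next
      case restart
      have "\<And>k. U k \<in> stiefel (rk X k) (n k)" using GU unfolding tucker_decomp_def by blast
      from restart_step_decrease[OF restart this P pos(1,2,5)] c[of "\<omega>\<^sup>2"]
      show ?thesis by simp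
    next
      case shrink
      have "norm ?T \<le> \<epsilon>" using stop other by simp
      then have "\<epsilon>\<^sub>2 * norm P \<le> \<epsilon>" "0 \<le> \<epsilon>"
        using P_le shrink(1) pos mult_left_mono[OF P_le, of \<epsilon>\<^sub>2] norm_ge_zero[of ?T] by linarith+
      then have "norm P \<le> 1 / \<epsilon>\<^sub>2 * \<epsilon>" using pos by (simp add: field_simps)
      also have "\<dots> \<le> max 1 (1 / \<epsilon>\<^sub>2) * \<epsilon>" using \<open>0 \<le> \<epsilon>\<close> by (intro mult_right_mono) auto
      finally show ?thesis using shrink by simp
    qed
  qed
qed

end

section \<open>Convergence\<close>

text \<open>If \<open>p\<close> stays above \<open>\<delta> > 0\<close>, the third alternative eventually contradicts the convergence of \<open>F\<close>. Choosing \<open>t1\<close>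
  as a minimizer of \<open>s\<close> among the late indices excludes the first, and the geometric decay of \<open>\<epsilon>\<close> then
  contradicts the bound on \<open>p\<close>.\<close>

lemma liminf_eq_0_of_descent:
  fixes F p \<epsilon> :: "nat \<Rightarrow> real" and s :: "nat \<Rightarrow> nat"
  assumes F: "\<And>t. F (Suc t) \<le> F t" "\<And>t. B \<le> F t"
    and p: "\<And>t. 0 \<le> p t" and c: "0 < c" and q: "0 < q" "q < 1"
    and cases: "\<And>t. s (Suc t) < s t \<or>
      s (Suc t) = s t \<and> \<epsilon> (Suc t) = q * \<epsilon> t \<and> p t \<le> C * \<epsilon> t \<or>
      c * (p t)\<^sup>2 \<le> F t - F (Suc t)"
  shows "liminf (\<lambda>t. ereal (p t)) = 0"
proof (rule antisym)
  show "0 \<le> liminf (\<lambda>t. ereal (p t))"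
    by (rule Liminf_bounded) (use p in simp)
  show "liminf (\<lambda>t. ereal (p t)) \<le> 0"
  proof (rule ccontr)
    assume "\<not> liminf (\<lambda>t. ereal (p t)) \<le> 0"
    then obtain \<delta> where \<delta>: "0 < ereal \<delta>" "ereal \<delta> < liminf (\<lambda>t. ereal (p t))"
      using ereal_dense2[of 0 "liminf (\<lambda>t. ereal (p t))"] by (auto simp: not_le)
    then have \<delta>0: "0 < \<delta>" by simp
    have ev1: "eventually (\<lambda>t. \<delta> < p t) sequentially"
      using less_LiminfD[OF \<delta>(2)] by simp
    have "decseq F" using F(1) by (simp add: decseq_Suc_iff)
    then obtain L where L: "F \<longlonglongrightarrow> L" using F(2) decseq_convergent by metis
    have "(\<lambda>t. F t - F (Suc t)) \<longlonglongrightarrow> L - L" by (intro tendsto_diff L LIMSEQ_Suc)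
    then have ev2: "eventually (\<lambda>t. F t - F (Suc t) < c * \<delta>\<^sup>2) sequentially"
      using c \<delta>0 by (intro order_tendstoD(2)) auto
    obtain t0 where t0: "\<And>t. t \<ge> t0 \<Longrightarrow> \<delta> < p t \<and> F t - F (Suc t) < c * \<delta>\<^sup>2"
      using eventually_conj[OF ev1 ev2] by (auto simp: eventually_sequentially)
    have cases': "s (Suc t) < s t \<or> s (Suc t) = s t \<and> \<epsilon> (Suc t) = q * \<epsilon> t \<and> p t \<le> C * \<epsilon> t"
      if "t \<ge> t0" for t
    proof -
      have "c * \<delta>\<^sup>2 \<le> c * (p t)\<^sup>2"
        using t0[OF that] \<delta>0 c by (intro mult_left_mono power_mono) auto
      then show ?thesis using cases[of t] t0[OF that] by linarith
    qed
    obtain t1 where t1: "t1 \<ge> t0" "\<And>t. t \<ge> t0 \<Longrightarrow> s t1 \<le> s t"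
      using ex_has_least_nat[of "\<lambda>t. t \<ge> t0" t0 s] by auto
    have shrink: "s (t1 + j) = s t1 \<and> \<epsilon> (t1 + j) = q ^ j * \<epsilon> t1" for j
    proof (induction j)
      case (Suc j)
      have "\<not> s (Suc (t1 + j)) < s (t1 + j)"
        using Suc t1(2)[of "Suc (t1 + j)"] t1(1) by simp
      then show ?case using cases'[of "t1 + j"] t1(1) Suc by simp
    qed simp
    have "p (t1 + j) \<le> C * (q ^ j * \<epsilon> t1)" for j
    proof -
      have "\<not> s (Suc (t1 + j)) < s (t1 + j)"
        using shrink[of j] shrink[of "Suc j"] by simp
      then show ?thesis using cases'[of "t1 + j"] t1(1) shrink[of j] by simp
    qed
    then have bound: "\<delta> \<le> C * (q ^ j * \<epsilon> t1)" for j
      using t0[of "t1 + j"] t1(1) by (smt (verit) trans_le_add1)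
    have "(\<lambda>j. C * (q ^ j * \<epsilon> t1)) \<longlonglongrightarrow> C * (0 * \<epsilon> t1)"
      by (intro tendsto_mult tendsto_const LIMSEQ_power_zero) (use q in auto)
    then have "\<delta> \<le> C * (0 * \<epsilon> t1)" using bound by (intro LIMSEQ_le_const) auto
    then show False using \<delta>0 by simp
  qed
qed

theorem theorem5:
  fixes ix :: "'m::finite \<Rightarrow> 'd::finite \<Rightarrow> nat" and n r :: "'d \<Rightarrow> nat"
    and f :: "real ^ 'm \<Rightarrow> real" and fstar :: real
    and \<rho> a s\<^sub>m\<^sub>i\<^sub>n \<epsilon>\<^sub>0 \<rho>\<^sub>R \<epsilon>\<^sub>1 \<epsilon>\<^sub>2 \<Delta> \<rho>\<^sub>1 \<omega> :: real
    and \<l> :: "nat \<Rightarrow> 'd \<Rightarrow> nat"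
    and X P :: "nat \<Rightarrow> real ^ 'm"
  assumes "bij_betw ix UNIV (multi_indices n)"
    and "\<And>k. 1 \<le> r k \<and> r k \<le> n k"
    and "0 < \<rho>" "\<rho> < 1" "0 < a" "a < 1" "0 < s\<^sub>m\<^sub>i\<^sub>n"
    and "0 < \<epsilon>\<^sub>0" "0 < \<rho>\<^sub>R" "\<rho>\<^sub>R < 1" "0 < \<epsilon>\<^sub>1" "0 < \<epsilon>\<^sub>2"
    and "0 < \<Delta>" "\<Delta> < 1" "0 < \<rho>\<^sub>1" "\<rho>\<^sub>1 < 1" "0 < \<omega>" "\<omega> \<le> 1"
    and "\<And>t k. 1 \<le> \<l> t k"
    and "smooth_on UNIV f"
    and "\<And>Y. fstar \<le> f Y"
    and "\<And>t. X t \<in> rank_le_set ix n r"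
    and "tram_sequence ix n r f \<rho> a s\<^sub>m\<^sub>i\<^sub>n \<epsilon>\<^sub>0 \<rho>\<^sub>R \<epsilon>\<^sub>1 \<epsilon>\<^sub>2 \<Delta> \<rho>\<^sub>1 \<omega> \<l> X"
    and "\<And>t. P t \<in> nearest_points (tangent_cone (rank_le_set ix n r) (X t)) (- gradient f (X t))"
  shows "liminf (\<lambda>t. ereal (norm (P t))) = 0"
proof -
  interpret tensor_space ix n by unfold_locales (rule assms(1))
  obtain X0 \<epsilon> where rgd: "\<And>t. rgd_result ix n f \<rho> a s\<^sub>m\<^sub>i\<^sub>n \<Delta> (\<epsilon> t) (X0 t) (X t)"
    and upd: "\<And>t. tram_update ix n r f \<rho> a s\<^sub>m\<^sub>i\<^sub>n \<rho>\<^sub>R \<epsilon>\<^sub>1 \<epsilon>\<^sub>2 \<Delta> \<rho>\<^sub>1 \<omega> (\<l> t) (X t) (\<epsilon> t) (X0 (Suc t)) (\<epsilon> (Suc t))"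
    using assms(23) unfolding tram_sequence_def by blast
  note rgd_descent = rgd_result_descent[OF rgd \<open>0 < a\<close> \<open>0 < s\<^sub>m\<^sub>i\<^sub>n\<close>]
  define c where "c = s\<^sub>m\<^sub>i\<^sub>n * a * min ((\<epsilon>\<^sub>1 * \<epsilon>\<^sub>2)\<^sup>2) (\<omega>\<^sup>2)"
  have c: "0 < c" using assms(5,7,11,12,17) by (simp add: c_def)
  have steps: "f (X0 (Suc t)) \<le> f (X t) \<and> (\<Sum>k\<in>UNIV. rk (X0 (Suc t)) k) < (\<Sum>k\<in>UNIV. rk (X t) k)
    \<or> X0 (Suc t) = X t \<and> \<epsilon> (Suc t) = \<rho>\<^sub>R * \<epsilon> t \<and> norm (P t) \<le> max 1 (1 / \<epsilon>\<^sub>2) * \<epsilon> t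
    \<or> f (X t) - f (X0 (Suc t)) \<ge> c * (norm (P t))\<^sup>2" for t
  proof -
    have "rank_deficient ix n \<Delta> (X t) \<or> norm (riem_grad ix n f (X t)) \<le> \<epsilon> t"
      using rgd[of t] by (auto simp: rgd_result_def)
    from tram_update_cases[OF upd[of t] this assms(24) assms(5,7,11,12,17)]
    show ?thesis by (simp add: c_def)
  qed
  have cp: "0 \<le> c * (norm (P t))\<^sup>2" for t using c by simp
  show ?thesis
  proof (rule liminf_eq_0_of_descent[where F = "\<lambda>t. f (X t)" and s = "\<lambda>t. \<Sum>k\<in>UNIV. rk (X t) k"
        and \<epsilon> = \<epsilon> and q = \<rho>\<^sub>R and C = "max 1 (1 / \<epsilon>\<^sub>2)" and c = c and B = fstar])
    show "f (X (Suc t)) \<le> f (X t)" for t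
      using steps[of t] rgd_descent(1)[of "Suc t"] cp[of t] by auto
    show "(\<Sum>k\<in>UNIV. rk (X (Suc t)) k) < (\<Sum>k\<in>UNIV. rk (X t) k) \<or>
      (\<Sum>k\<in>UNIV. rk (X (Suc t)) k) = (\<Sum>k\<in>UNIV. rk (X t) k) \<and> \<epsilon> (Suc t) = \<rho>\<^sub>R * \<epsilon> t
        \<and> norm (P t) \<le> max 1 (1 / \<epsilon>\<^sub>2) * \<epsilon> t \<or>
      c * (norm (P t))\<^sup>2 \<le> f (X t) - f (X (Suc t))" for t
      using steps[of t] rgd_descent[of "Suc t"] by auto
  qed (use assms(9,10,21) c in auto)
qed

end
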